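(* For each positive integer $n$, let $G_n(z)=H_n\left(\tfrac12-iz\right)$ for $z\in\mathbb{R}$. A necessary and sufficient condition for the Riemann hypothesis is that $$\lambda_n=\frac{1}{2\pi}\,\Vert G_n\Vert_{L^2(\mathbb{R})}^2$$ holds for all positive integers $n$, where $\lambda_n$ is the $n$-th Li coefficient and $\Vert\cdot\Vert_{L^2(\mathbb{R})}$ is the norm of $L^2(\mathbb{R})$ with respect to Lebesgue measure, i.e. $\Vert G_n\Vert_{L^2(\mathbb{R})}^2=\int_{\mathbb{R}}|G_n(z)|^2\,dz$.
   Context: $\zeta(s)$ is the Riemann zeta function; the Riemann hypothesis is the statement that all nontrivial zeros $\rho$ of $\zeta(s)$ satisfy $\Re(\rho)=1/2$. The Li coefficients are $$\lambda_n:=\sum_{\rho}\left[1-\left(1-\frac1\rho\right)^n\right],$$ where $\rho$ runs over all nontrivial zeros of $\zeta(s)$ counted with multiplicity and $\sum_\rho=\lim_{T\to\infty}\sum_{|\Im(\rho)|\le T}$. The Riemann xi-function is the entire function $\xi(s):=\frac12 s(s-1)\pi^{-s/2}\Gamma\left(\frac s2\right)\zeta(s)$, and $\frac{\xi'}{\xi}(s)=\xi'(s)/\xi(s)$. The numbers $\eta_k$ are the coefficients of the Laurent expansion at $s=0$ $$-\frac{\zeta'}{\zeta}(s+1)=\frac1s+\sum_{k=0}^\infty \eta_k s^k .$$ For a positive integer $n$, $H_n(s)$ is the meromorphic function on $\mathbb{C}$ $$H_n(s):=\frac{\xi(s)}{\xi(s)+\xi'(s)}\Bigg\{\frac{1}{s-1}+\left[1-\left(1-\frac1s\right)^n\right]\left(\frac{\xi'}{\xi}(s)-\frac1{s-1}-\frac{\xi'}{\xi}(0)-1\right)-\sum_{j=2}^n\binom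 nj\frac{(-1)^{j-1}}{s^j}\sum_{k=1}^{j-1}\Big[(-1)^k\eta_k+(1-2^{-k-1})\zeta(k+1)\Big]s^k\Bigg\},$$ where the sum over $j$ is zero when $n=1$. Removable singularities of $H_n$ are understood to be removed. *)

theory Defs
  imports "HOL-Complex_Analysis.Complex_Analysis"
begin

(* The analytic continuation to \<complex> - {1} of the Dirichlet series, which is unique by the identity
   theorem. The clause f 1 = 0 only fixes a junk value at the pole. *)
definition zeta :: "complex \<Rightarrow> complex" where
  "zeta = (THE f. f holomorphic_on (- {1}) \<and>
                  (\<forall>s. Re s > 1 \<longrightarrow> f s = (\<Sum>n. 1 / of_nat (Suc n) powr s)) \<and>
                  f 1 = 0)"

(* The trivial zeros are -2, -4, -6, ... *)
definition nontrivial_zeta_zeros :: "complex set" where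
  "nontrivial_zeta_zeros =
     {\<rho>. \<rho> \<noteq> 1 \<and> zeta \<rho> = 0 \<and> \<not> (\<exists>k::nat. k \<ge> 1 \<and> \<rho> = - (2 * of_nat k))}"

definition riemann_hypothesis :: bool where
  "riemann_hypothesis \<longleftrightarrow> (\<forall>\<rho>\<in>nontrivial_zeta_zeros. Re \<rho> = 1 / 2)"

(* The factor zorder zeta \<rho> counts each zero with its multiplicity. *)
definition li_coeff :: "nat \<Rightarrow> complex" where
  "li_coeff n =
     Lim at_top (\<lambda>T::real. \<Sum>\<rho>\<in>{\<rho>\<in>nontrivial_zeta_zeros. \<bar>Im \<rho>\<bar> \<le> T}.
                   of_int (zorder zeta \<rho>) * (1 - (1 - 1 / \<rho>) ^ n))"

(* remove_sings supplies the values of the entire function at s = 1 (pole of zeta) and at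
   s = 0, -2, -4, ... (poles of Gamma (s / 2)), where the literal product is 0 in HOL. *)
definition riemann_xi :: "complex \<Rightarrow> complex" where
  "riemann_xi =
     remove_sings (\<lambda>s. 1 / 2 * s * (s - 1) * of_real pi powr (- s / 2) * Gamma (s / 2) * zeta s)"

definition xi_logderiv :: "complex \<Rightarrow> complex" where
  "xi_logderiv s = deriv riemann_xi s / riemann_xi s"

definition eta :: "nat \<Rightarrow> complex" where
  "eta k = fls_nth (laurent_expansion (\<lambda>s. - (deriv zeta (s + 1) / zeta (s + 1))) 0) (int k)"

definition H :: "nat \<Rightarrow> complex \<Rightarrow> complex" where
  "H n = remove_sings (\<lambda>s.
     riemann_xi s / (riemann_xi s + deriv riemann_xi s) *
       (1 / (s - 1)
        + (1 - (1 - 1 / s) ^ n) * (xi_logderiv s - 1 / (s - 1) - xi_logderiv 0 - 1)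
        - (\<Sum>j=2..n. of_nat (n choose j) * ((- 1) ^ (j - 1) / s ^ j) *
             (\<Sum>k=1..j-1. ((- 1) ^ k * eta k
                            + (1 - 1 / 2 ^ (k + 1)) * zeta (of_nat (k + 1))) * s ^ k))))"

definition G :: "nat \<Rightarrow> real \<Rightarrow> complex" where
  "G n z = H n (1 / 2 - \<i> * of_real z)"

end

theory Submission
  imports Defs "HOL-Real_Asymp.Real_Asymp"
begin

text \<open>
Let rho run over the zeros of xi with multiplicities m, let L = xi'/xi, and put
c(rho) = 1 - (1 - 1/rho)^n.

The equality implies the Riemann hypothesis because it makes every Li coefficient a nonnegative
real number. Their generating function is s^2 L(s) in the variable z = 1 - 1/s
(\<open>li_generating_function\<close>). A zero off the critical line, or its mirror image, gives a pole in
the unit disc. At a pole of minimal modulus the function would be unbounded along a radius, but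
nonnegative coefficients bound it by its values on the positive real axis, where it is regular
(\<open>RH_if_li_nonneg\<close>).

For the converse, the expression in braces in the definition of H is the sum of
m c(rho) / (s - rho) over the zeros (\<open>Li_bracket_has_sum\<close>), so that on the critical line G is a
combination of the functions D(s) / (s - rho), where D = xi / (xi + xi'). Under the Riemann
hypothesis Re L is nonnegative to the right of the line and zero on it. Hence |D| is at most 1 on
the right, and |D|^2 = Re D on the line, which turns inner products of these functions into
boundary integrals of holomorphic functions. Cauchy's formula shows that the functions are
orthogonal with squared norms pi/m (\<open>mode_norm\<close>, \<open>mode_orthogonal\<close>). Therefore the squared
norm of G is pi times the sum of m |c(rho)|^2. On the line |c(rho)|^2 = c(rho) + c(1 - rho), and so
this sum is twice the Li coefficient (\<open>li_coeff_eq_norm\<close>).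

Both directions use the expansion of L in partial fractions (\<open>L_partial_fractions\<close>). The theta
transformation formula, obtained as a limit of an identity between binomial coefficients and
cosines, represents xi by a power series in (s - 1/2)^2 that has nonnegative coefficients up to
elementary terms (\<open>completed_zeta_power_series\<close>). This yields the continuation, the functional
equation and the growth of xi. After division by the zeros in a large disc, the
Borel-Caratheodory inequality shows that the remaining logarithmic derivative is nearly constant,
and the symmetry about 1/2 makes the constant vanish in the limit. Positivity of the partial
fractions to the right of the zeros then gives the convergence of the sum of m / |rho|^2.
\<close>

section \<open>The transformation formula of the theta function\<close>

lemma root_of_unity_sum:
  fixes l :: nat and j :: int
  assumes l: "l > 0"
  shows "(\<Sum>v<l. cis (2 * pi * of_int j * real v / real l)) = (if int l dvd j then of_nat l else 0)"
proof (cases "int l dvd j")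
  case True
  then obtain k where k: "j = int l * k" by blast
  have "cis (2 * pi * of_int j * real v / real l) = 1" for v
  proof -
    have "2 * pi * of_int j * real v / real l = 2 * pi * of_int (k * int v)"
      using l by (simp add: k)
    then show ?thesis by (metis cis_multiple_2pi Ints_of_int)
  qed
  then show ?thesis using True by simp
next
  case False
  define w where "w = cis (2 * pi * of_int j / real l)"
  have w: "cis (2 * pi * of_int j * real v / real l) = w ^ v" for v
    by (simp add: w_def Complex.DeMoivre mult_ac)
  have wl: "w ^ l = 1"
  proof -
    have "w ^ l = cis (2 * pi * of_int j)"
      using l by (simp add: w_def Complex.DeMoivre)
    then show ?thesis by (metis cis_multiple_2pi Ints_of_int)
  qed
  have "w \<noteq> 1"
  proof
    assume "w = 1"
    then have "cos (2 * pi * of_int j / real l) = 1" by (simp add: w_def complex_eq_iff)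
    then obtain k :: int where "2 * pi * of_int j / real l = of_int k * 2 * pi"
      using cos_one_2pi_int by auto
    then have "real_of_int j = of_int (k * int l)" using l by (simp add: field_simps)
    then have "j = k * int l" by linarith
    with False show False by simp
  qed
  then have "(\<Sum>v<l. w ^ v) = 0" using wl by (simp add: geometric_sum)
  then show ?thesis using False by (simp add: w)
qed

text \<open>Polya's identity: expand (exp (it) + exp (-it))^(2m) and sum over l equidistant angles.
Orthogonality of the characters leaves the binomial coefficients whose index is congruent to m
modulo l.\<close>

lemma cosine_power_sum:
  fixes l m :: nat
  assumes l: "l > 0"
  shows "(\<Sum>v<l. (2 * cos (pi * real v / real l)) ^ (2 * m)) =
         real l * (\<Sum>k | k \<le> 2 * m \<and> int l dvd int k - int m. real (2 * m choose k))"
proof -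
  have 1: "complex_of_real ((2 * cos t) ^ (2 * m)) =
      (\<Sum>k\<le>2*m. of_nat (2 * m choose k) * cis (2 * (of_int (int k - int m) * t)))" for t :: real
  proof -
    have "complex_of_real (2 * cos t) = cis t + cis (- t)"
      by (simp add: complex_eq_iff)
    then have "complex_of_real ((2 * cos t) ^ (2 * m)) = (cis t + cis (- t)) ^ (2 * m)"
      by (metis of_real_power)
    also have "\<dots> = (\<Sum>k\<le>2*m. of_nat (2 * m choose k) * (cis t) ^ k * (cis (- t)) ^ (2 * m - k))"
      by (simp add: binomial_ring)
    also have "\<dots> = (\<Sum>k\<le>2*m. of_nat (2 * m choose k) * cis (2 * (of_int (int k - int m) * t)))"
    proof (rule sum.cong[OF refl])
      fix k assume "k \<in> {..2*m}"
      then have k: "k \<le> 2 * m" by simp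
      have "(cis t) ^ k * (cis (- t)) ^ (2 * m - k) = cis (2 * (of_int (int k - int m) * t))"
        using k by (simp only: Complex.DeMoivre cis_mult) (rule arg_cong[where f = cis], simp add: of_nat_diff algebra_simps)
      then show "of_nat (2 * m choose k) * (cis t) ^ k * (cis (- t)) ^ (2 * m - k)
        = of_nat (2 * m choose k) * cis (2 * (of_int (int k - int m) * t))"
        by (simp add: mult.assoc)
    qed
    finally show ?thesis .
  qed
  have "complex_of_real (\<Sum>v<l. (2 * cos (pi * real v / real l)) ^ (2 * m))
     = (\<Sum>v<l. \<Sum>k\<le>2*m. of_nat (2 * m choose k) * cis (2 * (of_int (int k - int m) * (pi * real v / real l))))"
    by (simp only: of_real_sum 1)
  also have "\<dots> = (\<Sum>k\<le>2*m. of_nat (2 * m choose k) *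
          (\<Sum>v<l. cis (2 * pi * of_int (int k - int m) * real v / real l)))"
    by (subst sum.swap) (simp add: sum_distrib_left mult_ac)
  also have "\<dots> = (\<Sum>k\<le>2*m. of_nat (2 * m choose k) * (if int l dvd int k - int m then of_nat l else 0))"
    by (simp only: root_of_unity_sum[OF l])
  also have "\<dots> = (\<Sum>k | k \<le> 2 * m \<and> int l dvd int k - int m. of_nat (2 * m choose k) * of_nat l)"
    by (rule sum.mono_neutral_cong_right) auto
  also have "\<dots> = complex_of_real (real l * (\<Sum>k | k \<le> 2 * m \<and> int l dvd int k - int m. real (2 * m choose k)))"
    by (simp add: sum_distrib_left mult_ac)
  finally show ?thesis by (simp only: of_real_eq_iff)
qed

lemma binomial_progression_sum:
  fixes l m :: nat
  assumes l: "l > 0"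
  shows "(\<Sum>k | k \<le> 2 * m \<and> int l dvd int k - int m. real (2 * m choose k)) =
         real (2 * m choose m) + 2 * (\<Sum>j<m. real (2 * m choose (m + l * Suc j)))"
proof -
  define J where "J = {j. l * Suc j \<le> m}"
  have lj: "j < m" if "l * Suc j \<le> m" for j
  proof -
    have "1 * Suc j \<le> l * Suc j" using l by (intro mult_le_mono) simp_all
    with that show ?thesis by (metis Suc_le_lessD mult_1 order_trans)
  qed
  have finJ: "finite J" by (rule finite_subset[of _ "{..<m}"]) (auto simp: J_def lj)
  have eq: "{k. k \<le> 2 * m \<and> int l dvd int k - int m} =
        {m} \<union> ((\<lambda>j. m + l * Suc j) ` J \<union> (\<lambda>j. m - l * Suc j) ` J)"
  proof (intro equalityI subsetI)
    fix k assume "k \<in> {k. k \<le> 2 * m \<and> int l dvd int k - int m}"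
    then have k: "k \<le> 2 * m" "int l dvd int k - int m" by auto
    consider "k = m" | "k > m" | "k < m" by linarith
    then show "k \<in> {m} \<union> ((\<lambda>j. m + l * Suc j) ` J \<union> (\<lambda>j. m - l * Suc j) ` J)"
    proof cases
      case 2
      then have "int k - int m = int (k - m)" by simp
      then have "l dvd k - m" using k(2) by (metis int_dvd_int_iff)
      then obtain i where i: "k - m = l * i" by blast
      with 2 obtain j where "i = Suc j" by (cases i) auto
      with i 2 k(1) show ?thesis by (auto simp: J_def intro!: image_eqI[of _ _ j])
    next
      case 3
      then have "- (int k - int m) = int (m - k)" by simp
      then have "l dvd m - k" using k(2) by (metis int_dvd_int_iff dvd_minus_iff)
      then obtain i where i: "m - k = l * i" by blast
      with 3 obtain j where "i = Suc j" by (cases i) auto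
      then have "m - k = l * Suc j" using i by simp
      with 3 have "k = m - l * Suc j" "j \<in> J" unfolding J_def mem_Collect_eq by linarith+
      then show ?thesis by blast
    qed auto
  next
    fix k assume "k \<in> {m} \<union> ((\<lambda>j. m + l * Suc j) ` J \<union> (\<lambda>j. m - l * Suc j) ` J)"
    then consider "k = m" | j where "j \<in> J" "k = m + l * Suc j" | j where "j \<in> J" "k = m - l * Suc j"
      by blast
    then show "k \<in> {k. k \<le> 2 * m \<and> int l dvd int k - int m}"
    proof cases
      case 2
      then have "int k - int m = int l * int (Suc j)" by (simp add: algebra_simps)
      with 2 show ?thesis by (simp add: J_def)
    next
      case 3
      then have "int k - int m = int l * (- int (Suc j))"
        by (simp add: J_def of_nat_diff algebra_simps)
      with 3 show ?thesis by (simp only: mem_Collect_eq) (auto simp: J_def)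
    qed simp
  qed
  have pos: "l * Suc j > 0" for j using l by simp
  have inj1: "inj_on (\<lambda>j. m + l * Suc j) J" using l by (auto simp: inj_on_def)
  have inj2: "inj_on (\<lambda>j. m - l * Suc j) J"
  proof (rule inj_onI)
    fix i j assume "i \<in> J" "j \<in> J" and e: "m - l * Suc i = m - l * Suc j"
    then have "l * Suc i \<le> m" "l * Suc j \<le> m" by (auto simp: J_def)
    with e have "l * Suc i = l * Suc j" by linarith
    then show "i = j" using l by simp
  qed
  have sym: "(2 * m choose (m - l * Suc j)) = (2 * m choose (m + l * Suc j))" if "j \<in> J" for j
  proof -
    have "l * Suc j \<le> m" using that by (simp add: J_def)
    then show ?thesis using binomial_symmetric[of "m - l * Suc j" "2 * m"] by (simp add: algebra_simps)
  qed
  have d1: "m \<notin> (\<lambda>j. m + l * Suc j) ` J \<union> (\<lambda>j. m - l * Suc j) ` J"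
  proof
    assume "m \<in> (\<lambda>j. m + l * Suc j) ` J \<union> (\<lambda>j. m - l * Suc j) ` J"
    then obtain j where "j \<in> J" "m = m + l * Suc j \<or> m = m - l * Suc j" by blast
    with pos[of j] show False unfolding J_def mem_Collect_eq by linarith
  qed
  have d2: "(\<lambda>j. m + l * Suc j) ` J \<inter> (\<lambda>j. m - l * Suc j) ` J = {}"
  proof (rule ccontr)
    assume "\<not> ?thesis"
    then obtain i j where "m + l * Suc i = m - l * Suc j" by blast
    with pos[of i] show False by linarith
  qed
  have "(\<Sum>k | k \<le> 2 * m \<and> int l dvd int k - int m. real (2 * m choose k)) =
     real (2 * m choose m) + ((\<Sum>j\<in>J. real (2 * m choose (m + l * Suc j)))
       + (\<Sum>j\<in>J. real (2 * m choose (m - l * Suc j))))"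
    unfolding eq using finJ d1 d2
    by (subst sum.union_disjoint sum.union_disjoint[OF _ _ d2])
       (auto simp: sum.reindex[OF inj1] sum.reindex[OF inj2] sum.union_disjoint[OF _ _ d2] simp del: mult_Suc_right)
  also have "\<dots> = real (2 * m choose m) + 2 * (\<Sum>j\<in>J. real (2 * m choose (m + l * Suc j)))"
    using sum.cong[OF HOL.refl arg_cong[where f = real, OF sym], of J "\<lambda>j. j"] by simp
  also have "(\<Sum>j\<in>J. real (2 * m choose (m + l * Suc j))) = (\<Sum>j<m. real (2 * m choose (m + l * Suc j)))"
    by (rule sum.mono_neutral_left) (auto simp: J_def lj)
  finally show ?thesis .
qed

lemma sum_lessThan_add:
  fixes f :: "nat \<Rightarrow> 'a::comm_monoid_add"
  shows "(\<Sum>v<p + n. f v) = (\<Sum>v<p. f v) + (\<Sum>v<n. f (p + v))"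
  by (induction n) (simp_all add: add.assoc)

text \<open>A theta transformation before the limit. When l is odd and m has order l^2, the powers of
cosines on the left and the ratios of binomial coefficients on the right both tend to Gaussian
terms.\<close>

lemma theta_finite_identity:
  fixes p m :: nat
  defines "l \<equiv> 2 * p + 1"
  shows "1 + 2 * (\<Sum>v<p. cos (pi * real (Suc v) / real l) ^ (2 * m)) =
     real l * (real (2 * m choose m) / 4 ^ m) *
       (1 + 2 * (\<Sum>j<m. real (2 * m choose (m + l * Suc j)) / real (2 * m choose m)))"
proof -
  have l: "l > 0" by (simp add: l_def)
  define f where "f v = cos (pi * real v / real l) ^ (2 * m)" for v
  have refl: "f (l - v) = f v" if "v \<le> l" for v
  proof -
    have "pi * real (l - v) / real l = pi - pi * real v / real l"
      using that l by (simp add: of_nat_diff field_simps)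
    then show ?thesis by (simp add: f_def cos_diff power_minus_even)
  qed
  have "(\<Sum>v<l. f v) = f 0 + (\<Sum>v<2*p. f (Suc v))"
    unfolding l_def by (simp add: sum.lessThan_Suc_shift del: sum.lessThan_Suc)
  also have "(\<Sum>v<2*p. f (Suc v)) = (\<Sum>v<p. f (Suc v)) + (\<Sum>v<p. f (Suc (p + v)))"
    using sum_lessThan_add[of "\<lambda>v. f (Suc v)" p p] by (simp add: mult_2)
  also have "(\<Sum>v<p. f (Suc (p + v))) = (\<Sum>v<p. f (Suc (p + (p - Suc v))))"
    by (subst sum.nat_diff_reindex[symmetric]) simp
  also have "\<dots> = (\<Sum>v<p. f (Suc v))"
  proof (rule sum.cong[OF HOL.refl])
    fix v assume "v \<in> {..<p}"
    then have "Suc (p + (p - Suc v)) = l - Suc v" "Suc v \<le> l" by (auto simp: l_def)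
    then show "f (Suc (p + (p - Suc v))) = f (Suc v)" using refl by metis
  qed
  finally have "(\<Sum>v<l. f v) = 1 + 2 * (\<Sum>v<p. f (Suc v))" by (simp add: f_def)
  moreover have "(\<Sum>v<l. (2 * cos (pi * real v / real l)) ^ (2 * m)) = 4 ^ m * (\<Sum>v<l. f v)"
    by (simp add: f_def power_mult_distrib sum_distrib_left power_mult)
  ultimately have "4 ^ m * (1 + 2 * (\<Sum>v<p. f (Suc v))) =
      real l * (real (2 * m choose m) + 2 * (\<Sum>j<m. real (2 * m choose (m + l * Suc j))))"
    using cosine_power_sum[OF l, of m] binomial_progression_sum[OF l, of m] by simp
  moreover have "real (2 * m choose m) \<noteq> 0" by simp
  ultimately show ?thesis
    unfolding f_def by (simp add: field_simps sum_distrib_left sum_divide_distrib del: mult_Suc_right)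
qed


lemma gbinomial_minus_half:
  "(- (1 / 2 :: real) gchoose n) = (- 1) ^ n * real (2 * n choose n) / 4 ^ n"
proof -
  have B: "real (2 * n choose n) = fact (2 * n) / (fact n * fact n)" for n
    by (subst binomial_fact) (simp_all add: mult_2)
  have "(- (1 / 2 :: real) gchoose n) = (- 1) ^ n * (fact (2 * n) / (fact n * fact n)) / 4 ^ n"
  proof (induction n)
    case (Suc n)
    define F f where "F = (fact (2 * n) :: real)" and "f = (fact n :: real)"
    have f: "f \<noteq> 0" by (simp add: f_def)
    have "(- (1 / 2 :: real) gchoose Suc n) = (- (1 / 2) gchoose n) * ((- (1 / 2) - real n) / (real n + 1))"
      by (simp add: gbinomial_prod_rev)
    also have "\<dots> = (- 1) ^ n * (F / (f * f)) / 4 ^ n * ((- (1 / 2) - real n) / (real n + 1))"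
      by (simp only: Suc.IH F_def f_def)
    also have "\<dots> = (- 1) ^ Suc n * ((2 * (real n + 1) * (2 * real n + 1) * F) / (((real n + 1) * f) * ((real n + 1) * f))) / 4 ^ Suc n"
      using f by (simp add: divide_simps) (simp add: algebra_simps)
    also have "2 * (real n + 1) * (2 * real n + 1) * F = fact (2 * Suc n)"
      by (simp add: F_def algebra_simps)
    also have "(real n + 1) * f = fact (Suc n)"
      by (simp add: f_def algebra_simps)
    finally show ?case .
  qed simp
  then show ?thesis by (simp only: B)
qed

text \<open>Wallis' asymptotics, read off from the asymptotics of the generalised binomial coefficients of
-1/2, which are the central ones up to (-4)^n.\<close>

lemma central_binomial_asymptotic:
  "(\<lambda>n. sqrt (real n) * (real (2 * n choose n) / 4 ^ n)) \<longlonglongrightarrow> 1 / sqrt pi"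
proof (rule Lim_transform_eventually)
  show "(\<lambda>n. ((- 1 / 2 :: real) gchoose n) / ((-1) ^ n / exp ((- 1 / 2 + 1) * of_real (ln (real n)))))
      \<longlonglongrightarrow> 1 / sqrt pi"
    using gbinomial_asymptotic[of "- 1 / 2 :: real"] by (simp add: Gamma_one_half_real inverse_eq_divide)
  show "\<forall>\<^sub>F n in sequentially. ((- 1 / 2 :: real) gchoose n) / ((-1) ^ n / exp ((- 1 / 2 + 1) * of_real (ln (real n))))
      = sqrt (real n) * (real (2 * n choose n) / 4 ^ n)"
    using eventually_gt_at_top[of 0]
  proof eventually_elim
    case (elim n)
    have "exp ((- 1 / 2 + 1) * ln (real n)) = sqrt (real n)"
      using elim by (simp add: powr_half_sqrt[symmetric] powr_def)
    then show ?case by (simp add: gbinomial_minus_half)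
  qed
qed

lemma binomial_ratio_prod:
  fixes m r :: nat
  assumes r: "r \<le> m"
  shows "real (2 * m choose (m + r)) / real (2 * m choose m) = (\<Prod>i<r. 1 - real r / real (m + 1 + i))"
proof -
  have F: "(fact (a + n) :: real) = fact a * (\<Prod>i<n. real (a + 1 + i))" for a n :: nat
    by (induction n) (simp_all add: algebra_simps)
  have "real (2 * m choose m) = fact (2 * m) / (fact m * fact m)"
    by (subst binomial_fact) (simp_all add: mult_2)
  moreover have "real (2 * m choose (m + r)) = fact (2 * m) / (fact (m + r) * fact (m - r))"
    using r by (subst binomial_fact) (simp_all add: mult_2)
  ultimately have "real (2 * m choose (m + r)) / real (2 * m choose m) =
      (fact m / fact (m - r)) / (fact (m + r) / fact m)"
    by (simp add: field_simps)
  also have "fact m / (fact (m - r) :: real) = (\<Prod>i<r. real (m - r + 1 + i))"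
    using F[of "m - r" r] r by simp
  also have "fact (m + r) / (fact m :: real) = (\<Prod>i<r. real (m + 1 + i))"
    using F[of m r] by simp
  also have "(\<Prod>i<r. real (m - r + 1 + i)) / (\<Prod>i<r. real (m + 1 + i)) =
      (\<Prod>i<r. real (m - r + 1 + i) / real (m + 1 + i))"
    by (simp add: prod_dividef)
  also have "\<dots> = (\<Prod>i<r. 1 - real r / real (m + 1 + i))"
    using r by (intro prod.cong) (auto simp: field_simps of_nat_diff)
  finally show ?thesis .
qed

text \<open>Every factor of the product is at most exp (-r / (m + r)). The bound is uniform in r, so it
dominates the whole sum; together with the lower bound below it also determines the limit of
each single ratio, since r^2 / (m + r) and r^2 / (m - r) have the same limit when r / m tends to
0.\<close>

lemma binomial_ratio_le:
  fixes m r :: nat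
  assumes r: "r \<le> m"
  shows "real (2 * m choose (m + r)) / real (2 * m choose m) \<le> exp (- (real r)\<^sup>2 / real (m + r))"
proof (cases "r = 0")
  case False
  have "(\<Prod>i<r. 1 - real r / real (m + 1 + i)) \<le> (\<Prod>i<r. exp (- real r / real (m + r)))"
  proof (rule prod_mono)
    fix i assume "i \<in> {..<r}"
    then have i: "i < r" by simp
    have "real r / real (m + r) \<le> real r / real (m + 1 + i)"
      using i False by (intro divide_left_mono) auto
    moreover have "1 + (- real r / real (m + r)) \<le> exp (- real r / real (m + r))"
      by (rule exp_ge_add_one_self)
    moreover have "real r / real (m + 1 + i) \<le> 1" using r by simp
    ultimately show "0 \<le> 1 - real r / real (m + 1 + i) \<and>
       1 - real r / real (m + 1 + i) \<le> exp (- real r / real (m + r))" by simp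
  qed
  also have "\<dots> = exp (real r * (- real r / real (m + r)))" by (simp flip: exp_of_nat_mult)
  finally show ?thesis by (simp add: binomial_ratio_prod[OF r] power2_eq_square)
qed simp

lemma binomial_ratio_ge:
  fixes m r :: nat
  assumes r: "r < m"
  shows "real (2 * m choose (m + r)) / real (2 * m choose m) \<ge> exp (- (real r)\<^sup>2 / (real m - real r))"
proof -
  have "(\<Prod>i<r. exp (- real r / (real m - real r))) \<le> (\<Prod>i<r. 1 - real r / real (m + 1 + i))"
  proof (rule prod_mono)
    fix i assume "i \<in> {..<r}"
    have "exp (real r / (real m - real r)) \<ge> 1 + real r / (real m - real r)"
      by (rule exp_ge_add_one_self)
    also have "1 + real r / (real m - real r) = inverse (1 - real r / real m)"
      using r by (simp add: field_simps)
    finally have "inverse (exp (real r / (real m - real r))) \<le> inverse (inverse (1 - real r / real m))"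
      using r by (intro le_imp_inverse_le) simp_all
    also have "\<dots> = 1 - real r / real m" by simp
    also have "\<dots> \<le> 1 - real r / real (m + 1 + i)"
      using r by (auto intro!: divide_left_mono)
    finally show "0 \<le> exp (- real r / (real m - real r)) \<and>
        exp (- real r / (real m - real r)) \<le> 1 - real r / real (m + 1 + i)"
      by (simp add: exp_minus)
  qed
  moreover have "(\<Prod>i<r. exp (- real r / (real m - real r))) = exp (real r * (- real r / (real m - real r)))"
    by (simp flip: exp_of_nat_mult)
  ultimately show ?thesis using r by (simp add: binomial_ratio_prod power2_eq_square)
qed

definition theta_tail :: "real \<Rightarrow> real" where
  "theta_tail x = (\<Sum>n. exp (- pi * (real (Suc n))\<^sup>2 * x))"

lemma summable_exp_Suc:
  assumes "k > (0::real)"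
  shows "summable (\<lambda>n. exp (- k * real (Suc n)))"
proof -
  have "summable (\<lambda>n. (exp (- k)) ^ n)" using assms by (intro summable_geometric) auto
  then have "summable (\<lambda>n. (exp (- k)) ^ Suc n)" by (subst summable_Suc_iff)
  also have "(\<lambda>n. (exp (- k)) ^ Suc n) = (\<lambda>n. exp (- k * real (Suc n)))"
    by (subst exp_of_nat_mult[symmetric]) (simp add: mult.commute)
  finally show ?thesis .
qed

lemma summable_theta_tail:
  assumes "x > 0"
  shows "summable (\<lambda>n. exp (- pi * (real (Suc n))\<^sup>2 * x))"
proof (rule summable_comparison_test')
  show "summable (\<lambda>n. exp (- (pi * x) * real (Suc n)))"
    using assms by (intro summable_exp_Suc) auto
  fix n :: nat
  have "real (Suc n) \<le> (real (Suc n))\<^sup>2" by (intro self_le_power) auto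
  then have "pi * x * real (Suc n) \<le> pi * x * (real (Suc n))\<^sup>2"
    using assms by (intro mult_left_mono) auto
  then show "norm (exp (- pi * (real (Suc n))\<^sup>2 * x)) \<le> exp (- (pi * x) * real (Suc n))"
    by (simp add: algebra_simps)
qed

text \<open>A Gaussian majorant on the whole range of angles. The constant 1/6 instead of 1/2 leaves room
for estimating the fourth-order Taylor term crudely.\<close>

lemma cos_le_exp:
  fixes y :: real
  assumes "0 \<le> y" "y \<le> pi / 2"
  shows "cos y \<le> exp (- y\<^sup>2 / 6)"
proof -
  have "cos y \<le> 1 - y\<^sup>2 / 6"
  proof (cases "y = 0")
    case False
    then have y0: "y > 0" using assms by simp
    obtain t where t: "0 < t" "t < y" and e: "cos y = (\<Sum>m<4. cos_coeff m * y ^ m) + (cos (t + 1/2 * real 4 * pi) / fact 4) * y ^ 4"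
      using Maclaurin_cos_expansion2[OF y0, of 4] by auto
    have "cos y \<le> 1 - y\<^sup>2 / 2 + y ^ 4 / 24"
    proof -
      have "cos (t + 1/2 * real 4 * pi) / fact 4 * y ^ 4 \<le> 1 / 24 * y ^ 4"
        by (intro mult_right_mono) (auto simp: fact_numeral)
      moreover have "(\<Sum>m<4. cos_coeff m * y ^ m) = 1 - y\<^sup>2 / 2"
        by (simp add: lessThan_nat_numeral cos_coeff_def)
      ultimately show ?thesis using e by linarith
    qed
    moreover have "y ^ 4 / 24 \<le> y\<^sup>2 / 3"
    proof -
      have "y \<le> 2" using assms pi_less_4 by linarith
      then have "y\<^sup>2 \<le> 2\<^sup>2" using y0 by (intro power_mono) auto
      then have "y\<^sup>2 * y\<^sup>2 \<le> y\<^sup>2 * 4" by (intro mult_left_mono) auto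
      then show ?thesis using zero_le_power2[of y] unfolding power4_eq_xxxx power2_eq_square mult.assoc by linarith
    qed
    ultimately show ?thesis by linarith
  qed simp
  also have "\<dots> \<le> exp (- y\<^sup>2 / 6)" using exp_ge_add_one_self[of "- y\<^sup>2 / 6"] by simp
  finally show ?thesis .
qed

text \<open>Put m = floor (c l^2) with l = 2p + 1 in the finite identity and let p tend to infinity.
Tannery's theorem allows the limit termwise on both sides, and the central binomial coefficient,
multiplied by l / 4^m, contributes the factor 1 / sqrt x.\<close>

theorem theta_transformation:
  fixes x :: real
  assumes x: "x > 0"
  shows "1 + 2 * theta_tail x = (1 + 2 * theta_tail (1 / x)) / sqrt x"
proof -
  \<comment> \<open>With this value exp (-pi^2 c v^2) and exp (-j^2 / c) are the theta terms at x and at 1/x.\<close>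
  define c where "c = x / pi"
  have c: "c > 0" using x by (simp add: c_def)
  define l where "l p = 2 * p + 1" for p :: nat
  define m where "m p = nat \<lfloor>c * (real (l p))\<^sup>2\<rfloor>" for p
  have lim_l: "filterlim (\<lambda>p. real (l p)) at_top sequentially"
    unfolding l_def by real_asymp
  have m_le: "real (m p) \<le> c * (real (l p))\<^sup>2" for p
    unfolding m_def using c by (simp add: of_nat_nat)
  have m_ge: "real (m p) \<ge> c * (real (l p))\<^sup>2 - 1" for p
    unfolding m_def using c by (simp add: of_nat_nat)
  have lpos: "real (l p) > 0" for p by (simp add: l_def)
  have l_lim: "(\<lambda>p. 1 / real (l p)) \<longlonglongrightarrow> 0" unfolding l_def by real_asymp
  have m_lim: "(\<lambda>p. real (m p) / (real (l p))\<^sup>2) \<longlonglongrightarrow> c"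
  proof (rule tendsto_sandwich)
    show "\<forall>\<^sub>F p in sequentially. c - (1 / real (l p))\<^sup>2 \<le> real (m p) / (real (l p))\<^sup>2"
    proof (intro always_eventually allI)
      fix p
      have "c - (1 / real (l p))\<^sup>2 = (c * (real (l p))\<^sup>2 - 1) / (real (l p))\<^sup>2"
        using lpos[of p] by (simp add: diff_divide_distrib power_divide)
      then show "c - (1 / real (l p))\<^sup>2 \<le> real (m p) / (real (l p))\<^sup>2"
        using m_ge[of p] by (simp add: divide_right_mono)
    qed
    show "\<forall>\<^sub>F p in sequentially. real (m p) / (real (l p))\<^sup>2 \<le> c"
      using m_le lpos by (intro always_eventually allI) (simp add: divide_le_eq)
    have "(\<lambda>p. c - (1 / real (l p))\<^sup>2) \<longlonglongrightarrow> c - 0\<^sup>2"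
      by (intro tendsto_intros l_lim)
    then show "(\<lambda>p. c - (1 / real (l p))\<^sup>2) \<longlonglongrightarrow> c" by simp
  qed simp
  have mlim': "filterlim m at_top sequentially"
  proof -
    have "filterlim (\<lambda>p. (real (m p) / (real (l p))\<^sup>2) * (real (l p))\<^sup>2) at_top sequentially"
      by (rule filterlim_tendsto_pos_mult_at_top[OF m_lim c filterlim_pow_at_top[OF _ lim_l]]) simp
    also have "(\<lambda>p. (real (m p) / (real (l p))\<^sup>2) * (real (l p))\<^sup>2) = (\<lambda>p. real (m p))"
      using lpos by (auto simp: fun_eq_iff)
    finally have "filterlim (\<lambda>p. real (m p)) at_top sequentially" .
    then show ?thesis
      by (simp add: filterlim_sequentially_iff_filterlim_real)
  qed
  \<comment> \<open>The terms are the exponentials of 2 (m/l^2) (l^2 ln (cos (k/l))), and l^2 ln (cos (k/l))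
    tends to -k^2/2.\<close>
  define a where "a v p = (if v < p then cos (pi * real (Suc v) / real (l p)) ^ (2 * m p) else 0)" for v p
  have a_lim: "(\<lambda>p. a v p) \<longlonglongrightarrow> exp (- pi * (real (Suc v))\<^sup>2 * x)" for v
  proof (rule Lim_transform_eventually)
    define k where "k = pi * real (Suc v)"
    have "k > 0" by (simp add: k_def)
    have "(\<lambda>p. (real (l p))\<^sup>2 * ln (cos (k / real (l p)))) \<longlonglongrightarrow> - k\<^sup>2 / 2"
    proof -
      have "((\<lambda>y. y\<^sup>2 * ln (cos (k / y))) \<longlongrightarrow> - k\<^sup>2 / 2) at_top"
        using \<open>k > 0\<close> by real_asymp (simp add: field_simps power2_eq_square)
      then show ?thesis using lim_l by (rule filterlim_compose)
    qed
    from tendsto_mult[OF m_lim this]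
    have "(\<lambda>p. exp (2 * (real (m p) / (real (l p))\<^sup>2 * ((real (l p))\<^sup>2 * ln (cos (k / real (l p)))))))
        \<longlonglongrightarrow> exp (2 * (c * (- k\<^sup>2 / 2)))"
      by (intro tendsto_exp tendsto_mult[OF tendsto_const])
    also have "exp (2 * (c * (- k\<^sup>2 / 2))) = exp (- pi * (real (Suc v))\<^sup>2 * x)"
      by (simp add: k_def c_def power2_eq_square)
    finally show "(\<lambda>p. exp (2 * (real (m p) / (real (l p))\<^sup>2 * ((real (l p))\<^sup>2 * ln (cos (k / real (l p)))))))
      \<longlonglongrightarrow> exp (- pi * (real (Suc v))\<^sup>2 * x)" .
    show "\<forall>\<^sub>F p in sequentially. exp (2 * (real (m p) / (real (l p))\<^sup>2 * ((real (l p))\<^sup>2 * ln (cos (k / real (l p))))))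
        = a v p"
      using eventually_gt_at_top[of v]
    proof eventually_elim
      case (elim p)
      have "real (2 * Suc v) < real (l p)" using elim by (simp add: l_def)
      then have "pi * real (2 * Suc v) < pi * real (l p)" by (intro mult_strict_left_mono) auto
      then have "k / real (l p) < pi / 2" "k / real (l p) > 0"
        using lpos[of p] \<open>k > 0\<close> by (simp_all add: k_def field_simps)
      then have "cos (k / real (l p)) > 0" by (intro cos_gt_zero_pi) auto
      then have "cos (k / real (l p)) ^ (2 * m p) = exp (real (2 * m p) * ln (cos (k / real (l p))))"
        by (subst exp_of_nat_mult) simp
      then show ?case using elim lpos[of p] by (simp add: a_def k_def power2_eq_square field_simps)
    qed
  qed
  have a_bound: "\<forall>\<^sub>F p in sequentially. \<forall>v. norm (a v p) \<le> exp (- (c * pi\<^sup>2 / 6) * real (Suc v))"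
  proof -
    have "\<forall>\<^sub>F p in sequentially. real (m p) / (real (l p))\<^sup>2 > c / 2"
      using m_lim c by (intro order_tendstoD(1)[OF m_lim]) auto
    then show ?thesis
    proof eventually_elim
      case (elim p)
      show ?case
      proof
        fix v
        show "norm (a v p) \<le> exp (- (c * pi\<^sup>2 / 6) * real (Suc v))"
        proof (cases "v < p")
          case True
          define y where "y = pi * real (Suc v) / real (l p)"
          have "real (2 * Suc v) < real (l p)" using True by (simp add: l_def)
          then have "pi * real (2 * Suc v) < pi * real (l p)" by (intro mult_strict_left_mono) auto
          moreover have "pi * real (Suc v) > 0" by simp
          ultimately have y: "y < pi / 2" "y > 0"
            using lpos[of p] by (simp_all add: y_def field_simps)
          then have "0 < cos y" by (intro cos_gt_zero_pi) auto
          moreover have "cos y \<le> exp (- y\<^sup>2 / 6)" using y by (intro cos_le_exp) auto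
          ultimately have "cos y ^ (2 * m p) \<le> exp (- y\<^sup>2 / 6) ^ (2 * m p)"
            by (intro power_mono) auto
          also have "\<dots> = exp (real (2 * m p) * (- y\<^sup>2 / 6))" by (rule exp_of_nat_mult[symmetric])
          also have "\<dots> = exp (- (real (m p) / (real (l p))\<^sup>2) * (pi\<^sup>2 / 3 * (real (Suc v))\<^sup>2))"
            by (simp add: y_def power_divide power_mult_distrib)
          also have "\<dots> \<le> exp (- (c / 2) * (pi\<^sup>2 / 3 * real (Suc v)))"
          proof -
            have "real (Suc v) \<le> (real (Suc v))\<^sup>2" by (intro self_le_power) auto
            then have "(c / 2) * (pi\<^sup>2 / 3 * real (Suc v)) \<le> (real (m p) / (real (l p))\<^sup>2) * (pi\<^sup>2 / 3 * (real (Suc v))\<^sup>2)"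
              using elim c by (intro mult_mono) auto
            then show ?thesis by simp
          qed
          also have "\<dots> = exp (- (c * pi\<^sup>2 / 6) * real (Suc v))" by simp
          finally show ?thesis using True \<open>0 < cos y\<close> by (simp add: a_def y_def)
        qed (simp add: a_def)
      qed
    qed
  qed
  have A: "(\<lambda>p. \<Sum>v. a v p) \<longlonglongrightarrow> theta_tail x"
    unfolding theta_tail_def
  proof (rule tannerys_theorem[THEN conjunct2, THEN conjunct2])
    show "\<forall>\<^sub>F (v, p) in at_top \<times>\<^sub>F sequentially. norm (a v p) \<le> exp (- (c * pi\<^sup>2 / 6) * real (Suc v))"
      using a_bound by (auto simp: eventually_prod_filter intro!: exI[of _ "\<lambda>_. True"] exI)
    show "summable (\<lambda>v. exp (- (c * pi\<^sup>2 / 6) * real (Suc v)))"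
      using c by (intro summable_exp_Suc) auto
  qed (use a_lim in auto)
  have A': "(\<Sum>v. a v p) = (\<Sum>v<p. cos (pi * real (Suc v) / real (l p)) ^ (2 * m p))" for p
    by (subst suminf_finite[of "{..<p}"]) (auto simp: a_def)
  define b where "b j p = real (2 * m p choose (m p + l p * Suc j)) / real (2 * m p choose m p)" for j p
  have lm_lim: "(\<lambda>p. (real (l p * Suc j))\<^sup>2 / (real (m p) + e * real (l p * Suc j))) \<longlonglongrightarrow> (real (Suc j))\<^sup>2 / c" for j e
  proof (rule Lim_transform_eventually)
    have "(\<lambda>p. (real (Suc j))\<^sup>2 / (real (m p) / (real (l p))\<^sup>2 + e * real (Suc j) * (1 / real (l p))))
        \<longlonglongrightarrow> (real (Suc j))\<^sup>2 / (c + e * real (Suc j) * 0)"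
      using c by (intro tendsto_intros m_lim l_lim) auto
    then show "(\<lambda>p. (real (Suc j))\<^sup>2 / (real (m p) / (real (l p))\<^sup>2 + e * real (Suc j) * (1 / real (l p))))
        \<longlonglongrightarrow> (real (Suc j))\<^sup>2 / c" by simp
    show "\<forall>\<^sub>F p in sequentially. (real (Suc j))\<^sup>2 / (real (m p) / (real (l p))\<^sup>2 + e * real (Suc j) * (1 / real (l p)))
       = (real (l p * Suc j))\<^sup>2 / (real (m p) + e * real (l p * Suc j))"
    proof (intro always_eventually allI)
      fix p
      define L where "L = real (l p)"
      have "L > 0" using lpos by (simp add: L_def)
      then have "real (m p) / L\<^sup>2 + e * real (Suc j) * (1 / L) = (real (m p) + e * (L * real (Suc j))) / L\<^sup>2"
        by (simp add: field_simps power2_eq_square)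
      then show "(real (Suc j))\<^sup>2 / (real (m p) / (real (l p))\<^sup>2 + e * real (Suc j) * (1 / real (l p)))
       = (real (l p * Suc j))\<^sup>2 / (real (m p) + e * real (l p * Suc j))"
        unfolding of_nat_mult L_def[symmetric] by (simp add: power_mult_distrib mult_ac)
    qed
  qed
  have small: "\<forall>\<^sub>F p in sequentially. l p * Suc j < m p" for j
  proof -
    have "(\<lambda>p. real (m p) / (real (l p))\<^sup>2 - real (Suc j) * (1 / real (l p))) \<longlonglongrightarrow> c - real (Suc j) * 0"
      by (intro tendsto_intros m_lim l_lim)
    then have "\<forall>\<^sub>F p in sequentially. real (m p) / (real (l p))\<^sup>2 - real (Suc j) * (1 / real (l p)) > 0"
      using c by (intro order_tendstoD(1)) auto
    then show ?thesis
    proof eventually_elim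
      case (elim p)
      define L where "L = real (l p)"
      have L: "L > 0" using lpos by (simp add: L_def)
      have "real (m p) / L\<^sup>2 - real (Suc j) * (1 / L) = (real (m p) - L * real (Suc j)) / L\<^sup>2"
        using L by (simp add: field_simps power2_eq_square)
      with elim have "0 < (real (m p) - L * real (Suc j)) / L\<^sup>2" unfolding L_def by metis
      with L have "L * real (Suc j) < real (m p)" by (simp add: zero_less_divide_iff)
      then show ?case unfolding L_def by (metis of_nat_less_iff of_nat_mult)
    qed
  qed
  have b_lim: "(\<lambda>p. b j p) \<longlonglongrightarrow> exp (- pi * (real (Suc j))\<^sup>2 * (1 / x))" for j
  proof (rule tendsto_sandwich)
    have e: "exp (- ((real (Suc j))\<^sup>2 / c)) = exp (- pi * (real (Suc j))\<^sup>2 * (1 / x))"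
      using x by (simp add: c_def)
    show "(\<lambda>p. exp (- ((real (l p * Suc j))\<^sup>2 / (real (m p) + (- 1) * real (l p * Suc j)))))
       \<longlonglongrightarrow> exp (- pi * (real (Suc j))\<^sup>2 * (1 / x))"
      unfolding e[symmetric] by (intro tendsto_intros lm_lim)
    show "(\<lambda>p. exp (- ((real (l p * Suc j))\<^sup>2 / (real (m p) + 1 * real (l p * Suc j)))))
       \<longlonglongrightarrow> exp (- pi * (real (Suc j))\<^sup>2 * (1 / x))"
      unfolding e[symmetric] by (intro tendsto_intros lm_lim)
    show "\<forall>\<^sub>F p in sequentially. exp (- ((real (l p * Suc j))\<^sup>2 / (real (m p) + (- 1) * real (l p * Suc j)))) \<le> b j p"
    proof (use small[of j] in eventually_elim)
      case (elim p)
      then show ?case using binomial_ratio_ge[of "l p * Suc j" "m p"]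
        by (simp add: b_def del: mult_Suc_right of_nat_mult)
    qed
    show "\<forall>\<^sub>F p in sequentially. b j p \<le> exp (- ((real (l p * Suc j))\<^sup>2 / (real (m p) + 1 * real (l p * Suc j))))"
    proof (use small[of j] in eventually_elim)
      case (elim p)
      then show ?case using binomial_ratio_le[of "l p * Suc j" "m p"]
        by (simp add: b_def del: mult_Suc_right of_nat_mult)
    qed
  qed
  have b_bound: "norm (b j p) \<le> exp (- (1 / (2 * c)) * real (Suc j))" for j p
  proof (cases "l p * Suc j \<le> m p")
    case True
    have mp: "real (m p) > 0" using True by (simp add: l_def)
    have "b j p \<le> exp (- (real (l p * Suc j))\<^sup>2 / real (m p + l p * Suc j))"
      unfolding b_def by (rule binomial_ratio_le[OF True])
    also have "\<dots> \<le> exp (- (1 / (2 * c)) * real (Suc j))"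
    proof -
      have "real (m p + l p * Suc j) \<le> 2 * real (m p)" using True by linarith
      also have "\<dots> \<le> 2 * (c * (real (l p))\<^sup>2)" using m_le[of p] by simp
      finally have "(real (l p * Suc j))\<^sup>2 / (2 * (c * (real (l p))\<^sup>2)) \<le> (real (l p * Suc j))\<^sup>2 / real (m p + l p * Suc j)"
        using mp lpos[of p] c by (intro divide_left_mono) (auto intro!: mult_pos_pos add_pos_nonneg)
      moreover have "(real (l p * Suc j))\<^sup>2 / (2 * (c * (real (l p))\<^sup>2)) = (1 / (2 * c)) * (real (Suc j))\<^sup>2"
        using lpos[of p] c by (simp only: of_nat_mult power_mult_distrib) (simp add: field_simps)
      moreover have "(1 / (2 * c)) * real (Suc j) \<le> (1 / (2 * c)) * (real (Suc j))\<^sup>2"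
        using c by (intro mult_left_mono self_le_power) auto
      ultimately show ?thesis by (simp only: exp_le_cancel_iff)
    qed
    finally show ?thesis by (simp add: b_def)
  next
    case False
    then have "b j p = 0" by (simp add: b_def)
    then show ?thesis by simp
  qed
  have B: "(\<lambda>p. \<Sum>j. b j p) \<longlonglongrightarrow> theta_tail (1 / x)"
    unfolding theta_tail_def
  proof (rule tannerys_theorem[THEN conjunct2, THEN conjunct2])
    show "\<forall>\<^sub>F (j, p) in at_top \<times>\<^sub>F sequentially. norm (b j p) \<le> exp (- (1 / (2 * c)) * real (Suc j))"
      using b_bound by (intro always_eventually) auto
    show "summable (\<lambda>j. exp (- (1 / (2 * c)) * real (Suc j)))"
      using c by (intro summable_exp_Suc) auto
  qed (use b_lim in auto)
  have B': "(\<Sum>j. b j p) = (\<Sum>j<m p. real (2 * m p choose (m p + l p * Suc j)) / real (2 * m p choose m p))" for p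
  proof (subst suminf_finite[of "{..<m p}"])
    fix j assume "j \<notin> {..<m p}"
    then have "m p < 1 * Suc j" by simp
    also have "\<dots> \<le> l p * Suc j" by (intro mult_le_mono) (auto simp: l_def)
    finally show "b j p = 0" by (simp add: b_def)
  qed (auto simp: b_def)
  have K: "(\<lambda>p. real (l p) * (real (2 * m p choose m p) / 4 ^ m p)) \<longlonglongrightarrow> 1 / sqrt x"
  proof (rule Lim_transform_eventually)
    have "(\<lambda>p. (sqrt (real (m p)) * (real (2 * m p choose m p) / 4 ^ m p)) / sqrt (real (m p) / (real (l p))\<^sup>2))
       \<longlonglongrightarrow> (1 / sqrt pi) / sqrt c"
      using c by (intro tendsto_divide tendsto_real_sqrt m_lim filterlim_compose[OF central_binomial_asymptotic mlim']) auto
    also have "(1 / sqrt pi) / sqrt c = 1 / sqrt x" using x by (simp add: c_def real_sqrt_divide)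
    finally show "(\<lambda>p. (sqrt (real (m p)) * (real (2 * m p choose m p) / 4 ^ m p)) / sqrt (real (m p) / (real (l p))\<^sup>2))
       \<longlonglongrightarrow> 1 / sqrt x" .
    have "\<forall>\<^sub>F p in sequentially. m p > 0" by (rule eventually_compose_filterlim[OF eventually_gt_at_top mlim'])
    then show "\<forall>\<^sub>F p in sequentially. (sqrt (real (m p)) * (real (2 * m p choose m p) / 4 ^ m p)) / sqrt (real (m p) / (real (l p))\<^sup>2)
       = real (l p) * (real (2 * m p choose m p) / 4 ^ m p)"
      by eventually_elim (use lpos in \<open>simp add: real_sqrt_divide\<close>)
  qed
  have "(\<lambda>p. 1 + 2 * (\<Sum>v. a v p)) \<longlonglongrightarrow> 1 + 2 * theta_tail x"
    by (intro tendsto_intros A)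
  moreover have "(\<lambda>p. 1 + 2 * (\<Sum>v. a v p)) \<longlonglongrightarrow> 1 / sqrt x * (1 + 2 * theta_tail (1 / x))"
    unfolding A' l_def theta_finite_identity unfolding l_def[symmetric] B'[symmetric]
    by (intro tendsto_intros K B)
  ultimately have "1 + 2 * theta_tail x = 1 / sqrt x * (1 + 2 * theta_tail (1 / x))"
    by (rule LIMSEQ_unique)
  then show ?thesis by simp
qed

section \<open>The completed zeta function as a power series\<close>

text \<open>Euler's integral after the substitution t = a exp u. In the variable u the involution x -> 1/x
of the theta function becomes the reflection u -> -u.\<close>

lemma nn_integral_exp_Gamma:
  fixes z a :: real
  assumes z: "z > 0" and a: "a > 0"
  shows "(\<integral>\<^sup>+u. ennreal (exp (z * u - a * exp u)) \<partial>lborel) = ennreal (Gamma z / a powr z)"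
proof -
  define f where "f t = t powr (z - 1) / exp t" for t :: real
  have G: "(f has_integral Gamma z) {0<..}"
    unfolding f_def
    by (rule has_integral_spike_set_eq[THEN iffD1, OF _ _ Gamma_integral_real[OF z]];
        rule negligible_subset[of "{0}"]) auto
  then have "f absolutely_integrable_on {0<..} \<and> integral {0<..} f = Gamma z"
    by (auto simp: f_def has_integral_iff intro!: nonnegative_absolutely_integrable_1)
  moreover have "range (exp :: real \<Rightarrow> real) = {0<..}"
  proof (intro equalityI subsetI)
    fix x :: real assume "x \<in> {0<..}"
    then have "x = exp (ln x)" by simp
    then show "x \<in> range exp" by blast
  qed auto
  ultimately have *: "(\<lambda>u. \<bar>exp u\<bar> * f (exp u)) absolutely_integrable_on UNIV \<and>
      integral UNIV (\<lambda>u. \<bar>exp u\<bar> * f (exp u)) = Gamma z"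
    by (subst has_absolute_integral_change_of_variables_1')
       (auto intro!: derivative_eq_intros inj_onI)
  have eq: "\<bar>exp u\<bar> * f (exp u) = exp (z * u - exp u)" for u
    by (simp add: f_def powr_def exp_diff algebra_simps)
  have "((\<lambda>u. exp (z * u - exp u)) has_integral Gamma z) UNIV"
    using * unfolding eq by (auto simp: has_integral_iff dest: set_lebesgue_integral_eq_integral(1))
  from nn_integral_has_integral_lebesgue[OF _ this]
  have "ennreal (Gamma z) = (\<integral>\<^sup>+u. ennreal (exp (z * u - exp u)) \<partial>lborel)" by simp
  also have "\<dots> = (\<integral>\<^sup>+u. ennreal (exp (z * (ln a + 1 * u) - exp (ln a + 1 * u))) \<partial>lborel)"
    by (subst nn_integral_real_affine[where c = 1 and t = "ln a"]) auto
  also have "\<dots> = (\<integral>\<^sup>+u. ennreal (a powr z) * ennreal (exp (z * u - a * exp u)) \<partial>lborel)"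
    using a by (intro nn_integral_cong)
      (simp add: powr_def exp_add algebra_simps flip: ennreal_mult exp_add, simp add: exp_add exp_diff)
  also have "\<dots> = ennreal (a powr z) * (\<integral>\<^sup>+u. ennreal (exp (z * u - a * exp u)) \<partial>lborel)"
    by (rule nn_integral_cmult) measurable
  finally have e: "ennreal (Gamma z) = ennreal (a powr z) * (\<integral>\<^sup>+u. ennreal (exp (z * u - a * exp u)) \<partial>lborel)" .
  have "(\<integral>\<^sup>+u. ennreal (exp (z * u - a * exp u)) \<partial>lborel) =
     ennreal (1 / a powr z) * (ennreal (a powr z) * (\<integral>\<^sup>+u. ennreal (exp (z * u - a * exp u)) \<partial>lborel))"
    using a by (subst mult.assoc[symmetric], subst ennreal_mult[symmetric]) auto
  also have "\<dots> = ennreal (1 / a powr z) * ennreal (Gamma z)" by (simp only: e)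
  also have "\<dots> = ennreal (Gamma z / a powr z)"
    using z by (subst ennreal_mult[symmetric]) (auto intro: Gamma_real_nonneg)
  finally show ?thesis .
qed

lemma borel_measurable_theta_tail [measurable]: "theta_tail \<in> borel_measurable borel"
  unfolding theta_tail_def[abs_def] by measurable

lemma theta_tail_nonneg: "x > 0 \<Longrightarrow> theta_tail x \<ge> 0"
  unfolding theta_tail_def by (intro suminf_nonneg summable_theta_tail) auto

lemma summable_zeta_real: "s > 1 \<Longrightarrow> summable (\<lambda>n. 1 / real (Suc n) powr s)"
  using summable_real_powr_iff[of "-s"]
  by (subst summable_Suc_iff) (simp add: powr_minus_divide)

text \<open>Integrate the theta series termwise; all terms are nonnegative.\<close>

lemma nn_integral_theta_Mellin:
  fixes s :: real
  assumes s: "s > 1"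
  shows "(\<integral>\<^sup>+u. ennreal (exp (s / 2 * u) * theta_tail (exp u)) \<partial>lborel) =
     ennreal (pi powr (- s / 2) * Gamma (s / 2) * (\<Sum>n. 1 / real (Suc n) powr s))"
proof -
  have 1: "exp (s / 2 * u - pi * (real (Suc n))\<^sup>2 * exp u) = exp (s / 2 * u) * exp (- pi * (real (Suc n))\<^sup>2 * exp u)" for u n
    by (simp flip: exp_add)
  have "(\<integral>\<^sup>+u. ennreal (exp (s / 2 * u) * theta_tail (exp u)) \<partial>lborel) =
     (\<integral>\<^sup>+u. (\<Sum>n. ennreal (exp (s / 2 * u - pi * (real (Suc n))\<^sup>2 * exp u))) \<partial>lborel)"
  proof (rule nn_integral_cong)
    fix u :: real
    have "summable (\<lambda>n. exp (s / 2 * u) * exp (- pi * (real (Suc n))\<^sup>2 * exp u))"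
      by (intro summable_mult summable_theta_tail) auto
    then have "(\<Sum>n. ennreal (exp (s / 2 * u - pi * (real (Suc n))\<^sup>2 * exp u))) =
      ennreal (\<Sum>n. exp (s / 2 * u) * exp (- pi * (real (Suc n))\<^sup>2 * exp u))"
      unfolding 1 by (intro suminf_ennreal2) auto
    also have "(\<Sum>n. exp (s / 2 * u) * exp (- pi * (real (Suc n))\<^sup>2 * exp u)) = exp (s / 2 * u) * theta_tail (exp u)"
      unfolding theta_tail_def by (intro suminf_mult summable_theta_tail) auto
    finally show "ennreal (exp (s / 2 * u) * theta_tail (exp u)) = (\<Sum>n. ennreal (exp (s / 2 * u - pi * (real (Suc n))\<^sup>2 * exp u)))" ..
  qed
  also have "\<dots> = (\<Sum>n. \<integral>\<^sup>+u. ennreal (exp (s / 2 * u - pi * (real (Suc n))\<^sup>2 * exp u)) \<partial>lborel)"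
    by (rule nn_integral_suminf) measurable
  also have "\<dots> = (\<Sum>n. ennreal (pi powr (- s / 2) * Gamma (s / 2) * (1 / real (Suc n) powr s)))"
  proof (rule suminf_cong)
    fix n
    have "(pi * (real (Suc n))\<^sup>2) powr (s / 2) = pi powr (s / 2) * real (Suc n) powr s"
    proof -
      have "(real (Suc n))\<^sup>2 = real (Suc n) powr 2" by (simp add: powr_numeral)
      then have "((real (Suc n))\<^sup>2) powr (s / 2) = real (Suc n) powr s"
        by (simp only: powr_powr) simp
      then show ?thesis by (simp only: powr_mult pi_ge_zero zero_le_power2)
    qed
    then have e: "Gamma (s / 2) / (pi * (real (Suc n))\<^sup>2) powr (s / 2) =
      pi powr (- s / 2) * Gamma (s / 2) * (1 / real (Suc n) powr s)"
      by (simp add: powr_minus_divide)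
    have "(\<integral>\<^sup>+u. ennreal (exp (s / 2 * u - pi * (real (Suc n))\<^sup>2 * exp u)) \<partial>lborel) =
        ennreal (Gamma (s / 2) / (pi * (real (Suc n))\<^sup>2) powr (s / 2))"
      using s by (intro nn_integral_exp_Gamma) auto
    then show "(\<integral>\<^sup>+u. ennreal (exp (s / 2 * u - pi * (real (Suc n))\<^sup>2 * exp u)) \<partial>lborel) =
        ennreal (pi powr (- s / 2) * Gamma (s / 2) * (1 / real (Suc n) powr s))"
      by (simp only: e)
  qed
  also have "\<dots> = ennreal (\<Sum>n. pi powr (- s / 2) * Gamma (s / 2) * (1 / real (Suc n) powr s))"
    using s by (intro suminf_ennreal2 summable_mult summable_zeta_real) (auto intro!: mult_nonneg_nonneg Gamma_real_nonneg)
  also have "(\<Sum>n. pi powr (- s / 2) * Gamma (s / 2) * (1 / real (Suc n) powr s)) =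
     pi powr (- s / 2) * Gamma (s / 2) * (\<Sum>n. 1 / real (Suc n) powr s)"
    by (intro suminf_mult summable_zeta_real s)
  finally show ?thesis .
qed

lemma theta_tail_exp_minus:
  "theta_tail (exp (- u)) = exp (u / 2) * theta_tail (exp u) + (exp (u / 2) - 1) / 2"
proof -
  have "sqrt (exp (- u)) = exp (- u / 2)"
    by (rule real_sqrt_unique) (simp_all add: power2_eq_square flip: exp_add)
  then have "1 + 2 * theta_tail (exp (- u)) = exp (u / 2) * (1 + 2 * theta_tail (exp u))"
  proof -
    have "1 / exp (- u) = exp u" by (simp add: exp_minus inverse_eq_divide)
    then have "1 + 2 * theta_tail (exp (- u)) = (1 + 2 * theta_tail (exp u)) / exp (- u / 2)"
      using theta_transformation[of "exp (- u)"] \<open>sqrt (exp (- u)) = exp (- u / 2)\<close> by simp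
    then show ?thesis by (simp add: exp_minus field_simps)
  qed
  then show ?thesis by (simp add: field_simps)
qed

lemma cosh_even_sums:
  "(\<lambda>k. 2 * y ^ (2 * k) / fact (2 * k)) sums (exp y + exp (- y :: real))"
proof -
  have "(\<lambda>n. y ^ n / fact n + (- y) ^ n / fact n) sums (exp y + exp (- y))"
    using sums_add[OF exp_converges[of y] exp_converges[of "- y"]]
    by (simp add: field_simps)
  then have "(\<lambda>n. y ^ (2 * n) / fact (2 * n) + (- y) ^ (2 * n) / fact (2 * n)) sums (exp y + exp (- y))"
  proof (subst sums_mono_reindex[where f = "\<lambda>n. y ^ n / fact n + (- y) ^ n / fact n" and g = "\<lambda>n. 2 * n"])
    fix n :: nat assume "n \<notin> range (\<lambda>n. 2 * n)"
    then have "odd n" by (auto elim!: evenE)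
    then show "y ^ n / fact n + (- y) ^ n / fact n = 0" by (simp add: power_minus_odd)
  qed (auto simp: strict_mono_def)
  then show ?thesis by (simp add: power_mult)
qed

text \<open>Split the Mellin integral at u = 0 and reflect the negative half by the theta transformation.
With r = s - 1/2 this leaves the integral of A(u) (exp (ur/2) + exp (-ur/2)) over u > 0 and an
elementary integral equal to 1/(s(s-1)). The even exponential series then produces a power
series in r^2 with nonnegative coefficients. This single statement contains the continuation,
the functional equation and, because of the signs of the coefficients, the growth of xi: its
values on the real axis majorise those on circles about 1/2. All integrals are taken of
nonnegative functions, so that the interchanges are monotone convergence and the finiteness of
the coefficients comes from the left-hand side.\<close>

theorem completed_zeta_power_series:
  obtains b :: "nat \<Rightarrow> real"
  where "\<And>k. b k \<ge> 0" "\<And>r. summable (\<lambda>k. b k * r ^ k)"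
    "\<And>s. s > 1 \<Longrightarrow> pi powr (- s / 2) * Gamma (s / 2) * (\<Sum>n. 1 / real (Suc n) powr s) =
       (\<Sum>k. b k * ((s - 1 / 2)\<^sup>2) ^ k) + 1 / (s * (s - 1))"
proof -
  \<comment> \<open>The weight exp (u/4) makes the exponents of the two halves of the integral symmetric: exp
    (su/2) = exp (u/4) exp (ur/2) with r = s - 1/2.\<close>
  define A where "A u = exp (u / 4) * theta_tail (exp u)" for u :: real
  have A_meas [measurable]: "A \<in> borel_measurable borel" unfolding A_def by measurable
  have A0: "A u \<ge> 0" for u by (simp add: A_def theta_tail_nonneg)
  define B where "B k = (\<integral>\<^sup>+u. ennreal (indicator {0<..} u * (A u * (2 * (u / 2) ^ (2 * k) / fact (2 * k)))) \<partial>lborel)" for k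
  define Lam where "Lam s = pi powr (- s / 2) * Gamma (s / 2) * (\<Sum>n. 1 / real (Suc n) powr s)" for s :: real
  have Lam0: "Lam s \<ge> 0" if "s > 1" for s
    unfolding Lam_def using that by (intro mult_nonneg_nonneg Gamma_real_nonneg suminf_nonneg summable_zeta_real) auto
  have main: "ennreal (Lam s) = (\<Sum>k. B k * ennreal (((s - 1 / 2)\<^sup>2) ^ k)) + ennreal (1 / (s * (s - 1)))"
    if s: "s > 1" for s
  proof -
    define r where "r = s - 1 / 2"
    define f where "f u = exp (s / 2 * u) * theta_tail (exp u)" for u
    have f0: "f u \<ge> 0" for u by (simp add: f_def theta_tail_nonneg)
    have f_meas [measurable]: "f \<in> borel_measurable borel" unfolding f_def by measurable
    have f_refl: "f u + f (- u) = A u * (exp (u / 2 * r) + exp (- (u / 2 * r))) + (exp (- ((s - 1) / 2 * u)) - exp (- (s / 2 * u))) / 2" for u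
    proof -
      have e1: "exp (s / 2 * u) = exp (u / 4) * exp (u / 2 * r)"
        by (simp add: r_def field_simps flip: exp_add)
      have e2: "exp (- (s / 2 * u)) * exp (u / 2) = exp (u / 4) * exp (- (u / 2 * r))"
        by (simp add: r_def field_simps flip: exp_add)
      have e3: "exp (- (s / 2 * u)) * exp (u / 2) = exp (- ((s - 1) / 2 * u))"
        by (simp add: field_simps flip: exp_add)
      have "f u + f (- u) = exp (s / 2 * u) * theta_tail (exp u) +
          (exp (- (s / 2 * u)) * exp (u / 2)) * theta_tail (exp u) + ((exp (- (s / 2 * u)) * exp (u / 2)) - exp (- (s / 2 * u))) / 2"
        unfolding f_def theta_tail_exp_minus by (simp add: algebra_simps diff_divide_distrib)
      also have "\<dots> = exp (s / 2 * u) * theta_tail (exp u) +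
          (exp (u / 4) * exp (- (u / 2 * r))) * theta_tail (exp u) + (exp (- ((s - 1) / 2 * u)) - exp (- (s / 2 * u))) / 2"
        by (simp only: e2 flip: e3)
      finally show ?thesis unfolding e1 A_def by (simp add: algebra_simps)
    qed
    have tail0: "(exp (- ((s - 1) / 2 * u)) - exp (- (s / 2 * u))) / 2 \<ge> 0" if "u > 0" for u
      using that by (simp add: algebra_simps)
    have "ennreal (Lam s) = (\<integral>\<^sup>+u. ennreal (f u) \<partial>lborel)"
      unfolding Lam_def f_def nn_integral_theta_Mellin[OF s] ..
    also have "\<dots> = (\<integral>\<^sup>+u. ennreal (indicator {0<..} u * f u) + ennreal (indicator {..<0} u * f u) \<partial>lborel)"
    proof (rule nn_integral_cong_AE)
      have "AE u in lborel. u \<noteq> (0::real)" by (rule AE_lborel_singleton)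
      then show "AE u in lborel. ennreal (f u) = ennreal (indicator {0<..} u * f u) + ennreal (indicator {..<0} u * f u)"
        by eventually_elim (auto simp: indicator_def)
    qed
    also have "\<dots> = (\<integral>\<^sup>+u. ennreal (indicator {0<..} u * f u) \<partial>lborel) + (\<integral>\<^sup>+u. ennreal (indicator {..<0} u * f u) \<partial>lborel)"
      by (rule nn_integral_add) measurable
    also have "(\<integral>\<^sup>+u. ennreal (indicator {..<0} u * f u) \<partial>lborel) = (\<integral>\<^sup>+u. ennreal (indicator {0<..} u * f (- u)) \<partial>lborel)"
      by (subst nn_integral_real_affine[where c = "-1" and t = 0]) (auto simp: indicator_def intro!: nn_integral_cong)
    also have "(\<integral>\<^sup>+u. ennreal (indicator {0<..} u * f u) \<partial>lborel) + (\<integral>\<^sup>+u. ennreal (indicator {0<..} u * f (- u)) \<partial>lborel)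
       = (\<integral>\<^sup>+u. ennreal (indicator {0<..} u * f u) + ennreal (indicator {0<..} u * f (- u)) \<partial>lborel)"
      by (rule nn_integral_add[symmetric]) measurable
    also have "\<dots> = (\<integral>\<^sup>+u. ennreal (indicator {0<..} u * (A u * (exp (u / 2 * r) + exp (- (u / 2 * r))))) +
        ennreal (indicator {0<..} u * ((exp (- ((s - 1) / 2 * u)) - exp (- (s / 2 * u))) / 2)) \<partial>lborel)"
    proof (rule nn_integral_cong)
      fix u :: real
      show "ennreal (indicator {0<..} u * f u) + ennreal (indicator {0<..} u * f (- u)) =
        ennreal (indicator {0<..} u * (A u * (exp (u / 2 * r) + exp (- (u / 2 * r))))) +
        ennreal (indicator {0<..} u * ((exp (- ((s - 1) / 2 * u)) - exp (- (s / 2 * u))) / 2))"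
      proof (cases "u > 0")
        case True
        have nn: "0 \<le> A u * (exp (u / 2 * r) + exp (- (u / 2 * r)))"
          by (intro mult_nonneg_nonneg A0 add_nonneg_nonneg) auto
        have "ennreal (f u) + ennreal (f (- u)) = ennreal (f u + f (- u))"
          by (rule ennreal_plus[symmetric]) (rule f0)+
        also have "\<dots> = ennreal (A u * (exp (u / 2 * r) + exp (- (u / 2 * r)))) + ennreal ((exp (- ((s - 1) / 2 * u)) - exp (- (s / 2 * u))) / 2)"
          unfolding f_refl by (rule ennreal_plus[OF nn tail0[OF True]])
        finally show ?thesis using True by simp
      qed simp
    qed
    also have "\<dots> = (\<integral>\<^sup>+u. ennreal (indicator {0<..} u * (A u * (exp (u / 2 * r) + exp (- (u / 2 * r))))) \<partial>lborel) +
        (\<integral>\<^sup>+u. ennreal (indicator {0<..} u * ((exp (- ((s - 1) / 2 * u)) - exp (- (s / 2 * u))) / 2)) \<partial>lborel)"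
      by (rule nn_integral_add) measurable
    also have "(\<integral>\<^sup>+u. ennreal (indicator {0<..} u * ((exp (- ((s - 1) / 2 * u)) - exp (- (s / 2 * u))) / 2)) \<partial>lborel)
        = ennreal (1 / (s * (s - 1)))"
    proof -
      have "((\<lambda>u. (exp (- ((s - 1) / 2) * u) - exp (- (s / 2) * u)) / 2) has_integral
          (exp (- ((s - 1) / 2) * 0) / ((s - 1) / 2) - exp (- (s / 2) * 0) / (s / 2)) / 2) {0..}"
        using s by (intro has_integral_divide has_integral_diff has_integral_exp_minus_to_infinity) auto
      also have "(exp (- ((s - 1) / 2) * 0) / ((s - 1) / 2) - exp (- (s / 2) * 0) / (s / 2)) / 2 = 1 / (s * (s - 1))"
        using s by (simp add: field_simps)
      finally have I0: "((\<lambda>u. (exp (- ((s - 1) / 2) * u) - exp (- (s / 2) * u)) / 2) has_integral 1 / (s * (s - 1))) {0..}" .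
      have "((\<lambda>u. (exp (- ((s - 1) / 2) * u) - exp (- (s / 2) * u)) / 2) has_integral 1 / (s * (s - 1))) {0<..}"
        by (rule has_integral_spike_set_eq[THEN iffD1, OF _ _ I0]; rule negligible_subset[of "{0}"]) auto
      then have I: "((\<lambda>u. (exp (- ((s - 1) / 2 * u)) - exp (- (s / 2 * u))) / 2) has_integral 1 / (s * (s - 1))) {0<..}"
        by (simp only: mult_minus_left)
      show ?thesis
        by (rule nn_integral_has_integral_lebesgue[OF _ I]) (rule tail0, simp)
    qed
    also have "(\<integral>\<^sup>+u. ennreal (indicator {0<..} u * (A u * (exp (u / 2 * r) + exp (- (u / 2 * r))))) \<partial>lborel) =
        (\<integral>\<^sup>+u. (\<Sum>k. ennreal (indicator {0<..} u * (A u * (2 * (u / 2) ^ (2 * k) / fact (2 * k)))) * ennreal ((r\<^sup>2) ^ k)) \<partial>lborel)"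
    proof (rule nn_integral_cong)
      fix u :: real
      have "(\<lambda>k. indicator {0<..} u * (A u * (2 * (u / 2 * r) ^ (2 * k) / fact (2 * k)))) sums
          (indicator {0<..} u * (A u * (exp (u / 2 * r) + exp (- (u / 2 * r)))))"
        by (intro sums_mult cosh_even_sums)
      moreover have "indicator {0<..} u * (A u * (2 * (u / 2 * r) ^ (2 * k) / fact (2 * k))) =
         indicator {0<..} u * (A u * (2 * (u / 2) ^ (2 * k) / fact (2 * k))) * (r\<^sup>2) ^ k" for k
      proof -
        have "(u / 2 * r) ^ (2 * k) = (u / 2) ^ (2 * k) * (r\<^sup>2) ^ k"
          by (simp only: power_mult_distrib power_mult)
        then show ?thesis by (simp only: times_divide_eq_left times_divide_eq_right mult.assoc)
      qed
      ultimately have S: "(\<lambda>k. indicator {0<..} u * (A u * (2 * (u / 2) ^ (2 * k) / fact (2 * k))) * (r\<^sup>2) ^ k) sums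
          (indicator {0<..} u * (A u * (exp (u / 2 * r) + exp (- (u / 2 * r)))))" by (simp only:)
      have nn: "0 \<le> indicator {0<..} u * (A u * (2 * (u / 2) ^ (2 * k) / fact (2 * k)))" for k
        by (intro mult_nonneg_nonneg A0 divide_nonneg_nonneg zero_le_even_power) auto
      have "(\<Sum>k. ennreal (indicator {0<..} u * (A u * (2 * (u / 2) ^ (2 * k) / fact (2 * k)))) * ennreal ((r\<^sup>2) ^ k)) =
        (\<Sum>k. ennreal (indicator {0<..} u * (A u * (2 * (u / 2) ^ (2 * k) / fact (2 * k))) * (r\<^sup>2) ^ k))"
        by (intro suminf_cong ennreal_mult[symmetric] nn) auto
      also have "\<dots> = ennreal (indicator {0<..} u * (A u * (exp (u / 2 * r) + exp (- (u / 2 * r)))))"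
        by (rule suminf_ennreal_eq[OF _ S]) (intro mult_nonneg_nonneg[OF nn], simp)
      finally show "ennreal (indicator {0<..} u * (A u * (exp (u / 2 * r) + exp (- (u / 2 * r))))) =
        (\<Sum>k. ennreal (indicator {0<..} u * (A u * (2 * (u / 2) ^ (2 * k) / fact (2 * k)))) * ennreal ((r\<^sup>2) ^ k))" ..
    qed
    also have "\<dots> = (\<Sum>k. \<integral>\<^sup>+u. ennreal (indicator {0<..} u * (A u * (2 * (u / 2) ^ (2 * k) / fact (2 * k)))) * ennreal ((r\<^sup>2) ^ k) \<partial>lborel)"
      by (rule nn_integral_suminf) measurable
    also have "\<dots> = (\<Sum>k. B k * ennreal ((r\<^sup>2) ^ k))"
      unfolding B_def by (intro suminf_cong nn_integral_multc) measurable
    finally show ?thesis unfolding r_def .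
  qed
  define b where "b k = enn2real (B k)" for k
  have term_fin: "(\<Sum>k. B k * ennreal (((s - 1 / 2)\<^sup>2) ^ k)) \<noteq> top" if "s > 1" for s
    using main[OF that] by (metis ennreal_neq_top ennreal_add_eq_top)
  have Bfin: "B k = ennreal (b k)" for k
  proof -
    have "B k * ennreal (((2 - 1 / 2)\<^sup>2) ^ k) \<le> (\<Sum>k. B k * ennreal (((2 - 1 / 2)\<^sup>2) ^ k))"
      using sum_le_suminf[OF summableI, of "{k}" "\<lambda>k. B k * ennreal (((2 - 1 / 2)\<^sup>2) ^ k)"] by simp
    with term_fin[of 2] have "B k * ennreal (((2 - 1 / 2)\<^sup>2) ^ k) \<noteq> top" by (auto simp: top_unique)
    then have "B k \<noteq> top" by (auto simp: ennreal_mult_eq_top_iff ennreal_eq_0_iff not_le)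
    then show ?thesis by (simp add: b_def less_top)
  qed
  have b0: "b k \<ge> 0" for k by (simp add: b_def)
  have t: "B k * ennreal (((s - 1 / 2)\<^sup>2) ^ k) = ennreal (b k * ((s - 1 / 2)\<^sup>2) ^ k)" for k s
    unfolding Bfin by (rule ennreal_mult[symmetric]) (auto simp: b0)
  have sm: "summable (\<lambda>k. b k * ((s - 1 / 2)\<^sup>2) ^ k)" if "s > 1" for s
    using term_fin[OF that] unfolding t by (intro summable_suminf_not_top mult_nonneg_nonneg b0) auto
  show ?thesis
  proof (rule that[of b])
    show "summable (\<lambda>k. b k * r ^ k)" for r :: real
    proof (rule summable_comparison_test'[OF sm[of "2 + \<bar>r\<bar>"]])
      fix k :: nat
      have "\<bar>r\<bar> \<le> 1 * (2 + \<bar>r\<bar> - 1 / 2)" by simp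
      also have "\<dots> \<le> (2 + \<bar>r\<bar> - 1 / 2) * (2 + \<bar>r\<bar> - 1 / 2)" by (intro mult_right_mono) auto
      finally have "\<bar>r\<bar> ^ k \<le> ((2 + \<bar>r\<bar> - 1 / 2)\<^sup>2) ^ k"
        unfolding power2_eq_square by (intro power_mono) auto
      then show "norm (b k * r ^ k) \<le> b k * ((2 + \<bar>r\<bar> - 1 / 2)\<^sup>2) ^ k"
        by (simp add: abs_mult power_abs b0 mult_left_mono)
    qed auto
    fix s :: real assume s: "s > 1"
    have "ennreal (Lam s) = (\<Sum>k. ennreal (b k * ((s - 1 / 2)\<^sup>2) ^ k)) + ennreal (1 / (s * (s - 1)))"
      using main[OF s] unfolding t .
    also have "\<dots> = ennreal (\<Sum>k. b k * ((s - 1 / 2)\<^sup>2) ^ k) + ennreal (1 / (s * (s - 1)))"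
      by (subst suminf_ennreal2) (auto intro!: mult_nonneg_nonneg b0 sm s)
    also have "\<dots> = ennreal ((\<Sum>k. b k * ((s - 1 / 2)\<^sup>2) ^ k) + 1 / (s * (s - 1)))"
      using s by (intro ennreal_plus[symmetric] suminf_nonneg sm) (auto intro!: mult_nonneg_nonneg b0)
    finally have "Lam s = (\<Sum>k. b k * ((s - 1 / 2)\<^sup>2) ^ k) + 1 / (s * (s - 1))"
      using s Lam0[OF s]
      by (subst (asm) ennreal_inj) (auto intro!: add_nonneg_nonneg suminf_nonneg sm mult_nonneg_nonneg b0)
    then show "pi powr (- s / 2) * Gamma (s / 2) * (\<Sum>n. 1 / real (Suc n) powr s) =
       (\<Sum>k. b k * ((s - 1 / 2)\<^sup>2) ^ k) + 1 / (s * (s - 1))"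
      unfolding Lam_def .
  qed (rule b0)
qed

section \<open>Continuation of zeta and the entire function xi\<close>

definition dirichlet_zeta :: "complex \<Rightarrow> complex" where
  "dirichlet_zeta s = (\<Sum>n. 1 / of_nat (Suc n) powr s)"

lemma norm_dirichlet_term: "norm (1 / of_nat (Suc n) powr s :: complex) = 1 / real (Suc n) powr Re s"
  by (simp add: norm_divide norm_powr_real_powr del: of_nat_Suc)

lemma summable_dirichlet:
  assumes "Re s > 1"
  shows "summable (\<lambda>n. 1 / of_nat (Suc n) powr s :: complex)"
  by (rule summable_norm_cancel) (simp only: norm_dirichlet_term summable_zeta_real[OF assms])

lemma dirichlet_zeta_of_real:
  assumes "x > 1"
  shows "dirichlet_zeta (of_real x) = of_real (\<Sum>n. 1 / real (Suc n) powr x)"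
proof -
  have "1 / of_nat (Suc n) powr of_real x = complex_of_real (1 / real (Suc n) powr x)" for n
    by (simp add: powr_of_real[symmetric] del: of_nat_Suc)
  then show ?thesis
    unfolding dirichlet_zeta_def by (simp only: suminf_of_real[OF summable_zeta_real[OF assms]])
qed

lemma holomorphic_dirichlet_zeta: "dirichlet_zeta holomorphic_on {s. Re s > 1}"
proof (rule holomorphic_uniform_sequence)
  show "open {s. Re s > 1}" by (rule open_halfspace_Re_gt)
  show "(\<lambda>s. \<Sum>n<N. 1 / of_nat (Suc n) powr s) holomorphic_on {s. Re s > 1}" for N
    by (intro holomorphic_intros) auto
  fix x assume "x \<in> {s. Re s > 1}"
  then have x: "Re x > 1" by simp
  define d where "d = (Re x - 1) / 2"
  have d: "d > 0" using x by (simp add: d_def)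
  have Re_ge: "Re y \<ge> 1 + d" if "y \<in> cball x d" for y
  proof -
    have "\<bar>Re (x - y)\<bar> \<le> d" using that abs_Re_le_cmod[of "x - y"] by (simp add: dist_norm)
    then have "Re x - Re y \<le> d" by simp
    then show ?thesis by (simp add: d_def field_simps)
  qed
  have "uniform_limit (cball x d) (\<lambda>N s. \<Sum>n<N. 1 / of_nat (Suc n) powr s)
      (\<lambda>s. \<Sum>n. 1 / of_nat (Suc n) powr s) sequentially"
  proof (rule Weierstrass_m_test)
    show "summable (\<lambda>n. 1 / real (Suc n) powr (1 + d))" using d by (intro summable_zeta_real) auto
    fix n y assume "y \<in> cball x d"
    then have "real (Suc n) powr (1 + d) \<le> real (Suc n) powr Re y"
      using Re_ge by (intro powr_mono) auto
    then show "norm (1 / of_nat (Suc n) powr y :: complex) \<le> 1 / real (Suc n) powr (1 + d)"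
      unfolding norm_dirichlet_term by (intro divide_left_mono) auto
  qed
  then have "uniform_limit (cball x d) (\<lambda>N s. \<Sum>n<N. 1 / of_nat (Suc n) powr s) dirichlet_zeta sequentially"
    unfolding dirichlet_zeta_def[abs_def] .
  moreover have "cball x d \<subseteq> {s. Re s > 1}" using Re_ge d by fastforce
  ultimately show "\<exists>d>0. cball x d \<subseteq> {s. 1 < Re s} \<and>
      uniform_limit (cball x d) (\<lambda>N s. \<Sum>n<N. 1 / of_nat (Suc n) powr s) dirichlet_zeta sequentially"
    using d by blast
qed

text \<open>A choice of the coefficients provided by the preceding theorem.\<close>

definition xi_coeff :: "nat \<Rightarrow> real" where
  "xi_coeff = (SOME b. (\<forall>k. b k \<ge> 0) \<and> (\<forall>r. summable (\<lambda>k. b k * r ^ k)) \<and>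
     (\<forall>s>1. pi powr (- s / 2) * Gamma (s / 2) * (\<Sum>n. 1 / real (Suc n) powr s) =
       (\<Sum>k. b k * ((s - 1 / 2)\<^sup>2) ^ k) + 1 / (s * (s - 1))))"

lemma
  shows xi_coeff_nonneg: "xi_coeff k \<ge> 0"
    and summable_xi_coeff: "summable (\<lambda>k. xi_coeff k * r ^ k)"
    and xi_coeff_sum: "s > 1 \<Longrightarrow> pi powr (- s / 2) * Gamma (s / 2) * (\<Sum>n. 1 / real (Suc n) powr s) =
       (\<Sum>k. xi_coeff k * ((s - 1 / 2)\<^sup>2) ^ k) + 1 / (s * (s - 1))"
proof -
  have "\<exists>b. (\<forall>k. b k \<ge> 0) \<and> (\<forall>r. summable (\<lambda>k. b k * r ^ k)) \<and>
     (\<forall>s>1. pi powr (- s / 2) * Gamma (s / 2) * (\<Sum>n. 1 / real (Suc n) powr s) =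
       (\<Sum>k. b k * ((s - 1 / 2)\<^sup>2) ^ k) + 1 / (s * (s - 1)))"
    by (rule completed_zeta_power_series) blast
  from someI_ex[OF this, folded xi_coeff_def]
  show "xi_coeff k \<ge> 0" "summable (\<lambda>k. xi_coeff k * r ^ k)"
    "s > 1 \<Longrightarrow> pi powr (- s / 2) * Gamma (s / 2) * (\<Sum>n. 1 / real (Suc n) powr s) =
       (\<Sum>k. xi_coeff k * ((s - 1 / 2)\<^sup>2) ^ k) + 1 / (s * (s - 1))"
    by auto
qed

text \<open>The Riemann xi-function, defined so that holomorphy and the symmetry s -> 1 - s are visible.\<close>

definition Xi :: "complex \<Rightarrow> complex" where
  "Xi s = 1 / 2 + ((s - 1 / 2)\<^sup>2 - 1 / 4) / 2 * (\<Sum>k. of_real (xi_coeff k) * ((s - 1 / 2)\<^sup>2) ^ k)"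

lemma summable_xi_coeff_complex:
  "summable (\<lambda>k. of_real (xi_coeff k) * w ^ k :: complex)"
proof (rule summable_norm_cancel)
  have "norm (of_real (xi_coeff k) * w ^ k :: complex) = xi_coeff k * norm w ^ k" for k
    by (simp add: norm_mult norm_power xi_coeff_nonneg)
  then show "summable (\<lambda>k. norm (of_real (xi_coeff k) * w ^ k :: complex))"
    by (simp only: summable_xi_coeff)
qed

lemma holomorphic_Xi: "Xi holomorphic_on A"
proof -
  define F where "F w = (\<Sum>k. of_real (xi_coeff k) * w ^ k)" for w :: complex
  have "F field_differentiable at w" for w
  proof -
    have "(F has_field_derivative (\<Sum>k. diffs (\<lambda>k. of_real (xi_coeff k)) k * w ^ k)) (at w)"
      unfolding F_def[abs_def] by (rule termdiffs_strong_converges_everywhere) (rule summable_xi_coeff_complex)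
    then show ?thesis by (auto simp: field_differentiable_def)
  qed
  then have F: "F holomorphic_on UNIV" by (auto simp: holomorphic_on_def field_differentiable_at_within)
  have "(\<lambda>s. 1 / 2 + ((s - 1 / 2)\<^sup>2 - 1 / 4) / 2 * (F \<circ> (\<lambda>s. (s - 1 / 2)\<^sup>2)) s) holomorphic_on UNIV"
    by (intro holomorphic_intros holomorphic_on_compose_gen[OF _ F]) auto
  then have "Xi holomorphic_on UNIV" by (simp add: Xi_def[abs_def] F_def)
  then show ?thesis by (rule holomorphic_on_subset) simp
qed

lemma Xi_reflect: "Xi (1 - s) = Xi s"
proof -
  have "(1 - s - 1 / 2)\<^sup>2 = (s - 1 / 2)\<^sup>2" by (simp add: power2_eq_square algebra_simps)
  then show ?thesis by (simp only: Xi_def)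
qed

lemma Xi_0: "Xi 0 = 1 / 2" by (simp add: Xi_def power2_eq_square)

lemma Xi_1: "Xi 1 = 1 / 2" using Xi_reflect[of 0] by (simp add: Xi_0)

lemma Xi_of_real:
  assumes "x > 1"
  shows "Xi (of_real x) = of_real (x * (x - 1) / 2 * (pi powr (- x / 2) * Gamma (x / 2) * (\<Sum>n. 1 / real (Suc n) powr x)))"
proof -
  have w: "(complex_of_real x - 1 / 2)\<^sup>2 = of_real ((x - 1 / 2)\<^sup>2)" by simp
  have "Xi (of_real x) = of_real (1 / 2 + ((x - 1 / 2)\<^sup>2 - 1 / 4) / 2 * (\<Sum>k. xi_coeff k * ((x - 1 / 2)\<^sup>2) ^ k))"
  proof -
    have "(\<Sum>k. of_real (xi_coeff k) * complex_of_real ((x - 1 / 2)\<^sup>2) ^ k) =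
        of_real (\<Sum>k. xi_coeff k * ((x - 1 / 2)\<^sup>2) ^ k)"
      by (simp only: of_real_mult[symmetric] of_real_power[symmetric] suminf_of_real[OF summable_xi_coeff])
    then show ?thesis unfolding Xi_def w by simp
  qed
  also have "1 / 2 + ((x - 1 / 2)\<^sup>2 - 1 / 4) / 2 * (\<Sum>k. xi_coeff k * ((x - 1 / 2)\<^sup>2) ^ k) =
     x * (x - 1) / 2 * ((\<Sum>k. xi_coeff k * ((x - 1 / 2)\<^sup>2) ^ k) + 1 / (x * (x - 1)))"
    using assms by (simp add: field_simps power2_eq_square)
  also have "\<dots> = x * (x - 1) / 2 * (pi powr (- x / 2) * Gamma (x / 2) * (\<Sum>n. 1 / real (Suc n) powr x))"
    by (simp only: xi_coeff_sum[OF assms])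
  finally show ?thesis .
qed

text \<open>The entire factor 1/Gamma (s/2 + 1) combines the poles of Gamma (s/2) with the zero of s(s-1) at
0, which leaves s = 1 as the only singularity.\<close>

definition zeta_ext :: "complex \<Rightarrow> complex" where
  "zeta_ext s = (if s = 1 then 0 else Xi s * (of_real pi powr (s / 2) * rGamma (s / 2 + 1) / (s - 1)))"

lemma holomorphic_zeta_ext: "zeta_ext holomorphic_on (- {1})"
proof -
  have "(\<lambda>s. Xi s * (of_real pi powr (s / 2) * rGamma (s / 2 + 1) / (s - 1))) holomorphic_on (- {1})"
    by (intro holomorphic_intros holomorphic_Xi) auto
  then show ?thesis
    by (rule holomorphic_transform) (simp add: zeta_ext_def)
qed

lemma zeta_ext_of_real:
  assumes x: "x > 1"
  shows "zeta_ext (of_real x) = dirichlet_zeta (of_real x)"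
proof -
  define Z where "Z = (\<Sum>n. 1 / real (Suc n) powr x)"
  have ng: "x / 2 \<notin> \<int>\<^sub>\<le>\<^sub>0" using x by (auto elim!: nonpos_Ints_cases)
  have "rGamma (complex_of_real x / 2 + 1) = of_real (rGamma (x / 2 + 1))"
    by (metis of_real_1 of_real_add of_real_divide of_real_numeral rGamma_complex_of_real)
  moreover have "x / 2 * rGamma (x / 2 + 1) = rGamma (x / 2)"
    by (rule rGamma_plus1)
  then have "rGamma (x / 2 + 1) = rGamma (x / 2) / (x / 2)" using x by (simp add: field_simps)
  moreover have "Gamma (x / 2) * rGamma (x / 2) = 1"
    using x by (simp add: rGamma_inverse_Gamma Gamma_eq_zero_iff ng)
  moreover have "complex_of_real pi powr (complex_of_real x / 2) = of_real (pi powr (x / 2))"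
    by (simp flip: powr_of_real)
  moreover have "complex_of_real x \<noteq> 1" using x by (metis of_real_eq_1_iff less_irrefl)
  ultimately have "zeta_ext (of_real x) = of_real (x * (x - 1) / 2 * (pi powr (- x / 2) * Gamma (x / 2) * Z)
     * (pi powr (x / 2) * (rGamma (x / 2) / (x / 2)) / (x - 1)))"
    unfolding zeta_ext_def Xi_of_real[OF x] Z_def by simp
  also have "x * (x - 1) / 2 * (pi powr (- x / 2) * Gamma (x / 2) * Z)
     * (pi powr (x / 2) * (rGamma (x / 2) / (x / 2)) / (x - 1)) =
     (x * (x - 1) / 2 / ((x / 2) * (x - 1))) * (pi powr (- x / 2) * pi powr (x / 2)) * (Gamma (x / 2) * rGamma (x / 2)) * Z"
    by (simp add: field_simps)
  also have "\<dots> = Z"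
    using x \<open>Gamma (x / 2) * rGamma (x / 2) = 1\<close> by (simp flip: powr_add)
  finally show ?thesis by (simp add: Z_def dirichlet_zeta_of_real[OF x])
qed

text \<open>On the real half-line this is the power series identity; the rest of the half plane follows by
the identity theorem.\<close>

lemma zeta_ext_eq_dirichlet:
  assumes "Re s > 1"
  shows "zeta_ext s = dirichlet_zeta s"
proof -
  have "(\<lambda>s. zeta_ext s - dirichlet_zeta s) s = 0"
  proof (rule analytic_continuation[of "\<lambda>s. zeta_ext s - dirichlet_zeta s" "{s. Re s > 1}" "of_real ` {1<..}" 2])
    show "(\<lambda>s. zeta_ext s - dirichlet_zeta s) holomorphic_on {s. Re s > 1}"
      by (intro holomorphic_intros holomorphic_dirichlet_zeta holomorphic_on_subset[OF holomorphic_zeta_ext]) auto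
    show "open {s. Re s > 1}" by (rule open_halfspace_Re_gt)
    show "connected {s. Re s > 1}" by (intro convex_connected convex_halfspace_Re_gt)
    show "(2::complex) islimpt of_real ` {1<..}"
      unfolding islimpt_approachable
    proof (intro allI impI)
      fix e :: real assume "e > 0"
      then show "\<exists>x'\<in>complex_of_real ` {1<..}. x' \<noteq> 2 \<and> dist x' 2 < e"
        by (intro bexI[OF _ imageI[of "2 + e / 2"]]) (auto simp: dist_norm)
    qed
  qed (use assms zeta_ext_of_real in auto)
  then show ?thesis by simp
qed

lemma zeta_eq: "zeta = zeta_ext"
  unfolding zeta_def
proof (rule the_equality)
  show "zeta_ext holomorphic_on - {1} \<and> (\<forall>s. Re s > 1 \<longrightarrow> zeta_ext s = (\<Sum>n. 1 / of_nat (Suc n) powr s)) \<and> zeta_ext 1 = 0"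
    using holomorphic_zeta_ext zeta_ext_eq_dirichlet by (auto simp: dirichlet_zeta_def zeta_ext_def)
  fix f assume f: "f holomorphic_on - {1} \<and> (\<forall>s. Re s > 1 \<longrightarrow> f s = (\<Sum>n. 1 / of_nat (Suc n) powr s)) \<and> f 1 = 0"
  show "f = zeta_ext"
  proof
    fix z
    show "f z = zeta_ext z"
    proof (cases "z = 1")
      case False
      show ?thesis
      proof (rule analytic_continuation_open[of "{s. Re s > 1}" "- {1}" f zeta_ext z])
        show "{s. Re s > 1} \<noteq> {}" by (auto intro: exI[of _ 2])
        show "connected (- {1::complex})" by (rule connected_punctured_universe) simp
      qed (use f holomorphic_zeta_ext zeta_ext_eq_dirichlet False open_halfspace_Re_gt in \<open>auto simp: dirichlet_zeta_def\<close>)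
    qed (use f in \<open>simp add: zeta_ext_def\<close>)
  qed
qed

lemma zeta_eq_dirichlet: "Re s > 1 \<Longrightarrow> zeta s = dirichlet_zeta s"
  by (simp add: zeta_eq zeta_ext_eq_dirichlet)

lemma zeta_Xi: "s \<noteq> 1 \<Longrightarrow> zeta s = Xi s * (of_real pi powr (s / 2) * rGamma (s / 2 + 1) / (s - 1))"
  by (simp add: zeta_eq zeta_ext_def)

text \<open>The defining product agrees with Xi in a punctured neighbourhood of every point, poles of its
factors included.\<close>

lemma riemann_xi_eq: "riemann_xi = Xi"
proof
  fix z :: complex
  let ?h = "\<lambda>s. 1 / 2 * s * (s - 1) * of_real pi powr (- s / 2) * Gamma (s / 2) * zeta s"
  have ev: "\<forall>\<^sub>F s in at z. rGamma (s / 2) \<noteq> 0 \<and> s \<in> UNIV"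
    by (rule non_zero_neighbour_alt[where \<beta> = 2]) (auto intro!: holomorphic_intros)
  have "\<forall>\<^sub>F s in at z. s \<noteq> 1" by (rule eventually_neq_at_within)
  with ev have "\<forall>\<^sub>F s in at z. Xi s = ?h s"
  proof eventually_elim
    case (elim s)
    have g: "Gamma (s / 2) * rGamma (s / 2) = 1"
      using elim by (simp add: rGamma_inverse_Gamma)
    have r: "s / 2 * rGamma (s / 2 + 1) = rGamma (s / 2)" by (rule rGamma_plus1)
    have p: "of_real pi powr (- s / 2) * of_real pi powr (s / 2) = (1 :: complex)"
      by (simp flip: powr_add)
    have "(s - 1) * zeta s = Xi s * (of_real pi powr (s / 2) * rGamma (s / 2 + 1))"
      using elim by (simp add: zeta_Xi)
    moreover have "?h s = 1 / 2 * s * of_real pi powr (- s / 2) * Gamma (s / 2) * ((s - 1) * zeta s)"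
      by (simp only: mult_ac)
    ultimately have "?h s = 1 / 2 * s * of_real pi powr (- s / 2) * Gamma (s / 2) *
        (Xi s * (of_real pi powr (s / 2) * rGamma (s / 2 + 1)))"
      by (simp only:)
    also have "\<dots> = Xi s * (of_real pi powr (- s / 2) * of_real pi powr (s / 2)) * (Gamma (s / 2) * (s / 2 * rGamma (s / 2 + 1)))"
      by (simp add: mult_ac)
    also have "\<dots> = Xi s" by (simp only: g r p mult_1_right)
    finally show ?case ..
  qed
  moreover have "Xi \<midarrow>z\<rightarrow> Xi z"
  proof -
    have "continuous_on UNIV Xi" by (intro holomorphic_on_imp_continuous_on holomorphic_Xi)
    then show ?thesis by (simp add: continuous_on_eq_continuous_at isContD)
  qed
  ultimately have "?h \<midarrow>z\<rightarrow> Xi z" by (rule Lim_transform_eventually[rotated])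
  then show "riemann_xi z = Xi z"
    unfolding riemann_xi_def by (rule remove_sings_eqI)
qed

lemma inverse_squares_Suc_sums: "(\<lambda>n. 1 / (real (Suc n))\<^sup>2) sums (pi\<^sup>2 / 6)"
  using inverse_squares_sums by (simp add: add.commute)

lemma pi_square_less_12: "pi\<^sup>2 < 12"
proof -
  have "pi\<^sup>2 \<le> (3.2)\<^sup>2" using pi_approx by (intro power_mono) auto
  then show ?thesis by (simp add: power2_eq_square)
qed

text \<open>The terms after the first add up to at most pi^2/6 - 1 < 1 in modulus. This half plane and its
mirror image confine the zeros of xi to a vertical strip.\<close>

lemma dirichlet_zeta_nonzero:
  assumes "Re s \<ge> 2"
  shows "dirichlet_zeta s \<noteq> 0"
proof -
  have sm: "summable (\<lambda>n. 1 / of_nat (Suc n) powr s :: complex)" using assms by (intro summable_dirichlet) auto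
  note sq = inverse_squares_Suc_sums
  have "dirichlet_zeta s = 1 + (\<Sum>n. 1 / of_nat (Suc (Suc n)) powr s)"
    unfolding dirichlet_zeta_def using suminf_split_head[OF sm] by (simp del: of_nat_Suc) simp
  moreover have "norm (\<Sum>n. 1 / of_nat (Suc (Suc n)) powr s :: complex) \<le> (\<Sum>n. 1 / (real (Suc (Suc n)))\<^sup>2)"
  proof (rule norm_suminf_le)
    show "summable (\<lambda>n. 1 / (real (Suc (Suc n)))\<^sup>2)"
      using sums_summable[OF sq] by (subst summable_Suc_iff[of "\<lambda>n. 1 / (real (Suc n))\<^sup>2"])
    fix n
    have "real (Suc (Suc n)) powr 2 \<le> real (Suc (Suc n)) powr Re s"
      using assms by (intro powr_mono) auto
    then have "(real (Suc (Suc n)))\<^sup>2 \<le> real (Suc (Suc n)) powr Re s" by (simp add: powr_numeral)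
    then show "norm (1 / of_nat (Suc (Suc n)) powr s :: complex) \<le> 1 / (real (Suc (Suc n)))\<^sup>2"
      unfolding norm_dirichlet_term by (intro divide_left_mono) auto
  qed
  moreover have "(\<Sum>n. 1 / (real (Suc (Suc n)))\<^sup>2) = pi\<^sup>2 / 6 - 1"
    using suminf_split_head[OF sums_summable[OF sq]] sums_unique[OF sq] by simp
  moreover note pi_square_less_12
  ultimately show ?thesis by (auto simp: add_eq_0_iff)
qed

lemma Xi_zero_strip:
  assumes "Xi \<rho> = 0"
  shows "- 1 < Re \<rho>" "Re \<rho> < 2"
proof -
  have *: "Re s < 2" if "Xi s = 0" for s
  proof (rule ccontr)
    assume "\<not> Re s < 2"
    then have s: "Re s \<ge> 2" by simp
    then have "s \<noteq> 1" by auto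
    then have "zeta s = 0" using that by (simp add: zeta_Xi)
    then show False using zeta_eq_dirichlet[of s] dirichlet_zeta_nonzero[OF s] s by simp
  qed
  show "Re \<rho> < 2" using *[OF assms] .
  show "- 1 < Re \<rho>" using *[of "1 - \<rho>"] assms by (simp add: Xi_reflect)
qed

lemma Xi_real_nonzero:
  assumes "x \<ge> (1::real)"
  shows "Xi (of_real x) \<noteq> 0"
proof (cases "x = 1")
  case False
  then have x: "x > 1" using assms by simp
  have "(\<Sum>n. 1 / real (Suc n) powr x) > 0"
    by (intro suminf_pos summable_zeta_real x) auto
  then have "x * (x - 1) / 2 * (pi powr (- x / 2) * Gamma (x / 2) * (\<Sum>n. 1 / real (Suc n) powr x)) > 0"
    using x by (intro mult_pos_pos Gamma_real_pos divide_pos_pos) auto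
  then show ?thesis unfolding Xi_of_real[OF x] by (simp only: of_real_eq_0_iff)
qed (simp add: Xi_1)

lemma rGamma_off_trivial_zeros:
  assumes "\<not> (\<exists>k::nat. k \<ge> 1 \<and> \<rho> = - (2 * of_nat k))"
  shows "rGamma (\<rho> / 2 + 1 :: complex) \<noteq> 0"
proof
  assume "rGamma (\<rho> / 2 + 1) = 0"
  then obtain n where "\<rho> / 2 + 1 = - of_nat n" by (auto simp: rGamma_eq_zero_iff elim!: nonpos_Ints_cases')
  then have "\<rho> = - (2 * of_nat (Suc n))" by (simp add: field_simps eq_neg_iff_add_eq_0)
  then show False using assms by (metis Suc_le_mono One_nat_def le0)
qed

text \<open>The Gamma factor vanishes exactly at the trivial zeros. Conversely xi does not vanish there,
since Xi (-2k) = Xi (1 + 2k) is positive.\<close>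

lemma nontrivial_zeta_zeros_eq: "nontrivial_zeta_zeros = {\<rho>. Xi \<rho> = 0}"
proof (intro equalityI subsetI)
  fix \<rho> assume "\<rho> \<in> nontrivial_zeta_zeros"
  then have r: "\<rho> \<noteq> 1" "zeta \<rho> = 0" "\<not> (\<exists>k::nat. k \<ge> 1 \<and> \<rho> = - (2 * of_nat k))"
    by (auto simp: nontrivial_zeta_zeros_def)
  have "rGamma (\<rho> / 2 + 1) \<noteq> 0" using r(3) by (rule rGamma_off_trivial_zeros)
  with r show "\<rho> \<in> {\<rho>. Xi \<rho> = 0}" by (simp add: zeta_Xi)
next
  fix \<rho> assume "\<rho> \<in> {\<rho>. Xi \<rho> = 0}"
  then have z: "Xi \<rho> = 0" by simp
  have "\<rho> \<noteq> 1" using z by (auto simp: Xi_1)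
  moreover have "\<rho> \<noteq> - (2 * of_nat k)" for k
  proof
    assume "\<rho> = - (2 * of_nat k)"
    then have "Xi (of_real (1 + 2 * real k)) = 0" using z Xi_reflect[of \<rho>] by simp
    then show False using Xi_real_nonzero[of "1 + 2 * real k"] by simp
  qed
  ultimately show "\<rho> \<in> nontrivial_zeta_zeros" using z by (simp add: nontrivial_zeta_zeros_def zeta_Xi)
qed

lemma Xi_frequently_nonzero: "\<forall>\<^sub>F w in at z. Xi w \<noteq> 0"
proof -
  have "\<forall>\<^sub>F w in at z. Xi w \<noteq> 0 \<and> w \<in> UNIV"
    by (rule non_zero_neighbour_alt[where \<beta> = 0]) (auto intro!: holomorphic_Xi simp: Xi_0)
  then show ?thesis by simp
qed

lemma zorder_zeta:
  assumes "Xi \<rho> = 0"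
  shows "zorder zeta \<rho> = zorder Xi \<rho>"
proof -
  define g where "g s = of_real pi powr (s / 2) * rGamma (s / 2 + 1) / (s - 1)" for s :: complex
  have "\<rho> \<in> nontrivial_zeta_zeros" using assms by (simp add: nontrivial_zeta_zeros_eq)
  then have r: "\<rho> \<noteq> 1" "\<not> (\<exists>k::nat. k \<ge> 1 \<and> \<rho> = - (2 * of_nat k))"
    by (auto simp: nontrivial_zeta_zeros_def)
  have "rGamma (\<rho> / 2 + 1) \<noteq> 0" using r(2) by (rule rGamma_off_trivial_zeros)
  then have g0: "g \<rho> \<noteq> 0" using r by (simp add: g_def)
  have gh: "g holomorphic_on - {1}" unfolding g_def by (intro holomorphic_intros) auto
  then have ga: "g analytic_on {\<rho>}" using r by (auto simp: analytic_at intro!: exI[of _ "- {1}"])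
  have "zorder zeta \<rho> = zorder (\<lambda>s. Xi s * g s) \<rho>"
  proof (rule zorder_cong)
    have "\<forall>\<^sub>F s in at \<rho>. s \<in> - {1}" using r by (intro eventually_at_in_open') auto
    then show "\<forall>\<^sub>F s in at \<rho>. zeta s = Xi s * g s"
      by eventually_elim (simp add: zeta_Xi g_def)
  qed simp
  also have "\<dots> = zorder Xi \<rho> + zorder g \<rho>"
  proof (rule zorder_times_analytic[OF _ ga])
    show "Xi analytic_on {\<rho>}" using holomorphic_Xi[of UNIV] by (simp add: analytic_at) blast
    have "\<forall>\<^sub>F s in at \<rho>. g s \<noteq> 0"
      using analytic_at_imp_isCont[OF ga] g0 by (simp add: isCont_def tendsto_imp_eventually_ne)
    with Xi_frequently_nonzero show "\<forall>\<^sub>F s in at \<rho>. Xi s * g s \<noteq> 0" by eventually_elim simp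
  qed
  also have "zorder g \<rho> = 0" by (rule zorder_eq_0I[OF ga g0])
  finally show ?thesis by simp
qed

text \<open>Since the coefficients of the power series are nonnegative, the circle of radius r about 1/2 is
majorised by the real point 1/2 + r. The radius is chosen to make this point 2N, where Gamma (N)
is a factorial.\<close>

lemma Xi_growth:
  assumes N: "N \<ge> 1" and s: "cmod (s - 1 / 2) \<le> 2 * real N - 1 / 2"
  shows "cmod (Xi s) \<le> 1 / 2 + 4 * (real N)\<^sup>2 * fact N"
proof -
  define r where "r = 2 * real N - 1 / 2"
  define w where "w = (s - 1 / 2)\<^sup>2"
  have r0: "r \<ge> 0" using N by (simp add: r_def)
  have w: "norm w \<le> r\<^sup>2" using s by (simp add: w_def norm_power r_def power_mono)
  have "norm (\<Sum>k. of_real (xi_coeff k) * w ^ k) \<le> (\<Sum>k. xi_coeff k * (r\<^sup>2) ^ k)"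
    using w by (intro norm_suminf_le summable_xi_coeff)
      (auto simp: norm_mult norm_power xi_coeff_nonneg intro!: mult_left_mono power_mono)
  also have "(\<Sum>k. xi_coeff k * (r\<^sup>2) ^ k) \<le> 2 * fact N"
  proof -
    define x where "x = 2 * real N"
    have x: "x > 1" "x \<ge> 2" using N by (auto simp: x_def)
    have "(\<Sum>k. xi_coeff k * (r\<^sup>2) ^ k) \<le> (\<Sum>k. xi_coeff k * (r\<^sup>2) ^ k) + 1 / (x * (x - 1))"
      using x by simp
    also have "\<dots> = pi powr (- x / 2) * Gamma (x / 2) * (\<Sum>n. 1 / real (Suc n) powr x)"
      using xi_coeff_sum[OF x(1)] by (simp add: r_def x_def)
    also have "\<dots> \<le> 1 * fact N * 2"
    proof (intro mult_mono)
      have "pi powr (- x / 2) \<le> pi powr 0" using x pi_gt3 by (intro powr_mono) auto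
      then show "pi powr (- x / 2) \<le> 1" by simp
      have "Gamma (x / 2) = fact (N - 1)" using N Gamma_fact[of "N - 1", where 'a = real] by (simp add: x_def of_nat_diff)
      also have "\<dots> \<le> fact N" by (intro fact_mono) auto
      finally show "Gamma (x / 2) \<le> fact N" .
      note sq = inverse_squares_Suc_sums
      have "(\<Sum>n. 1 / real (Suc n) powr x) \<le> (\<Sum>n. 1 / (real (Suc n))\<^sup>2)"
      proof (intro suminf_le summable_zeta_real x sums_summable[OF sq])
        fix n
        have "real (Suc n) powr 2 \<le> real (Suc n) powr x" using x by (intro powr_mono) auto
        then have "(real (Suc n))\<^sup>2 \<le> real (Suc n) powr x" by (simp add: powr_numeral)
        then show "1 / real (Suc n) powr x \<le> 1 / (real (Suc n))\<^sup>2" by (intro divide_left_mono) auto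
      qed
      also have "\<dots> = pi\<^sup>2 / 6" using sums_unique[OF sq] by simp
      also have "\<dots> \<le> 2" using pi_square_less_12 by simp
      finally show "(\<Sum>n. 1 / real (Suc n) powr x) \<le> 2" .
      show "0 \<le> (\<Sum>n. 1 / real (Suc n) powr x)" using x by (intro suminf_nonneg summable_zeta_real) auto
      show "0 \<le> Gamma (x / 2)" using x by (intro Gamma_real_nonneg) auto
    qed auto
    finally show ?thesis by simp
  qed
  finally have F: "norm (\<Sum>k. of_real (xi_coeff k) * w ^ k) \<le> 2 * fact N" .
  have "norm ((w - 1 / 4) / 2) \<le> 2 * (real N)\<^sup>2"
  proof -
    have "norm (w - 1 / 4) \<le> norm w + 1 / 4" using norm_triangle_ineq4[of w "1 / 4"] by simp
    also have "\<dots> \<le> r\<^sup>2 + 1 / 4" using w by simp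
    also have "\<dots> \<le> 4 * (real N)\<^sup>2" using N by (simp add: r_def power2_eq_square algebra_simps)
    finally show ?thesis by (simp add: norm_divide)
  qed
  then have "norm ((w - 1 / 4) / 2 * (\<Sum>k. of_real (xi_coeff k) * w ^ k)) \<le> 2 * (real N)\<^sup>2 * (2 * fact N)"
    unfolding norm_mult using F by (intro mult_mono) auto
  then show ?thesis
    unfolding Xi_def w_def[symmetric]
    using norm_triangle_ineq[of "1 / 2" "(w - 1 / 4) / 2 * (\<Sum>k. of_real (xi_coeff k) * w ^ k)"]
    by simp
qed

section \<open>Partial fractions of the logarithmic derivative of xi\<close>

lemma entire_factor_zero:
  assumes f: "f holomorphic_on UNIV" and nz: "\<exists>w. f w \<noteq> 0"
  obtains h where "h holomorphic_on UNIV" "h a \<noteq> 0" "\<And>s. f s = (s - a) ^ nat (zorder f a) * h s"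
proof -
  define n where "n = nat (zorder f a)"
  obtain r where r: "r > 0" "zor_poly f a holomorphic_on cball a r"
    and eq: "\<And>w. w \<in> cball a r \<Longrightarrow> f w = zor_poly f a w * (w - a) ^ n \<and> zor_poly f a w \<noteq> 0"
    using zorder_exist_zero[OF f open_UNIV connected_UNIV UNIV_I, of a] nz unfolding n_def by blast
  define h where "h s = (if s = a then zor_poly f a a else f s / (s - a) ^ n)" for s
  have h1: "h holomorphic_on (- {a})"
  proof (rule holomorphic_transform)
    show "(\<lambda>s. f s / (s - a) ^ n) holomorphic_on - {a}"
      by (intro holomorphic_intros holomorphic_on_subset[OF f]) auto
  qed (simp add: h_def)
  have h2: "h holomorphic_on ball a r"
  proof (rule holomorphic_transform)
    show "zor_poly f a holomorphic_on ball a r" by (rule holomorphic_on_subset[OF r(2)]) auto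
    fix x assume "x \<in> ball a r"
    then show "zor_poly f a x = h x" using eq[of x] by (auto simp: h_def)
  qed
  have "h holomorphic_on (- {a} \<union> ball a r)"
    by (rule holomorphic_on_Un[OF h1 h2]) auto
  moreover have "- {a} \<union> ball a r = UNIV" using r by auto
  ultimately have "h holomorphic_on UNIV" by simp
  moreover have "h a \<noteq> 0" using eq[of a] r by (simp add: h_def)
  moreover have "f s = (s - a) ^ n * h s" for s using eq[of a] r by (cases "s = a") (auto simp: h_def)
  ultimately show ?thesis using that unfolding n_def by blast
qed

lemma entire_eventually_nonzero:
  assumes "f holomorphic_on UNIV" "f w \<noteq> (0::complex)"
  shows "\<forall>\<^sub>F z in at a. f z \<noteq> 0"
  using non_zero_neighbour_alt[OF assms(1), of a w] assms(2) by (auto elim: eventually_mono)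

lemma entire_factor_zeros:
  assumes "finite S" "f holomorphic_on UNIV" "\<exists>w. f w \<noteq> 0"
  shows "\<exists>g. g holomorphic_on UNIV \<and> (\<forall>s. f s = (\<Prod>a\<in>S. (s - a) ^ nat (zorder f a)) * g s) \<and> (\<forall>a\<in>S. g a \<noteq> 0)"
  using assms
proof (induction S arbitrary: f rule: finite_induct)
  case empty
  then show ?case by (intro exI[of _ f]) auto
next
  case (insert a S)
  obtain h where h: "h holomorphic_on UNIV" "h a \<noteq> 0" "\<And>s. f s = (s - a) ^ nat (zorder f a) * h s"
    using entire_factor_zero[OF insert.prems] by blast
  have zo: "zorder h b = zorder f b" if "b \<in> S" for b
  proof -
    have ba: "b \<noteq> a" using that insert by auto
    have "zorder f b = zorder (\<lambda>s. (s - a) ^ nat (zorder f a) * h s) b"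
      by (rule arg_cong[of _ _ "\<lambda>F. zorder F b"]) (rule ext, rule h(3))
    also have "\<dots> = zorder (\<lambda>s. (s - a) ^ nat (zorder f a)) b + zorder h b"
    proof (rule zorder_times_analytic)
      show "(\<lambda>s. (s - a) ^ nat (zorder f a)) analytic_on {b}" by (intro analytic_intros)
      show "h analytic_on {b}" using h(1) by (meson analytic_at open_UNIV UNIV_I)
      show "\<forall>\<^sub>F z in at b. (z - a) ^ nat (zorder f a) * h z \<noteq> 0"
      proof -
        have "\<forall>\<^sub>F z in at b. f z \<noteq> 0"
          using entire_eventually_nonzero[OF insert.prems(1)] insert.prems(2) by blast
        then show ?thesis by eventually_elim (simp add: h(3)[symmetric])
      qed
    qed
    also have "zorder (\<lambda>s. (s - a) ^ nat (zorder f a)) b = 0"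
      using ba by (intro zorder_eq_0I analytic_intros) auto
    finally show ?thesis by simp
  qed
  from insert.IH[OF h(1)] h(2) obtain g where g: "g holomorphic_on UNIV"
    "\<And>s. h s = (\<Prod>b\<in>S. (s - b) ^ nat (zorder h b)) * g s" "\<And>b. b \<in> S \<Longrightarrow> g b \<noteq> 0" by blast
  have "h s = (\<Prod>b\<in>S. (s - b) ^ nat (zorder f b)) * g s" for s
    unfolding g(2)[of s] using zo by simp
  moreover have "g a \<noteq> 0" using h(2) g(2)[of a] by auto
  moreover have "f s = (\<Prod>b\<in>insert a S. (s - b) ^ nat (zorder f b)) * g s" for s
  proof -
    have "f s = (s - a) ^ nat (zorder f a) * h s" by (rule h(3))
    also have "h s = (\<Prod>b\<in>S. (s - b) ^ nat (zorder f b)) * g s" by fact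
    finally show ?thesis by (simp only: prod.insert[OF insert.hyps] mult.assoc)
  qed
  ultimately show ?case using g(1,3) by blast
qed

lemma has_field_derivative_prod_powers:
  fixes s :: complex
  assumes "finite S" "s \<notin> S"
  shows "((\<lambda>s. \<Prod>a\<in>S. (s - a) ^ m a) has_field_derivative
     (\<Prod>a\<in>S. (s - a) ^ m a) * (\<Sum>a\<in>S. of_nat (m a) / (s - a))) (at s)"
  using assms
proof (induction S rule: finite_induct)
  case (insert b S)
  have p: "((\<lambda>s. (s - b) ^ m b) has_field_derivative (s - b) ^ m b * (of_nat (m b) / (s - b))) (at s)"
  proof (cases "m b")
    case (Suc k)
    have "((\<lambda>s. (s - b) ^ m b) has_field_derivative of_nat (m b) * (s - b) ^ k) (at s)"
      unfolding Suc by (rule derivative_eq_intros refl | simp)+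
    moreover have "of_nat (m b) * (s - b) ^ k = (s - b) ^ m b * (of_nat (m b) / (s - b))"
      using insert by (simp add: Suc)
    ultimately show ?thesis by simp
  qed auto
  have "((\<lambda>s. (s - b) ^ m b * (\<Prod>a\<in>S. (s - a) ^ m a)) has_field_derivative
     (s - b) ^ m b * (of_nat (m b) / (s - b)) * (\<Prod>a\<in>S. (s - a) ^ m a) +
     (\<Prod>a\<in>S. (s - a) ^ m a) * (\<Sum>a\<in>S. of_nat (m a) / (s - a)) * (s - b) ^ m b) (at s)"
    using insert by (intro DERIV_mult p) auto
  then show ?case using insert by (simp add: algebra_simps)
qed auto

text \<open>The Borel-Caratheodory inequality on half the radius: h / (2A - h) maps the disc into the unit
disc and fixes 0, so the Schwarz lemma applies to it.\<close>

lemma Borel_Caratheodory_half: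
  assumes h: "h holomorphic_on ball 0 R" and h0: "h 0 = 0"
    and Re_less: "\<And>z. z \<in> ball 0 R \<Longrightarrow> Re (h z) < A"
    and z: "norm z \<le> R / 2" and R: "R > 0"
  shows "norm (h z) \<le> 2 * A"
proof -
  have A: "A > 0" using Re_less[of 0] R h0 by simp
  \<comment> \<open>The Moebius map w -> w / (2A - w) sends the half plane Re w < A into the unit disc.\<close>
  define p where "p u = h (of_real R * u) / (2 * of_real A - h (of_real R * u))" for u
  have in_ball: "of_real R * u \<in> ball 0 R" if "norm u < 1" for u :: complex
    using that R by (simp add: norm_mult)
  have den: "2 * of_real A - h (of_real R * u) \<noteq> 0" if "norm u < 1" for u
  proof
    assume "2 * of_real A - h (of_real R * u) = 0"
    then have "Re (h (of_real R * u)) = 2 * A" by (simp add: complex_eq_iff)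
    with Re_less[OF in_ball[OF that]] A show False by simp
  qed
  have hol: "p holomorphic_on ball 0 1"
  proof -
    have "(h \<circ> (\<lambda>u. of_real R * u)) holomorphic_on ball 0 1"
      by (rule holomorphic_on_compose_gen[OF _ h]) (use in_ball in \<open>auto intro!: holomorphic_intros\<close>)
    then have "(\<lambda>u. h (of_real R * u)) holomorphic_on ball 0 1" by (simp add: o_def)
    then show ?thesis unfolding p_def[abs_def] using den by (intro holomorphic_intros) auto
  qed
  have less1: "norm (p u) < 1" if u: "norm u < 1" for u
  proof -
    define w where "w = h (of_real R * u)"
    have "Re w < A" unfolding w_def by (rule Re_less[OF in_ball[OF u]])
    then have "A * Re w < A * A" using A by (intro mult_strict_left_mono)
    then have "(norm w)\<^sup>2 < (norm (2 * of_real A - w))\<^sup>2"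
      unfolding cmod_power2 by (simp add: power2_eq_square algebra_simps)
    then have "norm w < norm (2 * of_real A - w)" by (rule power2_less_imp_less) simp
    then show ?thesis using den[OF u] by (simp add: p_def w_def norm_divide divide_less_eq)
  qed
  define u where "u = z / of_real R"
  have u: "norm u \<le> 1 / 2" using z R by (simp add: u_def norm_divide field_simps)
  then have u1: "norm u < 1" by simp
  have "norm (p u) \<le> norm u"
    by (rule Schwarz_Lemma(1)[OF hol _ less1 u1]) (simp add: p_def h0)
  then have pu: "norm (p u) \<le> 1 / 2" using u by simp
  have Ru: "of_real R * u = z" using R by (simp add: u_def)
  have "p u = h z / (2 * of_real A - h z)" "2 * of_real A - h z \<noteq> 0"
    using den[OF u1] by (simp_all add: p_def Ru)
  then have "h z = p u * (2 * of_real A - h z)" by simp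
  then have "norm (h z) = norm (p u) * norm (2 * of_real A - h z)" by (metis norm_mult)
  also have "\<dots> \<le> 1 / 2 * (2 * A + norm (h z))"
    using pu A norm_triangle_ineq4[of "2 * of_real A" "h z"] by (intro mult_mono) auto
  finally show ?thesis by simp
qed

text \<open>On a zero-free disc g has a logarithm. Borel-Caratheodory turns the upper bound for |g| into a
bound for |log g|, and Cauchy's inequality on discs of radius R/4 bounds the second derivative
of log g; the constant is 64 = 2! * 2 * 4^2. The factor R^2 in the denominator is what makes
this useful for entire functions of order less than 2.\<close>

lemma logderiv_increment_bound:
  assumes g: "g holomorphic_on ball 0 R" and nz: "\<And>z. z \<in> ball 0 R \<Longrightarrow> g z \<noteq> 0"
    and B: "\<And>z. z \<in> ball 0 R \<Longrightarrow> norm (g z) < B * norm (g 0)"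
    and s: "norm s \<le> R / 4" and R: "R > 0"
  shows "norm (deriv g s / g s - deriv g 0 / g 0) \<le> 64 * ln B / R\<^sup>2 * norm s"
proof -
  have "contractible (ball (0::complex) R)" by (simp add: convex_imp_contractible)
  from contractible_imp_holomorphic_log[OF g this nz]
  obtain h1 where h1: "h1 holomorphic_on ball 0 R" "\<And>z. z \<in> ball 0 R \<Longrightarrow> g z = exp (h1 z)" by blast
  define h where "h z = h1 z - h1 0" for z
  have h: "h holomorphic_on ball 0 R" unfolding h_def by (intro holomorphic_intros h1)
  have g0: "g 0 \<noteq> 0" using nz R by simp
  have B1: "B > 1" using B[of 0] R g0 by simp
  have Re_h: "Re (h z) < ln B" if "z \<in> ball 0 R" for z
  proof -
    have "exp (Re (h z)) = norm (g z) / norm (g 0)"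
      using that R h1(2)[of z] h1(2)[of 0] by (simp add: h_def exp_diff)
    also have "\<dots> < B" using B[OF that] g0 by (simp add: divide_less_eq)
    also have "B = exp (ln B)" using B1 by simp
    finally show ?thesis by simp
  qed
  have hb: "norm (h z) \<le> 2 * ln B" if "norm z \<le> R / 2" for z
    by (rule Borel_Caratheodory_half[OF h _ Re_h that R]) (simp add: h_def)
  have dh: "deriv h z = deriv g z / g z" if "z \<in> ball 0 R" for z
  proof -
    have "((\<lambda>z. exp (h1 z)) has_field_derivative exp (h1 z) * deriv h1 z) (at z)"
      using that h1(1) by (auto intro!: derivative_eq_intros holomorphic_derivI)
    then have "(g has_field_derivative exp (h1 z) * deriv h1 z) (at z)"
      by (rule has_field_derivative_transform_within_open[of _ _ _ "ball 0 R"]) (use that h1 in auto)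
    then have "deriv g z = g z * deriv h1 z" using h1(2)[OF that] by (simp add: DERIV_imp_deriv)
    moreover have "(h has_field_derivative deriv h1 z) (at z)"
      unfolding h_def[abs_def] using that h1(1) by (auto intro!: derivative_eq_intros holomorphic_derivI)
    then have "deriv h z = deriv h1 z" by (rule DERIV_imp_deriv)
    ultimately show ?thesis using nz[OF that] by simp
  qed
  have ddh: "norm (deriv (deriv h) z) \<le> 64 * ln B / R\<^sup>2" if z: "norm z \<le> R / 4" for z
  proof -
    have sub: "cball z (R / 4) \<subseteq> ball 0 R"
    proof
      fix x assume "x \<in> cball z (R / 4)"
      then have "norm (x - z) \<le> R / 4" by (simp add: dist_norm norm_minus_commute)
      then have "norm x \<le> R / 2" using z norm_triangle_ineq[of "x - z" z] by simp
      then show "x \<in> ball 0 R" using R by simp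
    qed
    have "norm ((deriv ^^ 2) h z) \<le> fact 2 * (2 * ln B) / (R / 4) ^ 2"
    proof (rule Cauchy_inequality)
      show "h holomorphic_on ball z (R / 4)" by (rule holomorphic_on_subset[OF h]) (use sub in force)
      show "continuous_on (cball z (R / 4)) h"
        by (rule holomorphic_on_imp_continuous_on[OF holomorphic_on_subset[OF h sub]])
      fix x assume "norm (z - x) = R / 4"
      then have "norm x \<le> R / 2" using z norm_triangle_ineq[of "x - z" z] by (simp add: norm_minus_commute)
      then show "norm (h x) \<le> 2 * ln B" by (rule hb)
    qed (use R in auto)
    then show ?thesis by (simp add: numeral_2_eq_2 power_divide)
  qed
  have "norm (deriv h s - deriv h 0) \<le> 64 * ln B / R\<^sup>2 * norm (s - 0)"
  proof (rule field_differentiable_bound[of "cball 0 (R / 4)" "deriv h" "deriv (deriv h)"])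
    fix z :: complex assume "z \<in> cball 0 (R / 4)"
    then have "norm z \<le> R / 4" by simp
    then show "norm (deriv (deriv h) z) \<le> 64 * ln B / R\<^sup>2" by (rule ddh)
    have "z \<in> ball 0 R" using \<open>norm z \<le> R / 4\<close> R by simp
    moreover have "deriv h holomorphic_on ball 0 R" by (intro holomorphic_deriv h) auto
    ultimately have "(deriv h has_field_derivative deriv (deriv h) z) (at z)"
      by (intro holomorphic_derivI) auto
    then show "(deriv h has_field_derivative deriv (deriv h) z) (at z within cball 0 (R / 4))"
      by (rule has_field_derivative_at_within)
  qed (use s R in auto)
  moreover have "s \<in> ball 0 R" "0 \<in> ball 0 R" using s R by auto
  ultimately show ?thesis using dh by simp
qed

definition Zeros :: "complex set" where "Zeros = {\<rho>. Xi \<rho> = 0}"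

definition xi_mult :: "complex \<Rightarrow> nat" where "xi_mult \<rho> = nat (zorder Xi \<rho>)"

lemma Xi_nonzero: "\<exists>w. Xi w \<noteq> 0" by (intro exI[of _ 0], subst Xi_0) simp

lemma xi_mult_pos: "\<rho> \<in> Zeros \<Longrightarrow> xi_mult \<rho> > 0"
  using zorder_exist_zero[OF holomorphic_Xi open_UNIV connected_UNIV UNIV_I, of \<rho>] Xi_nonzero
  by (auto simp: Zeros_def xi_mult_def)

lemma zorder_Xi: "\<rho> \<in> Zeros \<Longrightarrow> zorder Xi \<rho> = int (xi_mult \<rho>)"
  using xi_mult_pos[of \<rho>] by (simp add: xi_mult_def)

lemma Zeros_reflect: "1 - \<rho> \<in> Zeros \<longleftrightarrow> \<rho> \<in> Zeros"
  by (simp add: Zeros_def Xi_reflect)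

lemma xi_mult_reflect: "xi_mult (1 - \<rho>) = xi_mult \<rho>"
proof -
  obtain h where h: "h holomorphic_on UNIV" "h \<rho> \<noteq> 0" "\<And>s. Xi s = (s - \<rho>) ^ xi_mult \<rho> * h s"
    using entire_factor_zero[OF holomorphic_Xi Xi_nonzero] unfolding xi_mult_def by blast
  have "zorder Xi (1 - \<rho>) = int (xi_mult \<rho>)"
  proof (rule zorder_eqI[of UNIV _ "\<lambda>s. (- 1) ^ xi_mult \<rho> * h (1 - s)"])
    have "(h \<circ> (\<lambda>s. 1 - s)) holomorphic_on UNIV"
      by (rule holomorphic_on_compose_gen[OF _ h(1)]) (auto intro!: holomorphic_intros)
    then show "(\<lambda>s. (- 1) ^ xi_mult \<rho> * h (1 - s)) holomorphic_on UNIV"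
      by (intro holomorphic_intros) (simp add: o_def)
    fix w :: complex
    have "Xi w = (1 - w - \<rho>) ^ xi_mult \<rho> * h (1 - w)" using h(3)[of "1 - w"] by (simp add: Xi_reflect)
    also have "1 - w - \<rho> = (- 1) * (w - (1 - \<rho>))" by simp
    finally show "Xi w = (- 1) ^ xi_mult \<rho> * h (1 - w) * (w - (1 - \<rho>)) powi int (xi_mult \<rho>)"
      by (simp only: power_mult_distrib) (simp add: mult_ac)
  qed (use h(2) in auto)
  then show ?thesis by (simp add: xi_mult_def)
qed

lemma finite_Zeros_compact:
  assumes "compact K"
  shows "finite (Zeros \<inter> K)"
proof -
  have "finite {z \<in> K. Xi z = 0}"
  proof (cases "Xi constant_on UNIV")
    case True
    then have "Xi w = Xi 0" for w unfolding constant_on_def by (metis UNIV_I)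
    then have "Xi w \<noteq> 0" for w using Xi_0 by (metis divide_eq_0_iff zero_neq_numeral zero_neq_one)
    then show ?thesis by simp
  next
    case False
    then show ?thesis
      by (intro holomorphic_compact_finite_zeros[OF holomorphic_Xi open_UNIV connected_UNIV assms]) auto
  qed
  moreover have "Zeros \<inter> K = {z \<in> K. Xi z = 0}" by (auto simp: Zeros_def)
  ultimately show ?thesis by simp
qed


text \<open>Four times this radius is the radius 2N - 1/2 of the growth estimate for xi.\<close>

definition Zeros_upto :: "nat \<Rightarrow> complex set" where
  "Zeros_upto N = Zeros \<inter> cball (1 / 2) ((2 * real N - 1 / 2) / 4)"

lemma finite_Zeros_upto: "finite (Zeros_upto N)"
  unfolding Zeros_upto_def by (rule finite_Zeros_compact) simp

lemma Zeros_upto_subset: "Zeros_upto N \<subseteq> Zeros" by (auto simp: Zeros_upto_def)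

lemma filterlim_Zeros_upto: "filterlim Zeros_upto (finite_subsets_at_top Zeros) sequentially"
  unfolding filterlim_finite_subsets_at_top
proof (intro allI impI)
  fix X assume X: "finite X \<and> X \<subseteq> Zeros"
  then have "bounded X" by (simp add: finite_imp_bounded)
  then obtain e where e: "\<And>x. x \<in> X \<Longrightarrow> dist (1 / 2) x \<le> e" by (auto simp: bounded_any_center[of _ "1 / 2"])
  have "\<forall>\<^sub>F N in sequentially. (2 * real N - 1 / 2) / 4 \<ge> e" by real_asymp
  then show "\<forall>\<^sub>F N in sequentially. finite (Zeros_upto N) \<and> X \<subseteq> Zeros_upto N \<and> Zeros_upto N \<subseteq> Zeros"
  proof eventually_elim
    case (elim N)
    then show ?case using X e finite_Zeros_upto Zeros_upto_subset by (fastforce simp: Zeros_upto_def)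
  qed
qed

lemma Zeros_upto_reflect: "(\<lambda>\<rho>. 1 - \<rho>) ` Zeros_upto N = Zeros_upto N"
proof -
  have *: "1 - \<rho> \<in> Zeros_upto N" if "\<rho> \<in> Zeros_upto N" for \<rho>
  proof -
    have "1 / 2 - (1 - \<rho>) = - (1 / 2 - \<rho>)" by simp
    then have "dist (1 / 2) (1 - \<rho>) = dist (1 / 2) \<rho>" unfolding dist_norm by (metis norm_minus_cancel)
    with that show ?thesis by (auto simp: Zeros_upto_def Zeros_reflect)
  qed
  show ?thesis
  proof (intro equalityI subsetI)
    fix \<rho> assume "\<rho> \<in> Zeros_upto N"
    then show "\<rho> \<in> (\<lambda>\<rho>. 1 - \<rho>) ` Zeros_upto N" using * by (intro image_eqI[of _ _ "1 - \<rho>"]) auto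
  qed (use * in auto)
qed

definition L :: "complex \<Rightarrow> complex" where "L s = deriv Xi s / Xi s"

definition zero_sum :: "nat \<Rightarrow> complex \<Rightarrow> complex" where
  "zero_sum N s = (\<Sum>\<rho>\<in>Zeros_upto N. of_nat (xi_mult \<rho>) / (s - \<rho>))"

lemma L_reflect: "L (1 - s) = - L s"
proof -
  have "(Xi has_field_derivative deriv Xi (1 - s)) (at (1 - s))"
    by (rule holomorphic_derivI[OF holomorphic_Xi[of UNIV]]) auto
  then have "((\<lambda>s. Xi (1 - s)) has_field_derivative deriv Xi (1 - s) * (- 1)) (at s)"
    by (rule DERIV_chain2) (auto intro!: derivative_eq_intros)
  then have "deriv Xi s = - deriv Xi (1 - s)" by (simp add: Xi_reflect DERIV_imp_deriv)
  then show ?thesis by (simp add: L_def Xi_reflect)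
qed

lemma zero_sum_reflect: "zero_sum N (1 - s) = - zero_sum N s"
proof -
  have "zero_sum N (1 - s) = (\<Sum>\<rho>\<in>(\<lambda>\<rho>. 1 - \<rho>) ` Zeros_upto N. of_nat (xi_mult \<rho>) / (1 - s - \<rho>))"
    by (simp add: zero_sum_def Zeros_upto_reflect)
  also have "\<dots> = (\<Sum>\<rho>\<in>Zeros_upto N. of_nat (xi_mult (1 - \<rho>)) / (1 - s - (1 - \<rho>)))"
    by (subst sum.reindex) (auto simp: inj_on_def)
  also have "\<dots> = (\<Sum>\<rho>\<in>Zeros_upto N. - (of_nat (xi_mult \<rho>) / (s - \<rho>)))"
  proof (rule sum.cong[OF refl])
    fix \<rho>
    have "1 - s - (1 - \<rho>) = - (s - \<rho>)" by simp
    then show "of_nat (xi_mult (1 - \<rho>)) / (1 - s - (1 - \<rho>)) = - (of_nat (xi_mult \<rho>) / (s - \<rho>) :: complex)"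
      by (simp only: xi_mult_reflect divide_minus_right)
  qed
  finally show ?thesis by (simp add: zero_sum_def sum_negf)
qed

text \<open>Divide xi by its zeros in the disc of radius R about 1/2. On the circle of radius 4R every
linear factor is at least 3R, whereas at 0 it is at most 2R. By the maximum principle the
quotient g is therefore at most 3 M |g(0)| on the large disc, where M bounds xi, whatever the
number of zeros; and g has no zeros near 0.\<close>

lemma logderiv_remainder_bound:
  assumes N: "N \<ge> 4" and s: "norm s \<le> (real N - 4) / 8" and nz: "Xi s \<noteq> 0"
  shows "norm ((L s - zero_sum N s) - (L 0 - zero_sum N 0)) \<le>
     64 * ln (3 * (1 / 2 + 4 * (real N)\<^sup>2 * fact N)) / ((real N - 2) / 2)\<^sup>2 * norm s"
proof -
  define R where "R = (2 * real N - 1 / 2) / 4"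
  define M where "M = 1 / 2 + 4 * (real N)\<^sup>2 * fact N"
  define r where "r = (real N - 2) / 2"
  have R: "R > 1" using N by (auto simp: R_def)
  have r0: "r > 0" using N by (simp add: r_def)
  define m where "m \<rho> = nat (zorder Xi \<rho>)" for \<rho>
  define S where "S = Zeros_upto N"
  have finS: "finite S" by (simp add: S_def finite_Zeros_upto)
  from entire_factor_zeros[OF finS holomorphic_Xi Xi_nonzero]
  obtain g where g: "g holomorphic_on UNIV" "\<And>s. Xi s = (\<Prod>a\<in>S. (s - a) ^ m a) * g s" "\<And>a. a \<in> S \<Longrightarrow> g a \<noteq> 0"
    unfolding m_def by blast
  have S_le: "norm (a - 1 / 2) \<le> R" if "a \<in> S" for a
    using that by (simp add: S_def Zeros_upto_def R_def dist_norm norm_minus_commute)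
  have in_disc: "norm (z - 1 / 2) \<le> R" if "norm z < r" for z :: complex
  proof -
    have "norm (z - 1 / 2) \<le> norm z + 1 / 2" using norm_triangle_ineq4[of z "1 / 2"] by simp
    then show ?thesis using that by (simp add: r_def R_def field_simps)
  qed
  have g_nz: "g z \<noteq> 0" if "norm z < r" for z
  proof
    assume "g z = 0"
    then have "Xi z = 0" by (simp add: g(2)[of z])
    then have "z \<in> S" using in_disc[OF that]
      by (simp add: S_def Zeros_upto_def Zeros_def R_def dist_norm norm_minus_commute)
    with g(3) \<open>g z = 0\<close> show False by blast
  qed
  define n where "n = (\<Sum>a\<in>S. m a)"
  have g0: "norm (g 0) \<ge> 1 / 2 / (2 * R) ^ n"
  proof -
    have "1 / 2 = norm (Xi 0)" by (simp add: Xi_0)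
    also have "\<dots> = (\<Prod>a\<in>S. norm a ^ m a) * norm (g 0)"
      unfolding g(2)[of 0] by (simp add: norm_mult prod_norm[symmetric] norm_power)
    also have "(\<Prod>a\<in>S. norm a ^ m a) \<le> (\<Prod>a\<in>S. (2 * R) ^ m a)"
    proof (rule prod_mono)
      fix a assume "a \<in> S"
      have "norm a \<le> norm (a - 1 / 2) + 1 / 2" using norm_triangle_ineq[of "a - 1 / 2" "1 / 2"] by simp
      then have "norm a \<le> 2 * R" using S_le[OF \<open>a \<in> S\<close>] R by simp
      then show "0 \<le> norm a ^ m a \<and> norm a ^ m a \<le> (2 * R) ^ m a" by (intro conjI power_mono zero_le_power) auto
    qed
    also have "(\<Prod>a\<in>S. (2 * R) ^ m a) = (2 * R) ^ n" by (simp add: n_def power_sum)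
    finally have "1 / 2 \<le> (2 * R) ^ n * norm (g 0)" by (simp add: mult_right_mono)
    then show ?thesis using R by (simp add: field_simps)
  qed
  have gM: "norm (g z) \<le> M / (3 * R) ^ n" if "z \<in> cball (1 / 2) (4 * R)" for z
  proof (rule maximum_modulus_frontier[OF _ _ _ _ that])
    show "g holomorphic_on interior (cball (1 / 2) (4 * R))" by (rule holomorphic_on_subset[OF g(1)]) simp
    show "continuous_on (closure (cball (1 / 2) (4 * R))) g"
      by (rule holomorphic_on_imp_continuous_on[OF holomorphic_on_subset[OF g(1)]]) simp
    fix z :: complex assume "z \<in> frontier (cball (1 / 2) (4 * R))"
    then have z: "norm (z - 1 / 2) = 4 * R" using R by (simp add: frontier_cball dist_norm norm_minus_commute)
    have "(3 * R) ^ n * norm (g z) \<le> (\<Prod>a\<in>S. norm (z - a) ^ m a) * norm (g z)"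
    proof (rule mult_right_mono)
      have "(3 * R) ^ n = (\<Prod>a\<in>S. (3 * R) ^ m a)" by (simp add: n_def power_sum)
      also have "\<dots> \<le> (\<Prod>a\<in>S. norm (z - a) ^ m a)"
      proof (rule prod_mono)
        fix a assume "a \<in> S"
        have "norm (z - 1 / 2) \<le> norm (z - a) + norm (a - 1 / 2)"
          using norm_triangle_ineq[of "z - a" "a - 1 / 2"] by simp
        then have "3 * R \<le> norm (z - a)" using S_le[OF \<open>a \<in> S\<close>] z by simp
        then show "0 \<le> (3 * R) ^ m a \<and> (3 * R) ^ m a \<le> norm (z - a) ^ m a"
          using R by (intro conjI power_mono zero_le_power) auto
      qed
      finally show "(3 * R) ^ n \<le> (\<Prod>a\<in>S. norm (z - a) ^ m a)" .
    qed simp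
    also have "\<dots> = norm (Xi z)" unfolding g(2)[of z] by (simp add: norm_mult prod_norm[symmetric] norm_power)
    also have "\<dots> \<le> M" unfolding M_def
      by (rule Xi_growth) (use N z in \<open>auto simp: R_def\<close>)
    finally show "norm (g z) \<le> M / (3 * R) ^ n" using R by (simp add: field_simps)
  qed simp
  have M0: "M > 0" unfolding M_def by (intro add_pos_nonneg) auto
  have gB: "norm (g z) < 3 * M * norm (g 0)" if "norm z < r" for z
  proof -
    have "norm (g z) \<le> M / (3 * R) ^ n"
      by (rule gM) (use in_disc[OF that] R in \<open>simp add: dist_norm norm_minus_commute\<close>)
    also have "\<dots> \<le> M / (2 * R) ^ n"
      using R M0 by (intro divide_left_mono power_mono) auto
    also have "\<dots> < 3 * M * (1 / 2 / (2 * R) ^ n)" using R M0 by (simp add: field_simps)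
    also have "\<dots> \<le> 3 * M * norm (g 0)" using g0 M0 by (intro mult_left_mono) auto
    finally show ?thesis .
  qed
  have split: "L z - zero_sum N z = deriv g z / g z" if "Xi z \<noteq> 0" for z
  proof -
    have zS: "z \<notin> S" using that by (auto simp: S_def Zeros_upto_def Zeros_def)
    have gd: "(g has_field_derivative deriv g z) (at z)"
      by (rule holomorphic_derivI[OF g(1)]) auto
    have "((\<lambda>s. (\<Prod>a\<in>S. (s - a) ^ m a) * g s) has_field_derivative
       ((\<Prod>a\<in>S. (z - a) ^ m a) * (\<Sum>a\<in>S. of_nat (m a) / (z - a))) * g z + deriv g z * (\<Prod>a\<in>S. (z - a) ^ m a)) (at z)"
      by (intro DERIV_mult has_field_derivative_prod_powers finS zS gd)
    moreover have "(\<lambda>s. (\<Prod>a\<in>S. (s - a) ^ m a) * g s) = Xi" using g(2) by auto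
    ultimately have "deriv Xi z = (\<Prod>a\<in>S. (z - a) ^ m a) * (\<Sum>a\<in>S. of_nat (m a) / (z - a)) * g z + deriv g z * (\<Prod>a\<in>S. (z - a) ^ m a)"
      by (simp add: DERIV_imp_deriv)
    moreover have "Xi z = (\<Prod>a\<in>S. (z - a) ^ m a) * g z" by (rule g(2))
    moreover have "(\<Prod>a\<in>S. (z - a) ^ m a) \<noteq> 0" "g z \<noteq> 0" using that g(2)[of z] by auto
    ultimately have "L z = (\<Sum>a\<in>S. of_nat (m a) / (z - a)) + deriv g z / g z"
      by (simp add: L_def add_divide_distrib)
    then show ?thesis by (simp add: zero_sum_def S_def m_def xi_mult_def)
  qed
  have X0: "Xi 0 \<noteq> 0" by (subst Xi_0) simp
  have "norm (deriv g s / g s - deriv g 0 / g 0) \<le> 64 * ln (3 * M) / r\<^sup>2 * norm s"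
  proof (rule logderiv_increment_bound)
    show "g holomorphic_on ball 0 r" by (rule holomorphic_on_subset[OF g(1)]) simp
    show "norm s \<le> r / 4" using s N by (simp add: r_def field_simps)
  qed (use g_nz gB r0 in auto)
  then show ?thesis using split[OF nz] split[OF X0] by (simp add: M_def r_def)
qed

lemma logderiv_error_tendsto:
  "(\<lambda>N. 64 * ln (3 * (1 / 2 + 4 * (real N)\<^sup>2 * fact N)) / ((real N - 2) / 2)\<^sup>2 * c) \<longlonglongrightarrow> 0"
proof (rule tendsto_sandwich)
  show "(\<lambda>N. - (64 * (ln (3 * (1 / 2 + 4 * (real N)\<^sup>2)) + real N * ln (real N)) / ((real N - 2) / 2)\<^sup>2 * \<bar>c\<bar>)) \<longlonglongrightarrow> 0"
    by real_asymp
  show "(\<lambda>N. 64 * (ln (3 * (1 / 2 + 4 * (real N)\<^sup>2)) + real N * ln (real N)) / ((real N - 2) / 2)\<^sup>2 * \<bar>c\<bar>) \<longlonglongrightarrow> 0"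
    by real_asymp
  have b: "\<bar>64 * ln (3 * (1 / 2 + 4 * (real N)\<^sup>2 * fact N)) / ((real N - 2) / 2)\<^sup>2 * c\<bar> \<le>
     64 * (ln (3 * (1 / 2 + 4 * (real N)\<^sup>2)) + real N * ln (real N)) / ((real N - 2) / 2)\<^sup>2 * \<bar>c\<bar>"
    if N: "N \<ge> 3" for N
  proof -
    have f1: "(1::real) \<le> fact N" by (rule fact_ge_1)
    have "1 * 1 \<le> (real N)\<^sup>2 * fact N" using N f1 by (intro mult_mono) auto
    then have l0: "ln (3 * (1 / 2 + 4 * (real N)\<^sup>2 * fact N)) \<ge> 0" by (intro ln_ge_zero) auto
    have "(fact N :: real) \<le> of_nat (N ^ N)" by (rule fact_le_power)
    then have fN: "(fact N :: real) \<le> real N ^ N" by simp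
    have "3 * (1 / 2 + 4 * (real N)\<^sup>2 * fact N) \<le> 3 * (1 / 2 * fact N + 4 * (real N)\<^sup>2 * fact N)"
      using f1 by simp
    also have "\<dots> = 3 * (1 / 2 + 4 * (real N)\<^sup>2) * fact N" by (simp add: algebra_simps)
    also have "\<dots> \<le> 3 * (1 / 2 + 4 * (real N)\<^sup>2) * real N ^ N" using fN by (intro mult_left_mono) auto
    finally have "ln (3 * (1 / 2 + 4 * (real N)\<^sup>2 * fact N)) \<le> ln (3 * (1 / 2 + 4 * (real N)\<^sup>2) * real N ^ N)"
      using N by (subst ln_le_cancel_iff) (auto intro!: add_pos_nonneg mult_pos_pos)
    also have "\<dots> = ln (3 * (1 / 2 + 4 * (real N)\<^sup>2)) + real N * ln (real N)"
      using N by (subst ln_mult_pos) (auto intro!: add_pos_nonneg simp: ln_realpow)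
    finally have "64 * ln (3 * (1 / 2 + 4 * (real N)\<^sup>2 * fact N)) / ((real N - 2) / 2)\<^sup>2 * \<bar>c\<bar> \<le>
       64 * (ln (3 * (1 / 2 + 4 * (real N)\<^sup>2)) + real N * ln (real N)) / ((real N - 2) / 2)\<^sup>2 * \<bar>c\<bar>"
      by (intro mult_right_mono divide_right_mono) auto
    then show ?thesis using l0 by (simp add: abs_mult)
  qed
  show "\<forall>\<^sub>F N in sequentially. - (64 * (ln (3 * (1 / 2 + 4 * (real N)\<^sup>2)) + real N * ln (real N)) / ((real N - 2) / 2)\<^sup>2 * \<bar>c\<bar>)
      \<le> 64 * ln (3 * (1 / 2 + 4 * (real N)\<^sup>2 * fact N)) / ((real N - 2) / 2)\<^sup>2 * c"
  proof (use eventually_ge_at_top[of 3] in eventually_elim)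
    case (elim N)
    show ?case using abs_le_D2[OF b[OF elim]] by linarith
  qed
  show "\<forall>\<^sub>F N in sequentially. 64 * ln (3 * (1 / 2 + 4 * (real N)\<^sup>2 * fact N)) / ((real N - 2) / 2)\<^sup>2 * c
      \<le> 64 * (ln (3 * (1 / 2 + 4 * (real N)\<^sup>2)) + real N * ln (real N)) / ((real N - 2) / 2)\<^sup>2 * \<bar>c\<bar>"
  proof (use eventually_ge_at_top[of 3] in eventually_elim)
    case (elim N)
    show ?case using abs_le_D1[OF b[OF elim]] .
  qed
qed

lemma L_increment_limit:
  assumes "Xi s \<noteq> 0"
  shows "(\<lambda>N. (L s - zero_sum N s) - (L 0 - zero_sum N 0)) \<longlonglongrightarrow> 0"
proof (rule tendsto_norm_zero_cancel, rule tendsto_sandwich[OF _ _ tendsto_const logderiv_error_tendsto[of "norm s"]])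
  have "\<forall>\<^sub>F N in sequentially. norm s \<le> (real N - 4) / 8" by real_asymp
  with eventually_ge_at_top[of 4]
  show "\<forall>\<^sub>F N in sequentially. norm ((L s - zero_sum N s) - (L 0 - zero_sum N 0)) \<le>
      64 * ln (3 * (1 / 2 + 4 * (real N)\<^sup>2 * fact N)) / ((real N - 2) / 2)\<^sup>2 * norm s"
    by eventually_elim (rule logderiv_remainder_bound[OF _ _ assms])
qed simp

text \<open>The remainder bound controls the difference of L and the partial sums up to an additive
constant. Both functions are odd about 1/2, and comparing the points 0 and 1 shows that the
constant tends to 0 as well.\<close>

theorem L_partial_fractions:
  assumes "Xi s \<noteq> 0"
  shows "(\<lambda>N. zero_sum N s) \<longlonglongrightarrow> L s"
proof -
  have X1: "Xi 1 \<noteq> 0" by (subst Xi_1) simp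
  have "L 1 - zero_sum N 1 = - (L 0 - zero_sum N 0)" for N
    using L_reflect[of 0] zero_sum_reflect[of N 0] by simp
  then have "(L 1 - zero_sum N 1) - (L 0 - zero_sum N 0) = - 2 * (L 0 - zero_sum N 0)" for N
    by simp
  with L_increment_limit[OF X1] have "(\<lambda>N. - 2 * (L 0 - zero_sum N 0)) \<longlonglongrightarrow> 0" by (simp only:)
  then have "(\<lambda>N. (- 1 / 2) * (- 2 * (L 0 - zero_sum N 0))) \<longlonglongrightarrow> (- 1 / 2) * 0"
    by (intro tendsto_mult tendsto_const)
  moreover have "(- 1 / 2) * (- 2 * x) = x" for x :: complex by simp
  ultimately have "(\<lambda>N. L 0 - zero_sum N 0) \<longlonglongrightarrow> 0" by (simp only: mult_zero_right)
  from tendsto_add[OF L_increment_limit[OF assms] this]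
  have "(\<lambda>N. L s - zero_sum N s) \<longlonglongrightarrow> 0" by simp
  from tendsto_diff[OF tendsto_const[of "L s"] this] show ?thesis by simp
qed


lemma Xi_nonzero_near:
  assumes "Xi s \<noteq> 0"
  shows "\<exists>d>0. \<forall>\<rho>\<in>Zeros. norm (s - \<rho>) \<ge> d"
proof -
  have "continuous_on UNIV Xi" by (intro holomorphic_on_imp_continuous_on holomorphic_Xi)
  then have "open (Xi -` (- {0}))" by (rule open_vimage[rotated]) auto
  moreover have "s \<in> Xi -` (- {0})" using assms by simp
  ultimately obtain d where d: "d > 0" "ball s d \<subseteq> Xi -` (- {0})" by (meson open_contains_ball)
  have "norm (s - \<rho>) \<ge> d" if "\<rho> \<in> Zeros" for \<rho>
  proof (rule ccontr)
    assume "\<not> norm (s - \<rho>) \<ge> d"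
    then have "\<rho> \<in> ball s d" by (simp add: dist_norm)
    then show False using d(2) that by (auto simp: Zeros_def)
  qed
  then show ?thesis using d(1) by blast
qed

lemma Zeros_separated:
  assumes "Xi s \<noteq> 0"
  obtains c where "c > 0" "\<And>\<rho>. \<rho> \<in> Zeros \<Longrightarrow> norm (s - \<rho>) \<ge> c * norm \<rho>"
proof -
  obtain d where d: "d > 0" "\<And>\<rho>. \<rho> \<in> Zeros \<Longrightarrow> norm (s - \<rho>) \<ge> d"
    using Xi_nonzero_near[OF assms] by blast
  \<comment> \<open>The first bound serves for the zeros with |rho| at least 2|s|, the second for the others.\<close>
  define c where "c = min (1 / 2) (d / (2 * norm s + 1))"
  have pos: "2 * norm s + 1 > 0" by (intro add_nonneg_pos) auto
  have c: "c > 0" using d pos by (simp add: c_def)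
  have cle: "c \<le> 1 / 2" "c \<le> d / (2 * norm s + 1)" unfolding c_def by (rule min.cobounded1, rule min.cobounded2)
  have "norm (s - \<rho>) \<ge> c * norm \<rho>" if "\<rho> \<in> Zeros" for \<rho>
  proof (cases "norm \<rho> \<ge> 2 * norm s")
    case True
    have "norm \<rho> \<le> norm (s - \<rho>) + norm s"
      using norm_triangle_ineq[of "\<rho> - s" s] by (simp add: norm_minus_commute)
    then have "1 / 2 * norm \<rho> \<le> norm (s - \<rho>)" using True by simp
    moreover have "c * norm \<rho> \<le> 1 / 2 * norm \<rho>" using cle(1) by (rule mult_right_mono) simp
    ultimately show ?thesis by linarith
  next
    case False
    have "c * norm \<rho> \<le> d / (2 * norm s + 1) * (2 * norm s + 1)"
      using False c pos d(1) cle(2) by (intro mult_mono) auto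
    also have "\<dots> = d" using pos by simp
    also have "d \<le> norm (s - \<rho>)" by (rule d(2)[OF that])
    finally show ?thesis .
  qed
  with c show ?thesis using that by blast
qed

lemma Zeros_nonzero: "\<rho> \<in> Zeros \<Longrightarrow> \<rho> \<noteq> 0" "\<rho> \<in> Zeros \<Longrightarrow> \<rho> \<noteq> 1"
  using Xi_0 Xi_1 by (auto simp: Zeros_def)

lemma Zeros_norm_lower: "\<exists>e>0. \<forall>\<rho>\<in>Zeros. norm \<rho> \<ge> e"
  using Xi_nonzero_near[of 0] by (simp add: Xi_0)

text \<open>At s = 5, to the right of the zero strip, the term of a zero has real part at least m / |5 -
rho|^2. As the partial sums of the partial fractions converge, these nonnegative terms have
bounded sums.\<close>

theorem summable_inverse_square_zeros: "(\<lambda>\<rho>. real (xi_mult \<rho>) / (norm \<rho>)\<^sup>2) summable_on Zeros"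
proof -
  have X5: "Xi 5 \<noteq> 0" using Xi_real_nonzero[of 5] by simp
  have Re_ge: "Re (of_nat (xi_mult \<rho>) / (5 - \<rho>)) \<ge> real (xi_mult \<rho>) / (norm (5 - \<rho>))\<^sup>2" if "\<rho> \<in> Zeros" for \<rho>
  proof -
    have "Re \<rho> < 2" using Xi_zero_strip[of \<rho>] that by (simp add: Zeros_def)
    then have "real (xi_mult \<rho>) / (norm (5 - \<rho>))\<^sup>2 \<le> real (xi_mult \<rho>) * (5 - Re \<rho>) / (norm (5 - \<rho>))\<^sup>2"
      by (intro divide_right_mono) (auto simp: mult_le_cancel_left1)
    also have "\<dots> = Re (of_nat (xi_mult \<rho>) / (5 - \<rho>))"
      by (simp add: Re_divide cmod_power2)
    finally show ?thesis .
  qed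
  have "(\<lambda>N. Re (zero_sum N 5)) \<longlonglongrightarrow> Re (L 5)"
    by (intro tendsto_Re L_partial_fractions X5)
  then have "Bseq (\<lambda>N. Re (zero_sum N 5))" by (intro convergent_imp_Bseq convergentI)
  then obtain K where K: "\<And>N. norm (Re (zero_sum N 5)) \<le> K" by (auto simp: Bseq_def)
  have sum5: "(\<lambda>\<rho>. real (xi_mult \<rho>) / (norm (5 - \<rho>))\<^sup>2) summable_on Zeros"
  proof (rule nonneg_bdd_above_summable_on)
    show "bdd_above (sum (\<lambda>\<rho>. real (xi_mult \<rho>) / (norm (5 - \<rho>))\<^sup>2) ` {F. F \<subseteq> Zeros \<and> finite F})"
    proof (rule bdd_aboveI2)
      fix F assume F: "F \<in> {F. F \<subseteq> Zeros \<and> finite F}"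
      have "\<forall>\<^sub>F N in sequentially. finite (Zeros_upto N) \<and> F \<subseteq> Zeros_upto N \<and> Zeros_upto N \<subseteq> Zeros"
        using filterlim_Zeros_upto F unfolding filterlim_finite_subsets_at_top by blast
      then obtain N where N: "F \<subseteq> Zeros_upto N" by (auto simp: eventually_sequentially)
      have "(\<Sum>\<rho>\<in>F. real (xi_mult \<rho>) / (norm (5 - \<rho>))\<^sup>2) \<le> (\<Sum>\<rho>\<in>Zeros_upto N. real (xi_mult \<rho>) / (norm (5 - \<rho>))\<^sup>2)"
        by (rule sum_mono2[OF finite_Zeros_upto N]) auto
      also have "\<dots> \<le> (\<Sum>\<rho>\<in>Zeros_upto N. Re (of_nat (xi_mult \<rho>) / (5 - \<rho>)))"
        using Zeros_upto_subset by (intro sum_mono Re_ge) auto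
      also have "\<dots> = Re (zero_sum N 5)" by (simp add: zero_sum_def)
      also have "\<dots> \<le> K" using K[of N] by simp
      finally show "(\<Sum>\<rho>\<in>F. real (xi_mult \<rho>) / (norm (5 - \<rho>))\<^sup>2) \<le> K" .
    qed
  qed auto
  obtain e where e: "e > 0" "\<And>\<rho>. \<rho> \<in> Zeros \<Longrightarrow> norm \<rho> \<ge> e" using Zeros_norm_lower by blast
  define C where "C = 1 + 5 / e"
  have C: "C > 0" using e by (simp add: C_def add_pos_pos)
  show ?thesis
  proof (rule summable_on_comparison_test[OF summable_on_cmult_right[OF sum5, of "C\<^sup>2"]])
    fix \<rho> assume r: "\<rho> \<in> Zeros"
    have n0: "norm \<rho> > 0" using e r by (meson less_le_trans)
    have d0: "norm (5 - \<rho>) > 0" using X5 r by (auto simp: Zeros_def)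
    have "norm (5 - \<rho>) \<le> 5 + norm \<rho>" using norm_triangle_ineq4[of 5 \<rho>] by simp
    also have "5 = 5 / e * e" using e by simp
    also have "5 / e * e + norm \<rho> \<le> 5 / e * norm \<rho> + norm \<rho>"
      using e r by (intro add_right_mono mult_left_mono) auto
    also have "\<dots> = C * norm \<rho>" by (simp add: C_def algebra_simps)
    finally have "(norm (5 - \<rho>))\<^sup>2 \<le> C\<^sup>2 * (norm \<rho>)\<^sup>2" by (metis norm_ge_zero power_mono power_mult_distrib)
    then have "1 / (norm \<rho>)\<^sup>2 \<le> C\<^sup>2 / (norm (5 - \<rho>))\<^sup>2" using n0 d0 by (simp add: field_simps)
    then have "real (xi_mult \<rho>) * (1 / (norm \<rho>)\<^sup>2) \<le> real (xi_mult \<rho>) * (C\<^sup>2 / (norm (5 - \<rho>))\<^sup>2)"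
      by (rule mult_left_mono) simp
    then show "real (xi_mult \<rho>) / (norm \<rho>)\<^sup>2 \<le> C\<^sup>2 * (real (xi_mult \<rho>) / (norm (5 - \<rho>))\<^sup>2)"
      by (simp add: field_simps)
  qed auto
qed

lemma abs_summable_Zeros:
  assumes "\<And>\<rho>. \<rho> \<in> Zeros \<Longrightarrow> norm (f \<rho>) \<le> K / (norm \<rho>)\<^sup>2"
  shows "(\<lambda>\<rho>. norm (of_nat (xi_mult \<rho>) * f \<rho> :: complex)) summable_on Zeros"
proof (rule summable_on_comparison_test[OF summable_on_cmult_right[OF summable_inverse_square_zeros, of K]])
  fix \<rho> assume "\<rho> \<in> Zeros"
  from mult_left_mono[OF assms[OF this], of "real (xi_mult \<rho>)"]
  show "norm (of_nat (xi_mult \<rho>) * f \<rho>) \<le> K * (real (xi_mult \<rho>) / (norm \<rho>)\<^sup>2)"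
    by (simp add: norm_mult mult_ac)
qed auto

lemma tendsto_sum_Zeros_upto:
  assumes "(f has_sum S) Zeros"
  shows "(\<lambda>N. \<Sum>\<rho>\<in>Zeros_upto N. f \<rho>) \<longlonglongrightarrow> S"
  using assms unfolding has_sum_def by (rule filterlim_compose[OF _ filterlim_Zeros_upto])

text \<open>Subtracting the value at 0 makes the partial fractions absolutely convergent, so that the order
of summation becomes irrelevant.\<close>

theorem L_has_sum:
  assumes X: "Xi s \<noteq> 0"
  shows "((\<lambda>\<rho>. of_nat (xi_mult \<rho>) * (s / (\<rho> * (s - \<rho>)))) has_sum (L s - L 0)) Zeros"
proof -
  obtain c where c: "c > 0" "\<And>\<rho>. \<rho> \<in> Zeros \<Longrightarrow> norm (s - \<rho>) \<ge> c * norm \<rho>"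
    using Zeros_separated[OF X] by blast
  have X0: "Xi 0 \<noteq> 0" by (subst Xi_0) simp
  have "(\<lambda>\<rho>. norm (of_nat (xi_mult \<rho>) * (s / (\<rho> * (s - \<rho>))))) summable_on Zeros"
  proof (rule abs_summable_Zeros)
    fix \<rho> assume r: "\<rho> \<in> Zeros"
    then have n: "norm \<rho> > 0" using Zeros_nonzero by simp
    have "norm (s / (\<rho> * (s - \<rho>))) = norm s / (norm \<rho> * norm (s - \<rho>))" by (simp add: norm_divide norm_mult)
    also have "\<dots> \<le> norm s / (norm \<rho> * (c * norm \<rho>))"
    proof -
      have "0 < c * norm \<rho>" using n c(1) by simp
      then have "norm (s - \<rho>) > 0" using c(2)[OF r] by linarith
      then show ?thesis using c(2)[OF r] n c(1) by (intro divide_left_mono mult_left_mono mult_pos_pos) auto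
    qed
    also have "\<dots> = (norm s / c) / (norm \<rho>)\<^sup>2" by (simp add: power2_eq_square)
    finally show "norm (s / (\<rho> * (s - \<rho>))) \<le> (norm s / c) / (norm \<rho>)\<^sup>2" .
  qed
  then have "(\<lambda>\<rho>. of_nat (xi_mult \<rho>) * (s / (\<rho> * (s - \<rho>)))) summable_on Zeros" by (rule abs_summable_summable)
  then obtain S where S: "((\<lambda>\<rho>. of_nat (xi_mult \<rho>) * (s / (\<rho> * (s - \<rho>)))) has_sum S) Zeros"
    by (auto simp: summable_on_def)
  have eq: "(\<Sum>\<rho>\<in>Zeros_upto N. of_nat (xi_mult \<rho>) * (s / (\<rho> * (s - \<rho>)))) = zero_sum N s - zero_sum N 0" for N
    unfolding zero_sum_def sum_subtractf[symmetric]
  proof (rule sum.cong[OF refl])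
    fix \<rho> assume "\<rho> \<in> Zeros_upto N"
    then have "\<rho> \<in> Zeros" using Zeros_upto_subset by blast
    then have "\<rho> \<noteq> 0" "s \<noteq> \<rho>" using X by (auto simp: Zeros_def Xi_0)
    then have "s / (\<rho> * (s - \<rho>)) = 1 / (s - \<rho>) - 1 / (0 - \<rho>)" by (simp add: field_simps)
    then have "of_nat (xi_mult \<rho>) * (s / (\<rho> * (s - \<rho>))) = of_nat (xi_mult \<rho>) * (1 / (s - \<rho>) - 1 / (0 - \<rho>))" by (simp only:)
    then show "of_nat (xi_mult \<rho>) * (s / (\<rho> * (s - \<rho>))) = of_nat (xi_mult \<rho>) / (s - \<rho>) - of_nat (xi_mult \<rho>) / (0 - \<rho>)"
      by (simp only: right_diff_distrib times_divide_eq_right mult_1_right)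
  qed
  have "(\<lambda>N. zero_sum N s - zero_sum N 0) \<longlonglongrightarrow> L s - L 0"
    by (intro tendsto_diff L_partial_fractions X X0)
  moreover have "(\<lambda>N. zero_sum N s - zero_sum N 0) \<longlonglongrightarrow> S"
    using tendsto_sum_Zeros_upto[OF S] unfolding eq .
  ultimately have "S = L s - L 0" using LIMSEQ_unique by blast
  with S show ?thesis by simp
qed

lemma L_0_has_sum:
  "((\<lambda>\<rho>. of_nat (xi_mult \<rho>) * (1 / (\<rho> * (1 - \<rho>)))) has_sum (- 2 * L 0)) Zeros"
proof -
  have "Xi 1 \<noteq> 0" by (subst Xi_1) simp
  from L_has_sum[OF this] show ?thesis using L_reflect[of 0] by simp
qed

section \<open>Li coefficients and positivity\<close>

definition li_term :: "nat \<Rightarrow> complex \<Rightarrow> complex" where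
  "li_term n \<rho> = 1 - (1 - 1 / \<rho>) ^ n"

text \<open>Adding the terms of rho and 1 - rho makes the series over the zeros absolutely convergent.\<close>

definition li_pair :: "nat \<Rightarrow> complex \<Rightarrow> complex" where
  "li_pair n \<rho> = (li_term n \<rho> + li_term n (1 - \<rho>)) / 2"

lemma one_minus_inverse_reflect:
  assumes "\<rho> \<noteq> 0" "\<rho> \<noteq> (1::complex)"
  shows "1 - 1 / (1 - \<rho>) = inverse (1 - 1 / \<rho>)"
  using assms by (simp add: divide_simps) (simp add: algebra_simps)

lemma li_pair_eq:
  assumes "\<rho> \<noteq> 0" "\<rho> \<noteq> 1"
  shows "li_pair n \<rho> = (2 - (1 - 1 / \<rho>) ^ n - inverse (1 - 1 / \<rho>) ^ n) / 2"
  using assms by (simp add: li_pair_def li_term_def one_minus_inverse_reflect)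

lemma Zeros_q_bounds:
  obtains Q where "Q \<ge> 1" "\<And>\<rho>. \<rho> \<in> Zeros \<Longrightarrow> norm (1 - 1 / \<rho>) \<le> Q"
    "\<And>\<rho>. \<rho> \<in> Zeros \<Longrightarrow> norm (inverse (1 - 1 / \<rho>)) \<le> Q"
proof -
  obtain e where e: "e > 0" "\<And>\<rho>. \<rho> \<in> Zeros \<Longrightarrow> norm \<rho> \<ge> e" using Zeros_norm_lower by blast
  define Q where "Q = 1 + 1 / e"
  have b: "norm (1 - 1 / \<rho>) \<le> Q" if "\<rho> \<in> Zeros" for \<rho>
  proof -
    have "norm \<rho> > 0" using e that by (meson less_le_trans)
    then have "1 / norm \<rho> \<le> 1 / e" using e that by (intro divide_left_mono mult_pos_pos) auto
    then show ?thesis using norm_triangle_ineq4[of 1 "1 / \<rho>"] by (simp add: Q_def norm_divide)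
  qed
  have "norm (inverse (1 - 1 / \<rho>)) \<le> Q" if "\<rho> \<in> Zeros" for \<rho>
    using b[of "1 - \<rho>"] that Zeros_nonzero[OF that] by (simp add: Zeros_reflect one_minus_inverse_reflect)
  with b show ?thesis using e by (intro that[of Q]) (auto simp: Q_def)
qed

text \<open>For q = 1 - 1/rho one has 2 - q^n - q^(-n) = -(1 - q^n)^2 / q^n, and 1 - q = 1/rho.\<close>

lemma li_pair_bound:
  assumes r: "\<rho> \<in> Zeros" and Q: "Q \<ge> 1" "norm (1 - 1 / \<rho>) \<le> Q" "norm (inverse (1 - 1 / \<rho>)) \<le> Q"
  shows "norm (li_pair n \<rho>) \<le> ((real n)\<^sup>2 * (Q ^ 3) ^ n) / (norm \<rho>)\<^sup>2"
proof -
  define q where "q = 1 - 1 / \<rho>"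
  have r0: "\<rho> \<noteq> 0" "\<rho> \<noteq> 1" using Zeros_nonzero[OF r] by auto
  have q0: "q \<noteq> 0" using r0 by (simp add: q_def)
  have "2 - q ^ n - inverse q ^ n = - ((1 - q ^ n)\<^sup>2 * inverse q ^ n)"
    using q0 by (simp add: power2_eq_square algebra_simps flip: power_mult_distrib)
  also have "1 - q ^ n = (1 - q) * (\<Sum>i<n. q ^ i)" by (rule one_diff_power_eq)
  finally have "norm (2 - q ^ n - inverse q ^ n) = (norm (1 - q) * norm (\<Sum>i<n. q ^ i))\<^sup>2 * norm (inverse q) ^ n"
    by (simp add: norm_mult norm_power)
  also have "\<dots> \<le> (1 / norm \<rho> * (real n * Q ^ n))\<^sup>2 * Q ^ n"
  proof (intro mult_mono power_mono)
    show "norm (1 - q) \<le> 1 / norm \<rho>" by (simp add: q_def norm_divide)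
    have "norm (\<Sum>i<n. q ^ i) \<le> (\<Sum>i<n. Q ^ n)"
    proof (rule sum_norm_le)
      fix i assume "i \<in> {..<n}"
      have "norm (q ^ i) \<le> Q ^ i" unfolding norm_power q_def by (intro power_mono Q) auto
      also have "\<dots> \<le> Q ^ n" using Q \<open>i \<in> {..<n}\<close> by (intro power_increasing) auto
      finally show "norm (q ^ i) \<le> Q ^ n" .
    qed
    then show "norm (\<Sum>i<n. q ^ i) \<le> real n * Q ^ n" by simp
    show "norm (inverse q) \<le> Q" unfolding q_def by (rule Q)
  qed (use Q in auto)
  also have "\<dots> = ((real n)\<^sup>2 * (Q ^ 3) ^ n) / (norm \<rho>)\<^sup>2"
    by (simp add: power_mult_distrib power_divide power_mult[symmetric] power_add[symmetric] algebra_simps)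
  finally have "norm (2 - q ^ n - inverse q ^ n) \<le> ((real n)\<^sup>2 * (Q ^ 3) ^ n) / (norm \<rho>)\<^sup>2" .
  moreover have "norm (li_pair n \<rho>) = norm (2 - q ^ n - inverse q ^ n) / 2"
    by (simp add: li_pair_eq r0 q_def norm_divide)
  ultimately show ?thesis using norm_ge_zero[of "2 - q ^ n - inverse q ^ n"] by linarith
qed

lemma li_pair_abs_summable: "(\<lambda>\<rho>. norm (of_nat (xi_mult \<rho>) * li_pair n \<rho>)) summable_on Zeros"
proof -
  obtain Q where Q: "Q \<ge> 1" "\<And>\<rho>. \<rho> \<in> Zeros \<Longrightarrow> norm (1 - 1 / \<rho>) \<le> Q"
    "\<And>\<rho>. \<rho> \<in> Zeros \<Longrightarrow> norm (inverse (1 - 1 / \<rho>)) \<le> Q" by (rule Zeros_q_bounds) blast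
  show ?thesis by (rule abs_summable_Zeros, rule li_pair_bound[OF _ Q(1) Q(2) Q(3)])
qed

definition Zeros_height :: "real \<Rightarrow> complex set" where
  "Zeros_height T = {\<rho> \<in> Zeros. \<bar>Im \<rho>\<bar> \<le> T}"

lemma finite_Zeros_height: "finite (Zeros_height T)"
proof -
  have "Zeros_height T \<subseteq> Zeros \<inter> cbox (Complex (-1) (- T)) (Complex 2 T)"
    using Xi_zero_strip by (force simp: Zeros_height_def Zeros_def in_cbox_complex_iff)
  then show ?thesis by (rule finite_subset) (intro finite_Zeros_compact compact_cbox)
qed

lemma filterlim_Zeros_height: "filterlim Zeros_height (finite_subsets_at_top Zeros) at_top"
  unfolding filterlim_finite_subsets_at_top
proof (intro allI impI)
  fix X assume X: "finite X \<and> X \<subseteq> Zeros"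
  define T0 where "T0 = (\<Sum>\<rho>\<in>X. \<bar>Im \<rho>\<bar>)"
  show "\<forall>\<^sub>F T in at_top. finite (Zeros_height T) \<and> X \<subseteq> Zeros_height T \<and> Zeros_height T \<subseteq> Zeros"
    using eventually_ge_at_top[of T0]
  proof eventually_elim
    case (elim T)
    have "\<bar>Im \<rho>\<bar> \<le> T0" if "\<rho> \<in> X" for \<rho>
      unfolding T0_def using X that by (intro member_le_sum) auto
    then have "X \<subseteq> Zeros_height T" using X elim by (force simp: Zeros_height_def)
    then show ?case using finite_Zeros_height by (auto simp: Zeros_height_def)
  qed
qed

text \<open>The set of zeros with |Im rho| <= T is invariant under rho -> 1 - rho, so its terms may be
symmetrised without changing the partial sum; the limit is then a sum of an absolutely
convergent series.\<close>

theorem li_coeff_has_sum: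
  "((\<lambda>\<rho>. of_nat (xi_mult \<rho>) * li_pair n \<rho>) has_sum li_coeff n) Zeros"
proof -
  have "(\<lambda>\<rho>. of_nat (xi_mult \<rho>) * li_pair n \<rho>) summable_on Zeros"
    by (rule abs_summable_summable[OF li_pair_abs_summable])
  then obtain S where S: "((\<lambda>\<rho>. of_nat (xi_mult \<rho>) * li_pair n \<rho>) has_sum S) Zeros"
    by (auto simp: summable_on_def)
  have eq: "(\<Sum>\<rho>\<in>{\<rho>\<in>nontrivial_zeta_zeros. \<bar>Im \<rho>\<bar> \<le> T}. of_int (zorder zeta \<rho>) * (1 - (1 - 1 / \<rho>) ^ n)) =
     (\<Sum>\<rho>\<in>Zeros_height T. of_nat (xi_mult \<rho>) * li_pair n \<rho>)" for T
  proof -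
    have "(\<Sum>\<rho>\<in>{\<rho>\<in>nontrivial_zeta_zeros. \<bar>Im \<rho>\<bar> \<le> T}. of_int (zorder zeta \<rho>) * (1 - (1 - 1 / \<rho>) ^ n)) =
       (\<Sum>\<rho>\<in>Zeros_height T. of_nat (xi_mult \<rho>) * li_term n \<rho>)"
    proof (rule sum.cong)
      show "{\<rho>\<in>nontrivial_zeta_zeros. \<bar>Im \<rho>\<bar> \<le> T} = Zeros_height T"
        by (simp add: Zeros_height_def nontrivial_zeta_zeros_eq Zeros_def)
      fix \<rho> assume "\<rho> \<in> Zeros_height T"
      then have "\<rho> \<in> Zeros" by (simp add: Zeros_height_def)
      then have "zorder zeta \<rho> = int (xi_mult \<rho>)" using zorder_Xi[of \<rho>] by (simp add: zorder_zeta Zeros_def)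
      then show "of_int (zorder zeta \<rho>) * (1 - (1 - 1 / \<rho>) ^ n) = of_nat (xi_mult \<rho>) * li_term n \<rho>"
        by (simp add: li_term_def)
    qed
    moreover have "(\<Sum>\<rho>\<in>Zeros_height T. of_nat (xi_mult \<rho>) * li_term n \<rho>) =
       (\<Sum>\<rho>\<in>Zeros_height T. of_nat (xi_mult \<rho>) * li_term n (1 - \<rho>))"
      by (rule sum.reindex_bij_witness[of _ "\<lambda>\<rho>. 1 - \<rho>" "\<lambda>\<rho>. 1 - \<rho>"])
         (auto simp: Zeros_height_def Zeros_reflect xi_mult_reflect)
    moreover have "(\<Sum>\<rho>\<in>Zeros_height T. of_nat (xi_mult \<rho>) * li_pair n \<rho>) =
       ((\<Sum>\<rho>\<in>Zeros_height T. of_nat (xi_mult \<rho>) * li_term n \<rho>) +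
       (\<Sum>\<rho>\<in>Zeros_height T. of_nat (xi_mult \<rho>) * li_term n (1 - \<rho>))) / 2"
      by (simp add: li_pair_def sum.distrib[symmetric] sum_divide_distrib distrib_left)
    ultimately show ?thesis by simp
  qed
  have "((\<lambda>T. \<Sum>\<rho>\<in>Zeros_height T. of_nat (xi_mult \<rho>) * li_pair n \<rho>) \<longlongrightarrow> S) at_top"
    using S unfolding has_sum_def by (rule filterlim_compose[OF _ filterlim_Zeros_height])
  then have "li_coeff n = S" unfolding li_coeff_def eq by (intro tendsto_Lim) auto
  with S show ?thesis by simp
qed

text \<open>The mean of the expansion of L and of its image under rho -> 1 - rho, the constants cancelling
by the value of L at 0.\<close>

lemma L_has_sum_sym:
  assumes X: "Xi s \<noteq> 0"
  shows "((\<lambda>\<rho>. of_nat (xi_mult \<rho>) * ((1 / (s - \<rho>) + 1 / (s - (1 - \<rho>))) / 2)) has_sum L s) Zeros"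
proof -
  have A: "((\<lambda>\<rho>. of_nat (xi_mult \<rho>) * (s / (\<rho> * (s - \<rho>)))) has_sum (L s - L 0)) Zeros"
    by (rule L_has_sum[OF X])
  then have B: "((\<lambda>\<rho>. of_nat (xi_mult \<rho>) * (s / ((1 - \<rho>) * (s - (1 - \<rho>))))) has_sum (L s - L 0)) Zeros"
    by (subst has_sum_reindex_bij_witness[of Zeros "\<lambda>\<rho>. 1 - \<rho>" "\<lambda>\<rho>. 1 - \<rho>"])
       (auto simp: Zeros_reflect xi_mult_reflect)
  from has_sum_add[OF has_sum_cmult_right[OF has_sum_add[OF A B], of "1 / 2"] has_sum_cmult_right[OF L_0_has_sum, of "- 1 / 2"]]
  have S1: "((\<lambda>\<rho>. 1 / 2 * (of_nat (xi_mult \<rho>) * (s / (\<rho> * (s - \<rho>))) + of_nat (xi_mult \<rho>) * (s / ((1 - \<rho>) * (s - (1 - \<rho>)))))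
      + - 1 / 2 * (of_nat (xi_mult \<rho>) * (1 / (\<rho> * (1 - \<rho>))))) has_sum (1 / 2 * (L s - L 0 + (L s - L 0)) + - 1 / 2 * (- 2 * L 0))) Zeros" .
  have S2: "1 / 2 * (L s - L 0 + (L s - L 0)) + - 1 / 2 * (- 2 * L 0) = L s" by (simp add: field_simps)
  have S3: "1 / 2 * (of_nat (xi_mult \<rho>) * (s / (\<rho> * (s - \<rho>))) + of_nat (xi_mult \<rho>) * (s / ((1 - \<rho>) * (s - (1 - \<rho>)))))
      + - 1 / 2 * (of_nat (xi_mult \<rho>) * (1 / (\<rho> * (1 - \<rho>)))) =
      of_nat (xi_mult \<rho>) * ((1 / (s - \<rho>) + 1 / (s - (1 - \<rho>))) / 2)" if r: "\<rho> \<in> Zeros" for \<rho>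
  proof -
    have n: "\<rho> \<noteq> 0" "1 - \<rho> \<noteq> 0" using Zeros_nonzero[OF r] by auto
    have "s \<noteq> \<rho>" "s \<noteq> 1 - \<rho>" using X r Xi_reflect[of \<rho>] by (auto simp: Zeros_def)
    then have "s - \<rho> \<noteq> 0" "s - (1 - \<rho>) \<noteq> 0" by auto
    have e: "s / (a * (s - a)) = 1 / (s - a) + 1 / a" if "a \<noteq> 0" "s - a \<noteq> 0" for a
      using that by (simp add: divide_simps)
    have f: "1 / (\<rho> * (1 - \<rho>)) = 1 / \<rho> + 1 / (1 - \<rho>)" using n by (simp add: divide_simps)
    show ?thesis unfolding e[OF n(1) \<open>s - \<rho> \<noteq> 0\<close>] e[OF n(2) \<open>s - (1 - \<rho>) \<noteq> 0\<close>] f by (simp add: algebra_simps add_divide_distrib)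
  qed
  show ?thesis by (rule has_sum_cong[THEN iffD1, OF S3 S1[unfolded S2]])
qed

text \<open>A difference of geometric series: 1/(1-z) - q/(1-qz) = s^2 / (s - (1 - rho)) for q = 1 - 1/rho,
and with 1/q in place of q the zero 1 - rho is replaced by rho.\<close>

lemma li_pair_generating:
  assumes r: "\<rho> \<noteq> 0" "\<rho> \<noteq> 1" and z: "norm z < 1" "norm ((1 - 1 / \<rho>) * z) < 1" "norm (inverse (1 - 1 / \<rho>) * z) < 1"
  defines "s \<equiv> 1 / (1 - z)"
  shows "(\<lambda>n. li_pair (Suc n) \<rho> * z ^ n) sums (s\<^sup>2 * ((1 / (s - \<rho>) + 1 / (s - (1 - \<rho>))) / 2))"
proof -
  define q where "q = 1 - 1 / \<rho>"
  have q0: "q \<noteq> 0" using r by (simp add: q_def)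
  have geo: "(\<lambda>n. a ^ Suc n * z ^ n) sums (a / (1 - a * z))" if "norm (a * z) < 1" for a
    using sums_mult[OF geometric_sums[OF that], of a] by (simp add: power_mult_distrib mult_ac)
  have z1: "1 - z \<noteq> 0" using z(1) by auto
  have d1: "1 - q * z \<noteq> 0" using z(2) by (auto simp: q_def)
  have d2: "1 - inverse q * z \<noteq> 0" using z(3) by (auto simp: q_def)
  have "(\<lambda>n. (2 * (1 ^ Suc n * z ^ n) - q ^ Suc n * z ^ n - inverse q ^ Suc n * z ^ n) / 2) sums
      ((2 * (1 / (1 - 1 * z)) - q / (1 - q * z) - inverse q / (1 - inverse q * z)) / 2)"
    using z by (intro sums_divide sums_diff sums_mult geo) (auto simp: q_def)
  moreover have "(2 * (1 ^ Suc n * z ^ n) - q ^ Suc n * z ^ n - inverse q ^ Suc n * z ^ n) / 2 = li_pair (Suc n) \<rho> * z ^ n" for n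
    unfolding li_pair_eq[OF r] q_def[symmetric] by (simp only: power_one) (simp add: algebra_simps diff_divide_distrib)
  moreover have "(2 * (1 / (1 - 1 * z)) - q / (1 - q * z) - inverse q / (1 - inverse q * z)) / 2 =
     s\<^sup>2 * ((1 / (s - \<rho>) + 1 / (s - (1 - \<rho>))) / 2)"
  proof -
    have e1: "1 / (1 - z) - q / (1 - q * z) = s\<^sup>2 / (s - (1 - \<rho>))"
    proof -
      have rq: "\<rho> * q = \<rho> - 1" using r by (simp add: q_def field_simps)
      have rz: "\<rho> * (1 - q * z) = \<rho> - (\<rho> - 1) * z"
        by (simp only: right_diff_distrib mult_1_right mult.assoc[symmetric] rq)
      then have n: "\<rho> - (\<rho> - 1) * z \<noteq> 0" using d1 r by (metis mult_eq_0_iff)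
      have "q / (1 - q * z) = (\<rho> * q) / (\<rho> * (1 - q * z))"
        by (rule mult_divide_mult_cancel_left[symmetric]) (use r in simp)
      then have "q / (1 - q * z) = (\<rho> - 1) / (\<rho> - (\<rho> - 1) * z)" by (simp only: rq rz)
      moreover have "1 / (1 - z) - (\<rho> - 1) / (\<rho> - (\<rho> - 1) * z) = 1 / ((1 - z) * (\<rho> - (\<rho> - 1) * z))"
        using n z1 by (simp add: divide_simps) (simp add: algebra_simps)
      moreover have "s - (1 - \<rho>) = (\<rho> - (\<rho> - 1) * z) / (1 - z)"
        using z1 by (simp add: s_def divide_simps) (simp add: algebra_simps)
      ultimately show ?thesis using n z1 by (simp add: s_def power2_eq_square)
    qed
    have e2: "1 / (1 - z) - inverse q / (1 - inverse q * z) = s\<^sup>2 / (s - \<rho>)"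
    proof -
      have rq: "(\<rho> - 1) * inverse q = \<rho>" using r by (simp add: q_def field_simps)
      have rz: "(\<rho> - 1) * (1 - inverse q * z) = (\<rho> - 1) - \<rho> * z"
        by (simp only: right_diff_distrib mult_1_right mult.assoc[symmetric] rq)
      then have n: "(\<rho> - 1) - \<rho> * z \<noteq> 0" using d2 r by (metis mult_eq_0_iff right_minus_eq)
      have "inverse q / (1 - inverse q * z) = ((\<rho> - 1) * inverse q) / ((\<rho> - 1) * (1 - inverse q * z))"
        by (rule mult_divide_mult_cancel_left[symmetric]) (use r in simp)
      also have "\<dots> = \<rho> / ((\<rho> - 1) - \<rho> * z)"
        by (simp only: rq rz)
      finally have a: "inverse q / (1 - inverse q * z) = \<rho> / ((\<rho> - 1) - \<rho> * z)" .
      have b: "1 / (1 - z) - \<rho> / ((\<rho> - 1) - \<rho> * z) = - 1 / ((1 - z) * ((\<rho> - 1) - \<rho> * z))"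
        using n z1 by (simp add: divide_simps) (simp add: algebra_simps)
      have c: "s - \<rho> = - ((\<rho> - 1) - \<rho> * z) / (1 - z)"
        using z1 by (simp add: s_def divide_simps) (simp add: algebra_simps)
      define X where "X = (\<rho> - 1) - \<rho> * z"
      have "1 / (1 - z) - inverse q / (1 - inverse q * z) = - 1 / ((1 - z) * X)" "s - \<rho> = - X / (1 - z)" "X \<noteq> 0"
        unfolding a b X_def by (rule refl, rule c, rule n)
      then show ?thesis using z1 by (simp add: s_def power2_eq_square)
    qed
    have "(2 * (1 / (1 - 1 * z)) - q / (1 - q * z) - inverse q / (1 - inverse q * z)) / 2 =
      ((1 / (1 - z) - q / (1 - q * z)) + (1 / (1 - z) - inverse q / (1 - inverse q * z))) / 2" by simp
    also have "\<dots> = (s\<^sup>2 / (s - (1 - \<rho>)) + s\<^sup>2 / (s - \<rho>)) / 2" by (simp only: e1 e2)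
    also have "\<dots> = s\<^sup>2 * ((1 / (s - \<rho>) + 1 / (s - (1 - \<rho>))) / 2)"
      by (simp only: add_divide_distrib distrib_left times_divide_eq_right mult_1_right add.commute)
    finally show ?thesis .
  qed
  ultimately show ?thesis by (simp only:)
qed

text \<open>Evaluate the double series over zeros and exponents in both orders. It converges absolutely for
small z because 1 - 1/rho and its inverse are bounded on the zeros.\<close>

theorem li_generating_function:
  obtains R where "R > 0" "R < 1" "\<And>z. norm z < R \<Longrightarrow> (\<lambda>n. li_coeff (Suc n) * z ^ n) sums ((1 / (1 - z))\<^sup>2 * L (1 / (1 - z)))"
proof -
  obtain Q where Q: "Q \<ge> 1" "\<And>\<rho>. \<rho> \<in> Zeros \<Longrightarrow> norm (1 - 1 / \<rho>) \<le> Q"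
    "\<And>\<rho>. \<rho> \<in> Zeros \<Longrightarrow> norm (inverse (1 - 1 / \<rho>)) \<le> Q" by (rule Zeros_q_bounds) blast
  \<comment> \<open>The double series is dominated by terms n^2 (Q^3 |z|)^n, up to a factor.\<close>
  define R where "R = 1 / (2 * Q ^ 3)"
  have Q3: "Q ^ 3 \<ge> Q" "Q ^ 3 \<ge> 1" using Q(1) by (auto intro: self_le_power one_le_power)
  have Qp: "Q > 0" "Q ^ 3 > 0" using Q(1) by auto
  have R: "R > 0" "R < 1" using Q3 Qp by (auto simp: R_def divide_less_eq)
  have "(\<lambda>n. li_coeff (Suc n) * z ^ n) sums ((1 / (1 - z))\<^sup>2 * L (1 / (1 - z)))" if z: "norm z < R" for z
  proof -
    define s where "s = 1 / (1 - z)"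
    have z1: "norm z < 1" using z R by simp
    then have z1': "1 - z \<noteq> 0" by auto
    have Qz: "Q * norm z < 1"
    proof -
      have "Q * norm z \<le> Q ^ 3 * norm z" using Q3 by (intro mult_right_mono) auto
      also have "\<dots> < Q ^ 3 * R" using z Q3 Qp by (intro mult_strict_left_mono) auto
      also have "\<dots> < 1" using Q3 Qp by (simp add: R_def)
      finally show ?thesis .
    qed
    have qz: "norm ((1 - 1 / \<rho>) * z) < 1" "norm (inverse (1 - 1 / \<rho>) * z) < 1" if "\<rho> \<in> Zeros" for \<rho>
    proof -
      have "norm ((1 - 1 / \<rho>) * z) \<le> Q * norm z" "norm (inverse (1 - 1 / \<rho>) * z) \<le> Q * norm z"
        unfolding norm_mult using Q that by (auto intro!: mult_right_mono simp del: inverse_diff_inverse)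
      then show "norm ((1 - 1 / \<rho>) * z) < 1" "norm (inverse (1 - 1 / \<rho>) * z) < 1" using Qz by linarith+
    qed
    have Xs: "Xi s \<noteq> 0"
    proof
      assume "Xi s = 0"
      then have sZ: "s \<in> Zeros" by (simp add: Zeros_def)
      have "inverse (1 - 1 / s) * z = 1"
      proof -
        have "1 - 1 / s = z" by (simp add: s_def)
        moreover have "z \<noteq> 0" using sZ Zeros_nonzero(2)[OF sZ] by (auto simp: s_def)
        ultimately show ?thesis by simp
      qed
      with qz(2)[OF sZ] show False by simp
    qed
    define F where "F = (\<lambda>(\<rho>, n). of_nat (xi_mult \<rho>) * li_pair (Suc n) \<rho> * z ^ n)"
    define w where "w n = (real (Suc n))\<^sup>2 * (Q ^ 3) ^ Suc n * norm z ^ n" for n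
    have w0: "w n \<ge> 0" for n using Q by (simp add: w_def)
    have "summable w"
    proof -
      have "summable (\<lambda>n. (real (Suc n))\<^sup>2 * (1 / 2) ^ n * Q ^ 3)"
      proof (rule summable_mult2, rule summable_comparison_test_bigo)
        show "summable (\<lambda>n. norm ((3 / 4 :: real) ^ n))" by (simp add: norm_power summable_geometric)
        show "(\<lambda>n. (real (Suc n))\<^sup>2 * (1 / 2) ^ n) \<in> O(\<lambda>n. (3 / 4) ^ n)" by real_asymp
      qed
      then show ?thesis
      proof (rule summable_comparison_test')
        fix n :: nat
        have "(Q ^ 3 * norm z) ^ n \<le> (1 / 2) ^ n"
        proof (rule power_mono)
          have "Q ^ 3 * norm z \<le> Q ^ 3 * R" using z Q3 Qp by (intro mult_left_mono) auto
          also have "\<dots> = 1 / 2" using Q3 Qp by (simp add: R_def)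
          finally show "Q ^ 3 * norm z \<le> 1 / 2" .
        qed (use Q in auto)
        then have "(real (Suc n))\<^sup>2 * Q ^ 3 * (Q ^ 3 * norm z) ^ n \<le> (real (Suc n))\<^sup>2 * Q ^ 3 * (1 / 2) ^ n"
          using Q by (intro mult_left_mono) auto
        then show "norm (w n) \<le> (real (Suc n))\<^sup>2 * (1 / 2) ^ n * Q ^ 3"
          using w0[of n] by (simp add: w_def power_mult_distrib mult_ac)
      qed
    qed
    then have w_sum: "(w has_sum suminf w) UNIV" using w0 by (intro sums_nonneg_imp_has_sum summable_sums) auto
    have dom: "(\<lambda>(\<rho>, n). real (xi_mult \<rho>) / (norm \<rho>)\<^sup>2 * w n) summable_on (Zeros \<times> UNIV)"
    proof (rule summable_on_SigmaI)
      fix \<rho> assume "\<rho> \<in> Zeros"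
      show "((\<lambda>n. case (\<rho>, n) of (\<rho>, n) \<Rightarrow> real (xi_mult \<rho>) / (norm \<rho>)\<^sup>2 * w n) has_sum (real (xi_mult \<rho>) / (norm \<rho>)\<^sup>2 * suminf w)) UNIV"
        using has_sum_cmult_right[OF w_sum, of "real (xi_mult \<rho>) / (norm \<rho>)\<^sup>2"] by simp
    next
      show "(\<lambda>\<rho>. real (xi_mult \<rho>) / (norm \<rho>)\<^sup>2 * suminf w) summable_on Zeros"
        by (intro summable_on_cmult_left summable_inverse_square_zeros)
    qed (use w0 in auto)
    have "(\<lambda>x. norm (F x)) summable_on (Zeros \<times> UNIV)"
    proof (rule summable_on_comparison_test[OF dom])
      fix x assume "x \<in> Zeros \<times> (UNIV :: nat set)"
      then obtain \<rho> n where x: "x = (\<rho>, n)" "\<rho> \<in> Zeros" by auto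
      have "norm (li_pair (Suc n) \<rho>) \<le> ((real (Suc n))\<^sup>2 * (Q ^ 3) ^ Suc n) / (norm \<rho>)\<^sup>2"
        by (intro li_pair_bound x Q)
      then have "real (xi_mult \<rho>) * norm (li_pair (Suc n) \<rho>) * norm z ^ n \<le>
         real (xi_mult \<rho>) * (((real (Suc n))\<^sup>2 * (Q ^ 3) ^ Suc n) / (norm \<rho>)\<^sup>2) * norm z ^ n"
        by (intro mult_right_mono mult_left_mono) auto
      then show "norm (F x) \<le> (case x of (\<rho>, n) \<Rightarrow> real (xi_mult \<rho>) / (norm \<rho>)\<^sup>2 * w n)"
        by (simp add: x F_def w_def norm_mult norm_power mult_ac del: power_Suc of_nat_Suc)
    qed auto
    then have "F summable_on (Zeros \<times> UNIV)" by (rule abs_summable_summable)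
    then obtain S where S: "(F has_sum S) (Zeros \<times> UNIV)" by (auto simp: summable_on_def)
    have inner: "((\<lambda>n. F (\<rho>, n)) has_sum (of_nat (xi_mult \<rho>) * (s\<^sup>2 * ((1 / (s - \<rho>) + 1 / (s - (1 - \<rho>))) / 2)))) UNIV"
      if "\<rho> \<in> Zeros" for \<rho>
    proof -
      have "(\<lambda>n. F (\<rho>, n)) summable_on UNIV"
        using summable_on_SigmaD1[of "\<lambda>a b. F (a, b)" Zeros "\<lambda>_. UNIV" \<rho>] \<open>F summable_on (Zeros \<times> UNIV)\<close> that by simp
      then obtain T where T: "((\<lambda>n. F (\<rho>, n)) has_sum T) UNIV" by (auto simp: summable_on_def)
      have "(\<lambda>n. li_pair (Suc n) \<rho> * z ^ n) sums (s\<^sup>2 * ((1 / (s - \<rho>) + 1 / (s - (1 - \<rho>))) / 2))"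
        unfolding s_def using Zeros_nonzero[OF that] z1 qz[OF that] by (intro li_pair_generating) auto
      from sums_mult[OF this, of "of_nat (xi_mult \<rho>)"]
      have "(\<lambda>n. F (\<rho>, n)) sums (of_nat (xi_mult \<rho>) * (s\<^sup>2 * ((1 / (s - \<rho>) + 1 / (s - (1 - \<rho>))) / 2)))"
        by (simp add: F_def mult.assoc)
      with has_sum_imp_sums[OF T] have "T = of_nat (xi_mult \<rho>) * (s\<^sup>2 * ((1 / (s - \<rho>) + 1 / (s - (1 - \<rho>))) / 2))"
        by (rule sums_unique2)
      with T show ?thesis by simp
    qed
    have "((\<lambda>\<rho>. of_nat (xi_mult \<rho>) * (s\<^sup>2 * ((1 / (s - \<rho>) + 1 / (s - (1 - \<rho>))) / 2))) has_sum S) Zeros"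
      by (rule has_sum_SigmaD[OF S inner])
    moreover have "((\<lambda>\<rho>. of_nat (xi_mult \<rho>) * (s\<^sup>2 * ((1 / (s - \<rho>) + 1 / (s - (1 - \<rho>))) / 2))) has_sum (s\<^sup>2 * L s)) Zeros"
      using has_sum_cmult_right[OF L_has_sum_sym[OF Xs], of "s\<^sup>2"] by (simp add: mult_ac)
    ultimately have SL: "S = s\<^sup>2 * L s" by (rule has_sum_unique)
    have "((\<lambda>(n, \<rho>). F (\<rho>, n)) has_sum S) (UNIV \<times> Zeros)" using S by (subst (asm) has_sum_swap)
    then have "((\<lambda>n. li_coeff (Suc n) * z ^ n) has_sum S) UNIV"
    proof (rule has_sum_SigmaD)
      fix n :: nat
      show "((\<lambda>\<rho>. case (n, \<rho>) of (n, \<rho>) \<Rightarrow> F (\<rho>, n)) has_sum (li_coeff (Suc n) * z ^ n)) Zeros"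
        using has_sum_cmult_left[OF li_coeff_has_sum[of "Suc n"], of "z ^ n"] by (simp add: F_def)
    qed
    from has_sum_imp_sums[OF this] show ?thesis unfolding SL s_def .
  qed
  with R show ?thesis using that by blast
qed


lemma residue_L:
  assumes "\<rho> \<in> Zeros"
  shows "((\<lambda>s. (s - \<rho>) * L s) \<longlongrightarrow> of_nat (xi_mult \<rho>)) (at \<rho>)"
proof -
  define m where "m = xi_mult \<rho>"
  obtain k where k: "m = Suc k" using xi_mult_pos[OF assms] by (cases m) (auto simp: m_def)
  obtain h where h: "h holomorphic_on UNIV" "h \<rho> \<noteq> 0" "\<And>s. Xi s = (s - \<rho>) ^ m * h s"
    using entire_factor_zero[OF holomorphic_Xi Xi_nonzero] unfolding m_def xi_mult_def by blast
  have hd: "(h has_field_derivative deriv h s) (at s)" for s by (rule holomorphic_derivI[OF h(1)]) auto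
  have dX: "deriv Xi s = of_nat m * (s - \<rho>) ^ k * h s + (s - \<rho>) ^ m * deriv h s" for s
  proof -
    have "((\<lambda>s. (s - \<rho>) ^ m * h s) has_field_derivative (of_nat m * (s - \<rho>) ^ k * h s + (s - \<rho>) ^ m * deriv h s)) (at s)"
      unfolding k by (rule derivative_eq_intros hd refl | simp add: algebra_simps)+
    moreover have "(\<lambda>s. (s - \<rho>) ^ m * h s) = Xi" using h(3) by auto
    ultimately show ?thesis by (simp add: DERIV_imp_deriv)
  qed
  have ch: "isCont h \<rho>" using hd by (rule DERIV_isCont)
  have cd: "isCont (deriv h) \<rho>"
  proof -
    have "deriv h holomorphic_on UNIV" by (intro holomorphic_deriv h) auto
    then have "continuous_on UNIV (deriv h)" by (rule holomorphic_on_imp_continuous_on)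
    then show ?thesis by (simp add: continuous_on_eq_continuous_at)
  qed
  have "((\<lambda>s. of_nat m + (s - \<rho>) * deriv h s / h s) \<longlongrightarrow> of_nat m + (\<rho> - \<rho>) * deriv h \<rho> / h \<rho>) (at \<rho>)"
    using h(2) by (intro tendsto_intros isContD ch cd)
  then have "((\<lambda>s. of_nat m + (s - \<rho>) * deriv h s / h s) \<longlongrightarrow> of_nat m) (at \<rho>)" by simp
  then show ?thesis unfolding m_def[symmetric]
  proof (rule Lim_transform_eventually)
    have "\<forall>\<^sub>F s in at \<rho>. h s \<noteq> 0" using ch h(2) by (simp add: isCont_def tendsto_imp_eventually_ne)
    with eventually_neq_at_within[of \<rho> \<rho> UNIV]
    show "\<forall>\<^sub>F s in at \<rho>. of_nat m + (s - \<rho>) * deriv h s / h s = (s - \<rho>) * L s"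
    proof eventually_elim
      case (elim s)
      then show ?case unfolding L_def dX h(3)[of s] k by (simp add: divide_simps) (simp add: algebra_simps)
    qed
  qed
qed

lemma holomorphic_L: "(\<And>s. s \<in> A \<Longrightarrow> Xi s \<noteq> 0) \<Longrightarrow> L holomorphic_on A"
  unfolding L_def[abs_def]
  by (intro holomorphic_on_divide holomorphic_Xi holomorphic_on_subset[OF holomorphic_deriv[OF holomorphic_Xi open_UNIV]]) auto

text \<open>Li's criterion. In the variable z = 1 - 1/s the half plane Re s > 1/2 is the unit disc. If there
is a zero off the critical line, s^2 L(s) has poles in the disc; let p be one of minimal
modulus. Up to the circle through p the generating series converges, and its nonnegative
coefficients bound the value at tp by the value at t|p|. The latter stays bounded as t tends to
1, because the points of [0,1) correspond to real s >= 1, where xi has no zeros. This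
contradicts the pole at p.\<close>

theorem RH_if_li_nonneg:
  assumes li: "\<And>n. n \<ge> 1 \<Longrightarrow> \<exists>a\<ge>0. li_coeff n = complex_of_real a"
  shows "riemann_hypothesis"
proof (rule ccontr)
  assume "\<not> riemann_hypothesis"
  then obtain \<rho>1 where r1: "\<rho>1 \<in> Zeros" "Re \<rho>1 \<noteq> 1 / 2"
    by (auto simp: riemann_hypothesis_def nontrivial_zeta_zeros_eq Zeros_def)
  obtain \<rho>0 where r0: "\<rho>0 \<in> Zeros" "Re \<rho>0 > 1 / 2"
  proof (cases "Re \<rho>1 > 1 / 2")
    case False
    then have "1 - \<rho>1 \<in> Zeros" "Re (1 - \<rho>1) > 1 / 2" using r1 by (auto simp: Zeros_reflect)
    then show ?thesis by (rule that)
  qed (use r1 that in auto)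
  define s where "s z = 1 / (1 - z)" for z :: complex
  define Psi where "Psi z = (s z)\<^sup>2 * L (s z)" for z
  have s_p: "s (1 - 1 / \<rho>) = \<rho>" if "\<rho> \<noteq> 0" for \<rho> using that by (simp add: s_def)
  define p0 where "p0 = 1 - 1 / \<rho>0"
  have r00: "\<rho>0 \<noteq> 0" using Zeros_nonzero r0 by blast
  have p0: "norm p0 < 1" "Xi (s p0) = 0"
  proof -
    have "(norm (\<rho>0 - 1))\<^sup>2 < (norm \<rho>0)\<^sup>2" using r0(2) by (simp add: cmod_power2) (simp add: power2_eq_square algebra_simps)
    then have "norm (\<rho>0 - 1) < norm \<rho>0" by (rule power2_less_imp_less) simp
    moreover have "p0 = (\<rho>0 - 1) / \<rho>0" using r00 by (simp add: p0_def diff_divide_distrib)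
    ultimately show "norm p0 < 1" using r00 by (simp add: norm_divide)
    show "Xi (s p0) = 0" unfolding p0_def s_p[OF r00] using r0 by (simp add: Zeros_def)
  qed
  \<comment> \<open>The zeros in this disc form a compact set, so that one of minimal modulus exists.\<close>
  define K where "K = {z \<in> cball 0 (norm p0). Xi (s z) = 0}"
  have ne1: "z \<noteq> 1" if "norm z < 1" for z :: complex using that by auto
  have hs: "s holomorphic_on A" if "\<And>z. z \<in> A \<Longrightarrow> norm z < 1" for A
    unfolding s_def[abs_def] using that ne1 by (intro holomorphic_intros) force
  have "compact K"
  proof -
    have "continuous_on (cball 0 (norm p0)) (\<lambda>z. Xi (s z))"
      by (rule continuous_on_compose2[OF holomorphic_on_imp_continuous_on[OF holomorphic_Xi[of UNIV]] holomorphic_on_imp_continuous_on[OF hs]])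
         (use p0 in auto)
    then have "closed (cball 0 (norm p0) \<inter> (\<lambda>z. Xi (s z)) -` {0})"
      by (intro continuous_closed_preimage) auto
    moreover have "cball 0 (norm p0) \<inter> (\<lambda>z. Xi (s z)) -` {0} = K" by (auto simp: K_def)
    ultimately have "closed K" by simp
    moreover have "bounded K" by (rule bounded_subset[OF bounded_cball[of 0 "norm p0"]]) (auto simp: K_def)
    ultimately show ?thesis by (simp add: compact_eq_bounded_closed)
  qed
  moreover have "p0 \<in> K" using p0 by (simp add: K_def)
  ultimately obtain p where p: "p \<in> K" "\<And>z. z \<in> K \<Longrightarrow> norm p \<le> norm z"
    using continuous_attains_inf[of K norm] by (auto intro: continuous_intros)
  define R where "R = norm p"
  have R1: "R < 1" using p(1) p0 by (auto simp: K_def R_def)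
  have Xp: "Xi (s p) = 0" using p(1) by (simp add: K_def)
  have R0: "R > 0"
  proof -
    have "p \<noteq> 0" using Xp by (auto simp: s_def Xi_1)
    then show ?thesis by (simp add: R_def)
  qed
  have nz: "Xi (s z) \<noteq> 0" if "norm z < R" for z
  proof
    assume "Xi (s z) = 0"
    then have "z \<in> K" using that p(1) by (auto simp: K_def R_def)
    with p(2)[OF this] that show False by (simp add: R_def)
  qed
  have hPsi: "Psi holomorphic_on A" if "\<And>z. z \<in> A \<Longrightarrow> norm z < 1 \<and> Xi (s z) \<noteq> 0" for A
  proof -
    have "(L \<circ> s) holomorphic_on A"
      by (rule holomorphic_on_compose_gen[OF hs holomorphic_L[of "{w. Xi w \<noteq> 0}"]]) (use that in auto)
    then show ?thesis unfolding Psi_def[abs_def] using that by (intro holomorphic_intros hs) (auto simp: o_def)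
  qed
  obtain R' where R': "R' > 0" "R' < 1" "\<And>z. norm z < R' \<Longrightarrow> (\<lambda>n. li_coeff (Suc n) * z ^ n) sums Psi z"
    using li_generating_function unfolding Psi_def s_def by blast
  define F where "F = Abs_fps (\<lambda>n. li_coeff (Suc n))"
  have Psi_F: "Psi has_fps_expansion F"
    unfolding has_fps_expansion_def
  proof
    have "summable (\<lambda>n. fps_nth F n * of_real (R' / 2) ^ n)"
      using R'(3)[of "of_real (R' / 2)"] R' by (auto simp: F_def sums_iff)
    then have "ereal (norm (of_real (R' / 2) :: complex)) \<le> fps_conv_radius F"
      unfolding fps_conv_radius_def by (rule conv_radius_geI)
    moreover have "ereal (norm (of_real (R' / 2) :: complex)) > 0" using R' by simp
    ultimately show "0 < fps_conv_radius F" by (rule less_le_trans[rotated])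
    have "\<forall>\<^sub>F z in nhds (0::complex). z \<in> ball 0 R'" using R' by (intro eventually_nhds_in_open) auto
    then show "\<forall>\<^sub>F z in nhds 0. eval_fps F z = Psi z"
      by eventually_elim (use R'(3) in \<open>simp add: eval_fps_def F_def sums_iff\<close>)
  qed
  have series: "(\<lambda>n. li_coeff (Suc n) * z ^ n) sums Psi z" if z: "norm z < R" for z
  proof -
    have "Psi holomorphic_on ball 0 R" using R1 nz by (intro hPsi) force
    then have "(\<lambda>n. (deriv ^^ n) Psi 0 / fact n * (z - 0) ^ n) sums Psi z"
      by (rule holomorphic_power_series) (use z in simp)
    then show ?thesis unfolding fps_nth_fps_expansion[OF Psi_F, symmetric] by (simp add: F_def)
  qed
  have dominated: "norm (Psi z) \<le> norm (Psi (of_real (norm z)))" if z: "norm z < R" for z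
  proof -
    have a: "\<exists>a\<ge>0. li_coeff (Suc n) = complex_of_real a" for n by (rule li) simp
    then have li_norm: "norm (li_coeff (Suc n)) = Re (li_coeff (Suc n))" for n
      by (metis Re_complex_of_real norm_of_real abs_of_nonneg)
    have li_re: "complex_of_real (Re (li_coeff (Suc n))) = li_coeff (Suc n)" for n
      using a[of n] by auto
    have S: "(\<lambda>n. li_coeff (Suc n) * of_real (norm z) ^ n) sums Psi (of_real (norm z))"
      by (rule series) (use z in simp)
    have "(\<lambda>n. Re (li_coeff (Suc n)) * norm z ^ n) sums Re (Psi (of_real (norm z)))"
      using sums_Re[OF S] by (simp flip: of_real_power)
    moreover have "norm (li_coeff (Suc n) * z ^ n) = Re (li_coeff (Suc n)) * norm z ^ n" for n
      by (simp add: norm_mult norm_power li_norm)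
    ultimately have T: "(\<lambda>n. norm (li_coeff (Suc n) * z ^ n)) sums Re (Psi (of_real (norm z)))" by simp
    have "Psi z = (\<Sum>n. li_coeff (Suc n) * z ^ n)" using series[OF z] by (simp add: sums_iff)
    then have "norm (Psi z) \<le> (\<Sum>n. norm (li_coeff (Suc n) * z ^ n))"
      using summable_norm[of "\<lambda>n. li_coeff (Suc n) * z ^ n"] T by (simp add: sums_iff)
    also have "\<dots> = Re (Psi (of_real (norm z)))" using T by (simp add: sums_iff)
    also have "\<dots> \<le> norm (Psi (of_real (norm z)))" by (rule complex_Re_le_cmod)
    finally show ?thesis .
  qed
  have "\<exists>M. \<forall>x\<in>{0..R}. norm (Psi (of_real x)) \<le> M"
  proof -
    have "Psi holomorphic_on of_real ` {0..R}"
    proof (rule hPsi)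
      fix z :: complex assume "z \<in> of_real ` {0..R}"
      then obtain x where x: "z = of_real x" "0 \<le> x" "x \<le> R" by auto
      have "s z = of_real (1 / (1 - x))" by (simp add: s_def x)
      moreover have "1 / (1 - x) \<ge> 1" using x R1 by (simp add: field_simps)
      ultimately have "Xi (s z) \<noteq> 0" using Xi_real_nonzero[of "1 / (1 - x)"] by metis
      then show "norm z < 1 \<and> Xi (s z) \<noteq> 0" using x R1 by simp
    qed
    then have "continuous_on (of_real ` {0..R}) Psi" by (rule holomorphic_on_imp_continuous_on)
    then have "continuous_on {0..R} (\<lambda>x. Psi (of_real x))"
      by (rule continuous_on_compose2) (auto intro!: continuous_intros)
    then have "compact ((\<lambda>x. Psi (of_real x)) ` {0..R})" by (rule compact_continuous_image) simp
    then have "bounded ((\<lambda>x. Psi (of_real x)) ` {0..R})" by (rule compact_imp_bounded)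
    then show ?thesis by (auto simp: bounded_iff)
  qed
  then obtain M where M0: "\<forall>x\<in>{0..R}. norm (Psi (of_real x)) \<le> M" by blast
  have M: "norm (Psi (of_real x)) \<le> M" if "0 \<le> x" "x \<le> R" for x using M0 that by simp
  define \<rho> where "\<rho> = s p"
  have rZ: "\<rho> \<in> Zeros" using Xp by (simp add: \<rho>_def Zeros_def)
  \<comment> \<open>Radial approach to p, along which the bounded function would have to blow up.\<close>
  define w where "w n = (1 - 1 / of_nat (Suc n)) * p" for n :: nat
  have w_norm: "norm (w n) < R" for n
  proof -
    have "(1 - 1 / of_nat (Suc n) :: complex) = of_real (1 - 1 / real (Suc n))" by simp
    then have "norm (w n) = \<bar>1 - 1 / real (Suc n)\<bar> * R"
      unfolding w_def norm_mult R_def by (simp only: norm_of_real)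
    also have "\<bar>1 - 1 / real (Suc n)\<bar> = 1 - 1 / real (Suc n)" by (intro abs_of_nonneg) simp
    also have "(1 - 1 / real (Suc n)) * R < 1 * R" using R0 by (intro mult_strict_right_mono) auto
    finally show ?thesis by simp
  qed
  have w_lim: "w \<longlonglongrightarrow> p"
  proof -
    have "(\<lambda>n. (1 - 1 / of_nat (Suc n)) * p) \<longlonglongrightarrow> (1 - 0) * p"
      by (intro tendsto_intros lim_const_over_n[THEN LIMSEQ_Suc])
    then show ?thesis by (simp add: w_def[abs_def])
  qed
  have p1: "1 - p \<noteq> 0" using R1 by (auto simp: R_def)
  have sw_lim: "(\<lambda>n. s (w n)) \<longlonglongrightarrow> \<rho>"
    unfolding s_def \<rho>_def using p1 by (intro tendsto_intros w_lim)
  have sw_ne: "s (w n) \<noteq> \<rho>" for n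
    using nz[OF w_norm[of n]] rZ by (auto simp: Zeros_def)
  have "filterlim (\<lambda>n. s (w n)) (at \<rho>) sequentially"
    using sw_lim sw_ne by (simp add: filterlim_at)
  with residue_L[OF rZ] have lim: "(\<lambda>n. (s (w n) - \<rho>) * L (s (w n))) \<longlonglongrightarrow> of_nat (xi_mult \<rho>)"
    by (rule filterlim_compose)
  have Lb: "norm (L (s (w n))) \<le> 4 * M" for n
  proof -
    have w1: "norm (w n) < 1" using w_norm[of n] R1 by simp
    then have n1: "1 - w n \<noteq> 0" by auto
    have "L (s (w n)) = (1 - w n)\<^sup>2 * Psi (w n)" using n1 by (simp add: Psi_def s_def power_divide)
    then have "norm (L (s (w n))) = (norm (1 - w n))\<^sup>2 * norm (Psi (w n))" by (simp add: norm_mult norm_power)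
    also have "\<dots> \<le> 2\<^sup>2 * M"
    proof (intro mult_mono power_mono)
      show "norm (1 - w n) \<le> 2" using norm_triangle_ineq4[of 1 "w n"] w1 by simp
      show "norm (Psi (w n)) \<le> M"
        using dominated[OF w_norm[of n]] M[of "norm (w n)"] w_norm[of n] by simp
    qed auto
    finally show ?thesis by simp
  qed
  have "(\<lambda>n. (s (w n) - \<rho>) * L (s (w n))) \<longlonglongrightarrow> 0"
  proof (rule tendsto_norm_zero_cancel, rule tendsto_sandwich[OF _ _ tendsto_const])
    show "(\<lambda>n. norm (s (w n) - \<rho>) * (4 * M)) \<longlonglongrightarrow> 0"
      using sw_lim by (intro tendsto_mult_left_zero tendsto_norm_zero) (simp add: LIM_zero)
    show "\<forall>\<^sub>F n in sequentially. norm ((s (w n) - \<rho>) * L (s (w n))) \<le> norm (s (w n) - \<rho>) * (4 * M)"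
      unfolding norm_mult by (intro always_eventually allI mult_left_mono Lb) auto
  qed auto
  with lim have "of_nat (xi_mult \<rho>) = (0 :: complex)" by (rule LIMSEQ_unique)
  then show False using xi_mult_pos[OF rZ] by simp
qed

section \<open>Taylor coefficients of the logarithmic derivative of xi\<close>

text \<open>For positive j this is, up to the factor s^j, the remainder of the Taylor expansion of L at 0.\<close>

definition zeros_series :: "nat \<Rightarrow> complex \<Rightarrow> complex" where
  "zeros_series j s = (\<Sum>\<^sub>\<infinity>\<rho>\<in>Zeros. of_nat (xi_mult \<rho>) * (1 / (\<rho> ^ j * (s - \<rho>))))"

lemma zeros_series_bound:
  assumes e: "e > 0" "\<And>\<rho>. \<rho> \<in> Zeros \<Longrightarrow> norm \<rho> \<ge> e"
    and c: "c > 0" "\<And>\<rho>. \<rho> \<in> Zeros \<Longrightarrow> norm (s - \<rho>) \<ge> c * norm \<rho>"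
    and r: "\<rho> \<in> Zeros"
  shows "norm (1 / (\<rho> ^ Suc j * (s - \<rho>))) \<le> (1 / (e ^ j * c)) / (norm \<rho>)\<^sup>2"
proof -
  have n: "norm \<rho> > 0" using e r by (meson less_le_trans)
  have "e ^ j * norm \<rho> * (c * norm \<rho>) \<le> norm \<rho> ^ j * norm \<rho> * norm (s - \<rho>)"
    using e r c n by (intro mult_mono power_mono) auto
  moreover have "e ^ j * norm \<rho> * (c * norm \<rho>) > 0" using e c n by simp
  ultimately have "1 / (norm \<rho> ^ j * norm \<rho> * norm (s - \<rho>)) \<le> 1 / (e ^ j * norm \<rho> * (c * norm \<rho>))"
    by (intro frac_le) auto
  then show ?thesis by (simp add: norm_divide norm_mult norm_power power2_eq_square mult_ac)
qed

lemma zeros_series_has_sum: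
  assumes X: "Xi s \<noteq> 0"
  shows "((\<lambda>\<rho>. of_nat (xi_mult \<rho>) * (1 / (\<rho> ^ Suc j * (s - \<rho>)))) has_sum zeros_series (Suc j) s) Zeros"
proof -
  obtain e where e: "e > 0" "\<And>\<rho>. \<rho> \<in> Zeros \<Longrightarrow> norm \<rho> \<ge> e" using Zeros_norm_lower by blast
  obtain c where c: "c > 0" "\<And>\<rho>. \<rho> \<in> Zeros \<Longrightarrow> norm (s - \<rho>) \<ge> c * norm \<rho>"
    using Zeros_separated[OF X] by blast
  have "(\<lambda>\<rho>. norm (of_nat (xi_mult \<rho>) * (1 / (\<rho> ^ Suc j * (s - \<rho>))))) summable_on Zeros"
    by (rule abs_summable_Zeros) (rule zeros_series_bound[OF e c])
  then show ?thesis unfolding zeros_series_def by (rule has_sum_infsum[OF abs_summable_summable])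
qed

definition L_coeff :: "nat \<Rightarrow> complex" where
  "L_coeff k = (if k = 0 then L 0 else zeros_series k 0)"

lemma Xi_0_nonzero: "Xi 0 \<noteq> 0" by (subst Xi_0) simp

text \<open>Geometric expansion 1/(s - rho) = -1/rho + s / (rho (s - rho)), summed over the zeros.\<close>

lemma zeros_series_step:
  assumes X: "Xi s \<noteq> 0"
  shows "zeros_series (Suc j) s = L_coeff (Suc j) + s * zeros_series (Suc (Suc j)) s"
proof -
  have S: "((\<lambda>\<rho>. of_nat (xi_mult \<rho>) * (1 / (\<rho> ^ Suc j * (0 - \<rho>))) + s * (of_nat (xi_mult \<rho>) * (1 / (\<rho> ^ Suc (Suc j) * (s - \<rho>)))))
     has_sum (zeros_series (Suc j) 0 + s * zeros_series (Suc (Suc j)) s)) Zeros"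
    by (intro has_sum_add has_sum_cmult_right zeros_series_has_sum X Xi_0_nonzero)
  have eq: "of_nat (xi_mult \<rho>) * (1 / (\<rho> ^ Suc j * (0 - \<rho>))) + s * (of_nat (xi_mult \<rho>) * (1 / (\<rho> ^ Suc (Suc j) * (s - \<rho>)))) =
     of_nat (xi_mult \<rho>) * (1 / (\<rho> ^ Suc j * (s - \<rho>)))" if "\<rho> \<in> Zeros" for \<rho>
  proof -
    have n: "\<rho> \<noteq> 0" "s - \<rho> \<noteq> 0" "\<rho> ^ Suc j \<noteq> 0" using that X Zeros_nonzero[OF that] by (auto simp: Zeros_def)
    have "1 / (0 - \<rho>) + s / (\<rho> * (s - \<rho>)) = 1 / (s - \<rho>)" using n by (simp add: divide_simps)
    then have "(1 / \<rho> ^ Suc j) * (1 / (0 - \<rho>) + s / (\<rho> * (s - \<rho>))) = (1 / \<rho> ^ Suc j) * (1 / (s - \<rho>))"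
      by (simp only:)
    then have "1 / (\<rho> ^ Suc j * (0 - \<rho>)) + s * (1 / (\<rho> ^ Suc (Suc j) * (s - \<rho>))) = 1 / (\<rho> ^ Suc j * (s - \<rho>))"
      by (simp add: distrib_left diff_divide_distrib mult_ac)
    then have "of_nat (xi_mult \<rho>) * (1 / (\<rho> ^ Suc j * (0 - \<rho>)) + s * (1 / (\<rho> ^ Suc (Suc j) * (s - \<rho>)))) =
      of_nat (xi_mult \<rho>) * (1 / (\<rho> ^ Suc j * (s - \<rho>)))" by (simp only:)
    then show ?thesis by (simp only: distrib_left mult.left_commute[of s])
  qed
  have "((\<lambda>\<rho>. of_nat (xi_mult \<rho>) * (1 / (\<rho> ^ Suc j * (s - \<rho>)))) has_sum (zeros_series (Suc j) 0 + s * zeros_series (Suc (Suc j)) s)) Zeros"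
    by (rule has_sum_cong[THEN iffD1, OF eq S])
  with zeros_series_has_sum[OF X] have "zeros_series (Suc j) s = zeros_series (Suc j) 0 + s * zeros_series (Suc (Suc j)) s"
    by (rule has_sum_unique)
  then show ?thesis by (simp add: L_coeff_def)
qed

lemma L_expansion_remainder:
  assumes X: "Xi s \<noteq> 0"
  shows "L s = (\<Sum>k<Suc j. L_coeff k * s ^ k) + s ^ Suc j * zeros_series (Suc j) s"
proof (induction j)
  case 0
  have "((\<lambda>\<rho>. of_nat (xi_mult \<rho>) * (s / (\<rho> * (s - \<rho>)))) has_sum (s * zeros_series (Suc 0) s)) Zeros"
    using has_sum_cmult_right[OF zeros_series_has_sum[OF X, of 0], of s] by (simp add: mult_ac)
  with L_has_sum[OF X] have "L s - L 0 = s * zeros_series (Suc 0) s" by (rule has_sum_unique)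
  then show ?case by (simp add: L_coeff_def algebra_simps)
next
  case (Suc j)
  show ?case unfolding Suc.IH zeros_series_step[OF X, of j] by (simp add: algebra_simps)
qed

lemma L_has_fps_expansion: "L has_fps_expansion Abs_fps L_coeff"
proof -
  obtain e where e: "e > 0" "\<And>\<rho>. \<rho> \<in> Zeros \<Longrightarrow> norm \<rho> \<ge> e" using Zeros_norm_lower by blast
  define C where "C = (\<Sum>\<^sub>\<infinity>\<rho>\<in>Zeros. real (xi_mult \<rho>) / (norm \<rho>)\<^sup>2)"
  have sums: "(\<lambda>k. L_coeff k * s ^ k) sums L s" if s: "norm s \<le> e / 2" for s
  proof -
    have sep: "norm (s - \<rho>) \<ge> 1 / 2 * norm \<rho>" if "\<rho> \<in> Zeros" for \<rho>
      using e(2)[OF that] s norm_triangle_ineq[of "\<rho> - s" s] by (simp add: norm_minus_commute)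
    have X: "Xi s \<noteq> 0"
    proof
      assume "Xi s = 0"
      then have "e \<le> norm s" using e(2)[of s] by (simp add: Zeros_def)
      then show False using s e(1) by simp
    qed
    have b: "norm (zeros_series (Suc j) s) \<le> 2 / e ^ j * C" for j
    proof (rule norm_infsum_le[OF zeros_series_has_sum[OF X]])
      show "((\<lambda>\<rho>. 2 / e ^ j * (real (xi_mult \<rho>) / (norm \<rho>)\<^sup>2)) has_sum (2 / e ^ j * C)) Zeros"
        unfolding C_def by (intro has_sum_cmult_right has_sum_infsum summable_inverse_square_zeros)
      fix \<rho> assume r: "\<rho> \<in> Zeros"
      have "norm (1 / (\<rho> ^ Suc j * (s - \<rho>))) \<le> (1 / (e ^ j * (1 / 2))) / (norm \<rho>)\<^sup>2"
        by (rule zeros_series_bound[OF e _ sep r]) auto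
      then have "real (xi_mult \<rho>) * norm (1 / (\<rho> ^ Suc j * (s - \<rho>))) \<le> real (xi_mult \<rho>) * ((1 / (e ^ j * (1 / 2))) / (norm \<rho>)\<^sup>2)"
        by (rule mult_left_mono) simp
      also have "\<dots> = 2 / e ^ j * (real (xi_mult \<rho>) / (norm \<rho>)\<^sup>2)" by simp
      finally show "norm (of_nat (xi_mult \<rho>) * (1 / (\<rho> ^ Suc j * (s - \<rho>)))) \<le> 2 / e ^ j * (real (xi_mult \<rho>) / (norm \<rho>)\<^sup>2)"
        by (simp only: norm_mult[of "of_nat (xi_mult \<rho>)"] norm_of_nat)
    qed
    have "(\<lambda>j. \<Sum>k<Suc j. L_coeff k * s ^ k) \<longlonglongrightarrow> L s"
    proof (rule Lim_transform_eventually[OF _ always_eventually])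
      have "(\<lambda>j. s ^ Suc j * zeros_series (Suc j) s) \<longlonglongrightarrow> 0"
      proof (rule tendsto_norm_zero_cancel, rule tendsto_sandwich[OF _ _ tendsto_const])
        have "(\<lambda>j. norm s * (2 * C) * (norm s / e) ^ j) \<longlonglongrightarrow> norm s * (2 * C) * 0"
          using s e by (intro tendsto_mult tendsto_const LIMSEQ_power_zero) (auto simp: divide_less_eq)
        then show "(\<lambda>j. norm s * (2 * C) * (norm s / e) ^ j) \<longlonglongrightarrow> 0" by simp
        show "\<forall>\<^sub>F j in sequentially. norm (s ^ Suc j * zeros_series (Suc j) s) \<le> norm s * (2 * C) * (norm s / e) ^ j"
        proof (intro always_eventually allI)
          fix j
          have "norm (s ^ Suc j * zeros_series (Suc j) s) \<le> norm s ^ Suc j * (2 / e ^ j * C)"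
            unfolding norm_mult norm_power by (intro mult_left_mono b) auto
          then show "norm (s ^ Suc j * zeros_series (Suc j) s) \<le> norm s * (2 * C) * (norm s / e) ^ j"
            by (simp add: power_divide mult_ac)
        qed
      qed auto
      from tendsto_diff[OF tendsto_const[of "L s"] this]
      show "(\<lambda>j. L s - s ^ Suc j * zeros_series (Suc j) s) \<longlonglongrightarrow> L s" by simp
      show "\<forall>j. L s - s ^ Suc j * zeros_series (Suc j) s = (\<Sum>k<Suc j. L_coeff k * s ^ k)"
      proof
        fix j
        show "L s - s ^ Suc j * zeros_series (Suc j) s = (\<Sum>k<Suc j. L_coeff k * s ^ k)"
          using L_expansion_remainder[OF X, of j] by (simp only: add_diff_cancel_right')
      qed
    qed
    then show ?thesis unfolding sums_def by (subst (asm) filterlim_sequentially_Suc)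
  qed
  show ?thesis unfolding has_fps_expansion_def
  proof
    have "summable (\<lambda>n. fps_nth (Abs_fps L_coeff) n * of_real (e / 2) ^ n)"
      using sums[of "of_real (e / 2)"] e(1) by (simp add: sums_iff)
    then have "ereal (norm (of_real (e / 2) :: complex)) \<le> fps_conv_radius (Abs_fps L_coeff)"
      unfolding fps_conv_radius_def by (rule conv_radius_geI)
    moreover have "ereal (norm (of_real (e / 2) :: complex)) > 0" using e by simp
    ultimately show "0 < fps_conv_radius (Abs_fps L_coeff)" by (rule less_le_trans[rotated])
    have "\<forall>\<^sub>F z in nhds (0::complex). z \<in> ball 0 (e / 2)" using e by (intro eventually_nhds_in_open) auto
    then show "\<forall>\<^sub>F z in nhds 0. eval_fps (Abs_fps L_coeff) z = L z"
      by eventually_elim (use sums in \<open>simp add: eval_fps_def sums_iff\<close>)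
  qed
qed

text \<open>Split the zeta series into odd and even terms, and drop the term 1.\<close>

lemma odd_zeta_sums:
  assumes k: "k \<ge> 1"
  shows "(\<lambda>n. 1 / (of_nat (2 * n + 3)) ^ Suc k) sums ((1 - 1 / 2 ^ Suc k) * zeta (of_nat (Suc k)) - 1 :: complex)"
proof -
  define Z where "Z = zeta (of_nat (Suc k))"
  have Re: "Re (of_nat (Suc k)) > 1" using k by simp
  have "(\<lambda>n. 1 / of_nat (Suc n) powr of_nat (Suc k)) sums Z"
    using summable_dirichlet[OF Re] unfolding Z_def zeta_eq_dirichlet[OF Re] dirichlet_zeta_def by (rule summable_sums)
  then have A: "(\<lambda>n. 1 / of_nat (Suc n) ^ Suc k) sums Z" by (simp only: powr_nat' of_nat_neq_0 simp_thms)
  have B: "(\<lambda>n. 1 / of_nat (2 * n + 2) ^ Suc k) sums (1 / 2 ^ Suc k * Z)"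
  proof -
    have "(\<lambda>n. 1 / 2 ^ Suc k * (1 / of_nat (Suc n) ^ Suc k)) sums (1 / 2 ^ Suc k * Z)" by (rule sums_mult[OF A])
    moreover have "1 / 2 ^ Suc k * (1 / of_nat (Suc n) ^ Suc k) = (1 / of_nat (2 * n + 2) ^ Suc k :: complex)" for n
    proof -
      have "of_nat (2 * n + 2) = (2 * of_nat (Suc n) :: complex)" by simp
      then show ?thesis by (simp only: power_mult_distrib) (simp del: of_nat_Suc power_Suc)
    qed
    ultimately show ?thesis by (simp only:)
  qed
  have "(\<lambda>n. 1 / of_nat (2 * n + 1) ^ Suc k + 1 / of_nat (2 * n + 2) ^ Suc k) sums Z"
  proof -
    have "(\<lambda>n. \<Sum>i=n * 2..<n * 2 + 2. 1 / of_nat (Suc i) ^ Suc k) sums Z" by (rule sums_group[OF A]) simp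
    moreover have "(\<Sum>i=n * 2..<n * 2 + 2. 1 / of_nat (Suc i) ^ Suc k) = 1 / of_nat (2 * n + 1) ^ Suc k + (1 / of_nat (2 * n + 2) ^ Suc k :: complex)" for n
    proof -
      have "{n * 2..<n * 2 + 2} = {2 * n, 2 * n + 1}" by auto
      then show ?thesis by (simp del: of_nat_Suc power_Suc)
    qed
    ultimately show ?thesis by (simp only:)
  qed
  from sums_diff[OF this B] have "(\<lambda>n. 1 / of_nat (2 * n + 1) ^ Suc k) sums (Z - 1 / 2 ^ Suc k * Z)" by simp
  then have "(\<lambda>n. 1 / of_nat (2 * Suc n + 1) ^ Suc k) sums (Z - 1 / 2 ^ Suc k * Z - 1 / of_nat (2 * 0 + 1) ^ Suc k)"
    by (subst sums_Suc_iff) simp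
  moreover have "Z - 1 / 2 ^ Suc k * Z - 1 / of_nat (2 * 0 + 1) ^ Suc k = (1 - 1 / 2 ^ Suc k) * Z - 1"
    by (simp add: algebra_simps)
  moreover have "2 * Suc n + 1 = 2 * n + 3" for n by simp
  ultimately show ?thesis unfolding Z_def by (simp only:)
qed

lemma Polygamma_three_halves:
  assumes k: "k \<ge> 1"
  shows "Polygamma k (3 / 2 :: complex) / fact k = (- 1) ^ Suc k * 2 ^ Suc k * ((1 - 1 / 2 ^ Suc k) * zeta (of_nat (Suc k)) - 1)"
proof -
  have "(\<lambda>n. 2 ^ Suc k * (1 / of_nat (2 * n + 3) ^ Suc k)) sums (2 ^ Suc k * ((1 - 1 / 2 ^ Suc k) * zeta (of_nat (Suc k)) - 1 :: complex))"
    by (rule sums_mult[OF odd_zeta_sums[OF k]])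
  moreover have "2 ^ Suc k * (1 / of_nat (2 * n + 3) ^ Suc k) = inverse ((3 / 2 + of_nat n :: complex) ^ Suc k)" for n
  proof -
    have "(3 / 2 + of_nat n :: complex) = of_nat (2 * n + 3) / 2" by (simp add: field_simps)
    then show ?thesis by (simp only: power_divide) (simp add: field_simps del: of_nat_add of_nat_mult power_Suc)
  qed
  ultimately have "(\<Sum>n. inverse ((3 / 2 + of_nat n :: complex) ^ Suc k)) = 2 ^ Suc k * ((1 - 1 / 2 ^ Suc k) * zeta (of_nat (Suc k)) - 1)"
    by (simp only: sums_iff)
  then show ?thesis using k unfolding Polygamma_def by simp
qed

lemma logderiv_zeta_near_1:
  assumes t: "norm t < 1" "t \<noteq> 0" and X: "Xi (- t) \<noteq> 0"
  shows "- (deriv zeta (t + 1) / zeta (t + 1)) = 1 / t + (L (- t) + (1 / 2 * Digamma (1 / 2 * t + 3 / 2) - of_real (ln pi) / 2))"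
proof -
  define s where "s = t + 1"
  have s1: "s \<noteq> 1" using t by (simp add: s_def)
  define z where "z = s / 2 + 1"
  have ze: "z = 1 / 2 * t + 3 / 2" by (simp add: z_def s_def field_simps)
  have "\<bar>Re t\<bar> < 1" using t abs_Re_le_cmod[of t] by simp
  then have "Re z > 0" by (simp add: ze)
  then have z: "z \<notin> \<int>\<^sub>\<le>\<^sub>0" by (auto elim!: nonpos_Ints_cases)
  define P where "P = (of_real pi powr (s / 2) :: complex)"
  define x where "x = Xi s"
  define x' where "x' = deriv Xi s"
  define g where "g = rGamma z"
  have g0: "g \<noteq> 0" using z by (simp add: g_def rGamma_eq_zero_iff)
  have P0: "P \<noteq> 0" by (simp add: P_def)
  have x0: "x \<noteq> 0" using X Xi_reflect[of s] by (simp add: x_def s_def)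
  have "((\<lambda>s. Xi s * (of_real pi powr (s / 2) * rGamma (s / 2 + 1) / (s - 1))) has_field_derivative
     x' * (P * g / (s - 1)) + x * (((P * (of_real (ln pi) / 2)) * g + P * (- g * Digamma z / 2)) * (s - 1) - P * g) / (s - 1)\<^sup>2) (at s)"
  proof -
    have 1: "(Xi has_field_derivative x') (at s)"
      unfolding x'_def by (rule holomorphic_derivI[OF holomorphic_Xi[of UNIV]]) auto
    have 2: "((\<lambda>s. of_real pi powr (s / 2)) has_field_derivative P * (of_real (ln pi) / 2)) (at s)"
    proof -
      have pw: "of_real pi powr w = exp (w * of_real (ln pi) :: complex)" for w
        by (simp add: powr_def Ln_of_real)
      show ?thesis unfolding P_def pw by (auto intro!: derivative_eq_intros)
    qed
    have 3: "((\<lambda>s. rGamma (s / 2 + 1)) has_field_derivative (- g * Digamma z / 2)) (at s)"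
    proof -
      have "((\<lambda>s. rGamma (s / 2 + 1)) has_field_derivative (- rGamma z * Digamma z) * (1 / 2)) (at s)"
        by (rule DERIV_chain2[of rGamma]) (use z in \<open>auto simp: z_def[symmetric] intro!: has_field_derivative_rGamma_no_nonpos_int derivative_eq_intros\<close>)
      then show ?thesis by (simp add: g_def)
    qed
    have 4: "((\<lambda>s. s - 1) has_field_derivative 1) (at s)" by (auto intro!: derivative_eq_intros)
    have 5: "((\<lambda>s. of_real pi powr (s / 2) * rGamma (s / 2 + 1) / (s - 1)) has_field_derivative
      (((P * (of_real (ln pi) / 2)) * g + (- g * Digamma z / 2) * P) * (s - 1) - P * g * 1) / ((s - 1) * (s - 1))) (at s)"
      using DERIV_divide[OF DERIV_mult[OF 2 3] 4] s1 by (simp add: P_def g_def z_def)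
    show ?thesis using DERIV_mult[OF 1 5] by (simp add: P_def g_def z_def x_def power2_eq_square mult_ac)
  qed
  then have "(zeta has_field_derivative
     x' * (P * g / (s - 1)) + x * (((P * (of_real (ln pi) / 2)) * g + P * (- g * Digamma z / 2)) * (s - 1) - P * g) / (s - 1)\<^sup>2) (at s)"
    by (rule has_field_derivative_transform_within_open[of _ _ _ "- {1}"]) (use s1 in \<open>auto simp: zeta_Xi\<close>)
  then have d: "deriv zeta s = x' * (P * g / (s - 1)) + x * (((P * (of_real (ln pi) / 2)) * g + P * (- g * Digamma z / 2)) * (s - 1) - P * g) / (s - 1)\<^sup>2"
    by (rule DERIV_imp_deriv)
  have v: "zeta s = x * (P * g / (s - 1))" by (simp add: zeta_Xi[OF s1] x_def P_def g_def z_def)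
  have "deriv zeta s / zeta s = x' / x + (of_real (ln pi) / 2 - Digamma z / 2) - 1 / (s - 1)"
    unfolding d v using P0 g0 x0 s1 by (simp add: divide_simps power2_eq_square) (simp add: algebra_simps)
  moreover have "x' / x = - L (- t)" using L_reflect[of "- t"] by (simp add: L_def x_def x'_def s_def add.commute)
  ultimately show ?thesis by (simp add: s_def ze algebra_simps)
qed

text \<open>By zeta = xi times elementary factors, the expansion of -zeta'/zeta at 1 consists of the pole,
of -L and of a digamma term at 3/2. The symmetry L(1 + t) = -L(-t) turns the second into Taylor
coefficients at 0. The derivatives of digamma at 3/2 are sums over odd integers starting from 3;
the absent integer 1 is the summand 1 on the right.\<close>

theorem eta_eq:
  assumes k: "k \<ge> 1"
  shows "(- 1) ^ k * eta k + (1 - 1 / 2 ^ (k + 1)) * zeta (of_nat (k + 1)) = L_coeff k + 1"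
proof -
  define D where "D t = Digamma (1 / 2 * t + 3 / 2 :: complex)" for t
  have hD: "D holomorphic_on ball 0 1" and dD: "(deriv ^^ n) D 0 = (1 / 2) ^ n * Polygamma n (3 / 2)" for n
  proof -
    have T: "Digamma holomorphic_on {z. Re z > 0}"
      unfolding holomorphic_on_def by (intro ballI field_differentiable_Polygamma) (auto elim!: nonpos_Ints_cases)
    have sub: "1 / 2 * w + 3 / 2 \<in> {z. Re z > 0}" if "w \<in> ball 0 1" for w :: complex
      using that abs_Re_le_cmod[of w] by simp
    have "(Digamma \<circ> (\<lambda>t. 1 / 2 * t + 3 / 2)) holomorphic_on ball 0 1"
      by (rule holomorphic_on_compose_gen[OF _ T]) (use sub in \<open>auto intro!: holomorphic_intros\<close>)
    then show "D holomorphic_on ball 0 1" by (simp add: D_def[abs_def] o_def)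
    have "(deriv ^^ n) (\<lambda>w. Digamma (1 / 2 * w + 3 / 2)) 0 = (1 / 2) ^ n * (deriv ^^ n) Digamma (1 / 2 * 0 + 3 / 2 :: complex)"
      by (rule higher_deriv_compose_linear'[OF T, of "ball 0 1"]) (use sub open_halfspace_Re_gt in auto)
    also have "(deriv ^^ n) Digamma (1 / 2 * 0 + 3 / 2 :: complex) = Polygamma n (3 / 2)"
      by (subst higher_deriv_Polygamma) (auto elim!: nonpos_Ints_cases simp: complex_eq_iff)
    finally show "(deriv ^^ n) D 0 = (1 / 2) ^ n * Polygamma n (3 / 2)" by (simp add: D_def[abs_def])
  qed
  have eD: "D has_fps_expansion fps_expansion D 0"
    by (rule has_fps_expansion_fps_expansion[OF _ _ hD]) auto
  have eL: "(L \<circ> (\<lambda>t. - 1 * t)) has_fps_expansion fps_compose (Abs_fps L_coeff) (fps_const (- 1) * fps_X)"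
    by (rule has_fps_expansion_compose[OF L_has_fps_expansion]) (intro fps_expansion_intros, simp)
  define F where "F = fps_compose (Abs_fps L_coeff) (fps_const (- 1) * fps_X) + (fps_const (1 / 2) * fps_expansion D 0 + fps_const (- of_real (ln pi) / 2))"
  have "(\<lambda>t. (L \<circ> (\<lambda>t. - 1 * t)) t + (1 / 2 * D t + - of_real (ln pi) / 2)) has_fps_expansion F"
    unfolding F_def by (intro fps_expansion_intros eD eL)
  then have "(\<lambda>t. L (- t) + (1 / 2 * Digamma (1 / 2 * t + 3 / 2) - of_real (ln pi) / 2)) has_laurent_expansion fps_to_fls F"
    by (intro has_laurent_expansion_fps) (simp add: D_def)
  from has_laurent_expansion_add[OF has_laurent_expansion_inverse[OF has_laurent_expansion_fps_X] this]
  have lau: "(\<lambda>t. inverse t + (L (- t) + (1 / 2 * Digamma (1 / 2 * t + 3 / 2) - of_real (ln pi) / 2))) has_laurent_expansion inverse fls_X + fps_to_fls F" .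
  have "(\<lambda>s. - (deriv zeta (s + 1) / zeta (s + 1))) has_laurent_expansion inverse fls_X + fps_to_fls F"
  proof (rule has_laurent_expansion_cong[THEN iffD1, OF _ refl lau])
    have 1: "\<forall>\<^sub>F t in at (0::complex). t \<in> ball 0 1 - {0}" by (intro eventually_at_in_open) auto
    have "\<forall>\<^sub>F t in at 0. Xi (- t) \<noteq> 0"
    proof -
      have "(Xi \<circ> (\<lambda>t. - t)) holomorphic_on UNIV"
        by (intro holomorphic_on_compose holomorphic_intros holomorphic_Xi)
      then have "\<forall>\<^sub>F t in at 0. (Xi \<circ> (\<lambda>t. - t)) t \<noteq> 0"
        by (rule entire_eventually_nonzero[of _ 0]) (simp add: Xi_0_nonzero)
      then show ?thesis by simp
    qed
    with 1 show "\<forall>\<^sub>F t in at 0. inverse t + (L (- t) + (1 / 2 * Digamma (1 / 2 * t + 3 / 2) - of_real (ln pi) / 2)) =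
        - (deriv zeta (t + 1) / zeta (t + 1))"
      by eventually_elim (subst logderiv_zeta_near_1, auto simp: inverse_eq_divide)
  qed
  then have lx: "laurent_expansion (\<lambda>s. - (deriv zeta (s + 1) / zeta (s + 1))) 0 = inverse fls_X + fps_to_fls F"
    by (rule laurent_expansion_0_eqI)
  have "eta k = fps_nth F k" unfolding eta_def lx by (simp add: fls_inverse_X)
  also have "\<dots> = (- 1) ^ k * L_coeff k + 1 / 2 * fps_nth (fps_expansion D 0) k"
    using k unfolding F_def fps_compose_linear by simp
  also have "fps_nth (fps_expansion D 0) k = (1 / 2) ^ k * (Polygamma k (3 / 2) / fact k)"
    unfolding fps_nth_fps_expansion[OF eD] dD by simp
  also have "\<dots> = (1 / 2) ^ k * ((- 1) ^ Suc k * 2 ^ Suc k * ((1 - 1 / 2 ^ Suc k) * zeta (of_nat (Suc k)) - 1))"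
    by (simp only: Polygamma_three_halves[OF k])
  also have "1 / 2 * \<dots> = - ((- 1) ^ k * ((1 - 1 / 2 ^ Suc k) * zeta (of_nat (Suc k)) - 1))"
    by (simp add: power_divide)
  finally have e: "eta k = (- 1) ^ k * L_coeff k + - ((- 1) ^ k * ((1 - 1 / 2 ^ Suc k) * zeta (of_nat (Suc k)) - 1))" .
  have s: "(- 1) ^ k * ((- 1) ^ k * a) = (a :: complex)" for a
    by (simp flip: mult.assoc power_mult_distrib)
  have "(- 1) ^ k * eta k = L_coeff k - ((1 - 1 / 2 ^ Suc k) * zeta (of_nat (Suc k)) - 1)"
    unfolding e by (simp only: distrib_left mult_minus_right s) simp
  then show ?thesis by simp
qed

lemma one_minus_power_binomial:
  "1 - (1 - x) ^ n = (\<Sum>j=1..n. of_nat (n choose j) * (- 1) ^ (j - 1) * x ^ j :: complex)"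
proof -
  have "(1 - x) ^ n = (\<Sum>j\<le>n. of_nat (n choose j) * (- x) ^ j)"
    using binomial_ring[of "- x" 1 n] by simp
  also have "\<dots> = 1 + (\<Sum>j=1..n. of_nat (n choose j) * (- x) ^ j)"
    by (simp add: atMost_atLeast0 sum.atLeast_Suc_atMost)
  finally have "1 - (1 - x) ^ n = (\<Sum>j=1..n. - (of_nat (n choose j) * (- x) ^ j))" by (simp add: sum_negf)
  also have "\<dots> = (\<Sum>j=1..n. of_nat (n choose j) * (- 1) ^ (j - 1) * x ^ j)"
  proof (rule sum.cong[OF refl])
    fix j assume "j \<in> {1..n}"
    then obtain i where "j = Suc i" by (cases j) auto
    then show "- (of_nat (n choose j) * (- x) ^ j) = of_nat (n choose j) * (- 1) ^ (j - 1) * x ^ j"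
      by (simp add: power_minus[of x])
  qed
  finally show ?thesis .
qed

text \<open>The factor in braces in the definition of H.\<close>

definition Li_bracket :: "nat \<Rightarrow> complex \<Rightarrow> complex" where
  "Li_bracket n s = 1 / (s - 1)
        + (1 - (1 - 1 / s) ^ n) * (xi_logderiv s - 1 / (s - 1) - xi_logderiv 0 - 1)
        - (\<Sum>j=2..n. of_nat (n choose j) * ((- 1) ^ (j - 1) / s ^ j) *
             (\<Sum>k=1..j-1. ((- 1) ^ k * eta k
                            + (1 - 1 / 2 ^ (k + 1)) * zeta (of_nat (k + 1))) * s ^ k))"

lemma xi_logderiv_eq: "xi_logderiv = L"
  by (simp add: fun_eq_iff xi_logderiv_def L_def riemann_xi_eq)

lemma has_sum_finite_sum:
  fixes f :: "'i \<Rightarrow> 'a \<Rightarrow> 'b::topological_comm_monoid_add"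
  assumes "\<And>j. j \<in> J \<Longrightarrow> (f j has_sum S j) A"
  shows "((\<lambda>x. \<Sum>j\<in>J. f j x) has_sum (\<Sum>j\<in>J. S j)) A"
proof -
  have "sum (\<lambda>x. \<Sum>j\<in>J. f j x) = (\<lambda>F. \<Sum>j\<in>J. sum (f j) F)"
    by (rule ext) (rule sum.swap)
  then show ?thesis using assms unfolding has_sum_def by (simp add: tendsto_sum)
qed

text \<open>Write 1 - (1 - 1/s)^n as a combination of powers s^(-j). Subtracting the inner sums replaces
L(s) s^(-j) by the series of 1/(rho^j (s - rho)), and the combination of 1/rho^j is again 1 - (1
- 1/rho)^n. The function 1/(s-1) that is subtracted along with L behaves like a zero at 1, with
weight 1 - (1 - 1)^n = 1; the initial summand 1/(s-1) compensates it.\<close>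

theorem Li_bracket_has_sum:
  assumes n: "n \<ge> 1" and X: "Xi s \<noteq> 0" and s: "s \<noteq> 0" "s \<noteq> 1"
  shows "((\<lambda>\<rho>. of_nat (xi_mult \<rho>) * (li_term n \<rho> / (s - \<rho>))) has_sum Li_bracket n s) Zeros"
proof -
  define w where "w j = of_nat (n choose j) * (- 1 :: complex) ^ (j - 1)" for j
  have "((\<lambda>\<rho>. \<Sum>j=1..n. w j * (of_nat (xi_mult \<rho>) * (1 / (\<rho> ^ j * (s - \<rho>))))) has_sum (\<Sum>j=1..n. w j * zeros_series j s)) Zeros"
  proof (rule has_sum_finite_sum)
    fix j assume "j \<in> {1..n}"
    then obtain i where i: "j = Suc i" by (cases j) auto
    show "((\<lambda>\<rho>. w j * (of_nat (xi_mult \<rho>) * (1 / (\<rho> ^ j * (s - \<rho>))))) has_sum w j * zeros_series j s) Zeros"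
      unfolding i by (intro has_sum_cmult_right zeros_series_has_sum X)
  qed
  moreover have "(\<Sum>j=1..n. w j * (of_nat (xi_mult \<rho>) * (1 / (\<rho> ^ j * (s - \<rho>))))) = of_nat (xi_mult \<rho>) * (li_term n \<rho> / (s - \<rho>))" for \<rho>
  proof -
    have "li_term n \<rho> = (\<Sum>j=1..n. w j * (1 / \<rho>) ^ j)"
      unfolding li_term_def w_def by (rule one_minus_power_binomial)
    then show ?thesis by (simp add: sum_distrib_left sum_divide_distrib power_one_over mult_ac)
  qed
  ultimately have S: "((\<lambda>\<rho>. of_nat (xi_mult \<rho>) * (li_term n \<rho> / (s - \<rho>))) has_sum (\<Sum>j=1..n. w j * zeros_series j s)) Zeros"
    by (simp only:)
  have "Li_bracket n s = (\<Sum>j=1..n. w j * zeros_series j s)"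
  proof -
    define l where "l = 1 / (s - 1)"
    have c1: "(\<Sum>j=1..n. w j) = 1"
      using one_minus_power_binomial[of 1 n] n by (simp add: w_def power_0_left)
    have zj: "zeros_series j s = (1 / s ^ j) * (L s - L 0 - (\<Sum>k=1..j-1. L_coeff k * s ^ k))" if jn: "j \<in> {1..n}" for j
    proof -
      obtain i where i: "j = Suc i" using jn by (cases j) auto
      have "(\<Sum>k<Suc i. L_coeff k * s ^ k) = L 0 + (\<Sum>k=1..i. L_coeff k * s ^ k)"
        by (simp add: lessThan_Suc_atMost atMost_atLeast0 sum.atLeast_Suc_atMost L_coeff_def)
      then show ?thesis using L_expansion_remainder[OF X, of i] s(1) unfolding i by (simp add: field_simps)
    qed
    have geo: "l + 1 + (\<Sum>k=1..j-1. s ^ k) = s ^ j * l" if jn: "j \<in> {1..n}" for j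
    proof -
      obtain i where i: "j = Suc i" using jn by (cases j) auto
      have "(\<Sum>k<Suc i. s ^ k) = 1 + (\<Sum>k=1..i. s ^ k)"
        by (simp add: lessThan_Suc_atMost atMost_atLeast0 sum.atLeast_Suc_atMost)
      moreover have "(\<Sum>k<Suc i. s ^ k) = (s ^ Suc i - 1) / (s - 1)" by (rule geometric_sum[OF s(2)])
      ultimately have "l + (1 + (\<Sum>k=1..i. s ^ k)) = l + (s ^ Suc i - 1) / (s - 1)" by simp
      also have "\<dots> = s ^ Suc i * l" by (simp add: l_def diff_divide_distrib)
      finally show ?thesis unfolding i by (simp add: add.assoc)
    qed
    have inner: "(\<Sum>k=1..j-1. ((- 1) ^ k * eta k + (1 - 1 / 2 ^ (k + 1)) * zeta (of_nat (k + 1))) * s ^ k) =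
       (\<Sum>k=1..j-1. L_coeff k * s ^ k) + (\<Sum>k=1..j-1. s ^ k)" for j
    proof -
      have "(\<Sum>k=1..j-1. ((- 1) ^ k * eta k + (1 - 1 / 2 ^ (k + 1)) * zeta (of_nat (k + 1))) * s ^ k) = (\<Sum>k=1..j-1. (L_coeff k + 1) * s ^ k)"
        by (rule sum.cong[OF refl]) (simp only: eta_eq atLeastAtMost_iff)
      then show ?thesis by (simp add: distrib_right sum.distrib)
    qed
    define A where "A j = (\<Sum>k=1..j-1. L_coeff k * s ^ k)" for j
    define B where "B j = (\<Sum>k=1..j-1. s ^ k)" for j
    have ext: "(\<Sum>j=2..n. w j * (1 / s ^ j) * (A j + B j)) = (\<Sum>j=1..n. w j * (1 / s ^ j) * (A j + B j))"
      using n by (subst sum.atLeast_Suc_atMost[of 1]) (auto simp: A_def B_def numeral_2_eq_2)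
    have "Li_bracket n s = l + (\<Sum>j=1..n. w j * (1 / s) ^ j) * (L s - l - L 0 - 1) - (\<Sum>j=2..n. w j * (1 / s ^ j) * (A j + B j))"
      unfolding Li_bracket_def xi_logderiv_eq inner one_minus_power_binomial A_def[symmetric] B_def[symmetric] l_def w_def
      by (simp add: mult.assoc)
    also have "\<dots> = l + (\<Sum>j=1..n. w j * (1 / s ^ j) * (L s - l - L 0 - 1)) - (\<Sum>j=1..n. w j * (1 / s ^ j) * (A j + B j))"
      unfolding ext by (simp add: sum_distrib_right power_one_over)
    also have "\<dots> = l + (\<Sum>j=1..n. w j * (1 / s ^ j) * (L s - l - L 0 - 1) - w j * (1 / s ^ j) * (A j + B j))"
      by (simp add: sum_subtractf)
    also have "(\<Sum>j=1..n. w j * (1 / s ^ j) * (L s - l - L 0 - 1) - w j * (1 / s ^ j) * (A j + B j)) =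
      (\<Sum>j=1..n. w j * zeros_series j s - w j * l)"
    proof (rule sum.cong[OF refl])
      fix j assume j: "j \<in> {1..n}"
      have "w j * (1 / s ^ j) * (L s - l - L 0 - 1) - w j * (1 / s ^ j) * (A j + B j) =
        w j * ((1 / s ^ j) * (L s - L 0 - A j)) - w j * ((1 / s ^ j) * (l + 1 + B j))"
        by (simp add: algebra_simps add_divide_distrib diff_divide_distrib)
      also have "(1 / s ^ j) * (L s - L 0 - A j) = zeros_series j s" unfolding A_def by (rule zj[OF j, symmetric])
      also have "(1 / s ^ j) * (l + 1 + B j) = l" unfolding B_def geo[OF j] using s(1) by simp
      finally show "w j * (1 / s ^ j) * (L s - l - L 0 - 1) - w j * (1 / s ^ j) * (A j + B j) = w j * zeros_series j s - w j * l" .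
    qed
    also have "l + \<dots> = l + ((\<Sum>j=1..n. w j * zeros_series j s) - (\<Sum>j=1..n. w j) * l)"
      by (simp add: sum_subtractf sum_distrib_right)
    also have "\<dots> = (\<Sum>j=1..n. w j * zeros_series j s)" unfolding c1 by simp
    finally show ?thesis .
  qed
  with S show ?thesis by simp
qed

section \<open>Cauchy's integral formula on a half plane\<close>

lemma integrable_inverse_one_plus_square: "integrable lborel (\<lambda>x::real. 1 / (1 + x\<^sup>2))"
proof (rule integrableI_nonneg)
  have half: "(\<integral>\<^sup>+x. ennreal (1 / (1 + x\<^sup>2)) * indicator {0..} x \<partial>lborel) = ennreal (pi / 2 - arctan 0)"
    by (rule nn_integral_FTC_atLeast)
       (auto intro!: derivative_eq_intros tendsto_arctan_at_top simp: add_nonneg_eq_0_iff field_simps)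
  have half': "(\<integral>\<^sup>+x. ennreal (1 / (1 + x\<^sup>2)) * indicator {..0} x \<partial>lborel) = ennreal (pi / 2 - arctan 0)"
  proof -
    have "(\<integral>\<^sup>+x. ennreal (1 / (1 + x\<^sup>2)) * indicator {..0} x \<partial>lborel) =
      (\<integral>\<^sup>+x. ennreal (1 / (1 + x\<^sup>2)) * indicator {0..} x \<partial>lborel)"
      by (subst nn_integral_real_affine[where c = "-1" and t = 0]) (auto simp: indicator_def intro!: nn_integral_cong)
    then show ?thesis using half by simp
  qed
  have "(\<integral>\<^sup>+x. ennreal (1 / (1 + x\<^sup>2)) \<partial>lborel) \<le>
      (\<integral>\<^sup>+x. ennreal (1 / (1 + x\<^sup>2)) * indicator {0..} x + ennreal (1 / (1 + x\<^sup>2)) * indicator {..0} x \<partial>lborel)"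
    by (rule nn_integral_mono) (auto simp: indicator_def)
  also have "\<dots> = ennreal (pi / 2 - arctan 0) + ennreal (pi / 2 - arctan 0)"
    by (subst nn_integral_add) (simp_all only: half half', measurable)
  finally show "(\<integral>\<^sup>+x. ennreal (1 / (1 + x\<^sup>2)) \<partial>lborel) < \<infinity>" by (auto simp: top_unique less_top intro: le_less_trans)
qed auto

lemma integrable_inverse_square_shift:
  fixes d c :: real
  assumes "d > 0"
  shows "integrable lborel (\<lambda>x. 1 / (d\<^sup>2 + (x - c)\<^sup>2))"
proof -
  have "integrable lborel (\<lambda>x. 1 / d\<^sup>2 * (1 / (1 + (- c / d + 1 / d * x)\<^sup>2)))"
    using assms by (intro integrable_mult_right lborel_integrable_real_affine[OF integrable_inverse_one_plus_square]) auto
  moreover have "1 / d\<^sup>2 * (1 / (1 + (- c / d + 1 / d * x)\<^sup>2)) = 1 / (d\<^sup>2 + (x - c)\<^sup>2)" for x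
  proof -
    have "- c / d + 1 / d * x = (x - c) / d" by (simp add: diff_divide_distrib)
    then have "d\<^sup>2 * (1 + (- c / d + 1 / d * x)\<^sup>2) = d\<^sup>2 + (x - c)\<^sup>2"
      using assms by (simp only: power_divide) (simp add: distrib_left)
    then show ?thesis by (metis divide_divide_eq_left mult_1_right times_divide_eq_right)
  qed
  ultimately show ?thesis by (simp only:)
qed

lemma norm_product_inverse_le:
  assumes "norm u \<le> A" "norm v \<le> B"
  shows "norm (u * v :: complex) \<le> (A\<^sup>2 + B\<^sup>2) / 2"
proof -
  have "0 \<le> A" using assms(1) norm_ge_zero order_trans by blast
  then have "norm (u * v) \<le> A * B" unfolding norm_mult using assms by (intro mult_mono) auto
  also have "\<dots> \<le> (A\<^sup>2 + B\<^sup>2) / 2" using sum_squares_bound[of A B] by simp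
  finally show ?thesis .
qed

text \<open>A vertical line traversed downwards, so that the abscissa 1/2 gives the points 1/2 - iz.\<close>

definition vline :: "real \<Rightarrow> real \<Rightarrow> complex" where
  "vline c z = Complex c (- z)"

lemma vline_kernel_bound:
  assumes "d > 0" "d \<le> \<bar>c - Re p\<bar>"
  shows "(norm (1 / (vline c z - p)))\<^sup>2 \<le> 1 / (d\<^sup>2 + (z - (- Im p))\<^sup>2)"
proof -
  have "(norm (vline c z - p))\<^sup>2 = (c - Re p)\<^sup>2 + (z + Im p)\<^sup>2"
    by (simp add: vline_def cmod_power2) (simp add: power2_eq_square algebra_simps)
  moreover have "d\<^sup>2 \<le> (c - Re p)\<^sup>2" using assms by (metis abs_ge_zero less_imp_le power2_abs power_mono)
  ultimately have "d\<^sup>2 + (z - (- Im p))\<^sup>2 \<le> (norm (vline c z - p))\<^sup>2" by simp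
  moreover have "d\<^sup>2 + (z - (- Im p))\<^sup>2 > 0" using assms by (intro add_pos_nonneg) auto
  ultimately show ?thesis by (simp add: norm_divide power_divide frac_le)
qed

lemma vline_kernel_product_bound:
  assumes d: "d > 0" "d \<le> \<bar>c - Re p\<bar>" "d \<le> \<bar>c - Re a\<bar>" and F: "norm F \<le> 1"
  shows "norm (F / ((vline c z - p) * (vline c z - a))) \<le>
    (1 / (d\<^sup>2 + (z - (- Im p))\<^sup>2) + 1 / (d\<^sup>2 + (z - (- Im a))\<^sup>2)) / 2"
proof -
  have "norm (F / ((vline c z - p) * (vline c z - a))) = norm F * norm (1 / (vline c z - p) * (1 / (vline c z - a)))"
    by (simp add: norm_divide norm_mult)
  also have "\<dots> \<le> 1 * norm (1 / (vline c z - p) * (1 / (vline c z - a)))" using F by (intro mult_right_mono) auto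
  also have "\<dots> \<le> ((norm (1 / (vline c z - p)))\<^sup>2 + (norm (1 / (vline c z - a)))\<^sup>2) / 2"
    using norm_product_inverse_le[of "1 / (vline c z - p)" _ "1 / (vline c z - a)"] by simp
  also have "\<dots> \<le> (1 / (d\<^sup>2 + (z - (- Im p))\<^sup>2) + 1 / (d\<^sup>2 + (z - (- Im a))\<^sup>2)) / 2"
    using vline_kernel_bound[of d c p z] vline_kernel_bound[of d c a z] d by simp
  finally show ?thesis .
qed

text \<open>Cauchy's formula for a rectangle whose left side lies on the line. The integrand is O(1/R^2) on
the other three sides, of total length 4R.\<close>

lemma half_plane_Cauchy:
  fixes F :: "complex \<Rightarrow> complex" and a p :: complex and b c :: real
  assumes F: "F holomorphic_on {s. Re s > b}" and F1: "\<And>s. Re s > b \<Longrightarrow> norm (F s) \<le> 1"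
    and c: "b < c" and a: "Re a > c" and p: "Re p \<le> b"
  shows "integrable lborel (\<lambda>z. F (vline c z) / ((vline c z - p) * (vline c z - a)))"
    and "(LINT z|lborel. F (vline c z) / ((vline c z - p) * (vline c z - a))) = - 2 * pi * F a / (a - p)"
proof -
  define g where "g s = F s / ((s - p) * (s - a))" for s
  define d where "d = min (c - Re p) (Re a - c)"
  have d: "d > 0" "d \<le> \<bar>c - Re p\<bar>" "d \<le> \<bar>c - Re a\<bar>" using c a p by (auto simp: d_def)
  have cont_v: "continuous_on UNIV (vline c)"
    unfolding vline_def[abs_def] Complex_eq by (intro continuous_intros)
  have ne: "vline c z - p \<noteq> 0" "vline c z - a \<noteq> 0" for z
    using c a p by (auto simp: vline_def complex_eq_iff)
  have cont_g: "continuous_on UNIV (\<lambda>z. g (vline c z))"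
  proof -
    have "continuous_on UNIV (\<lambda>z. F (vline c z))"
      by (rule continuous_on_compose2[OF holomorphic_on_imp_continuous_on[OF F] cont_v]) (use c in \<open>auto simp: vline_def\<close>)
    then show ?thesis unfolding g_def using ne by (intro continuous_intros cont_v) auto
  qed
  have meas: "(\<lambda>z. g (vline c z)) \<in> borel_measurable lborel"
    using borel_measurable_continuous_onI[OF cont_g] by simp
  have int: "integrable lborel (\<lambda>z. g (vline c z))"
  proof (rule Bochner_Integration.integrable_bound)
    show "integrable lborel (\<lambda>z. (1 / (d\<^sup>2 + (z - (- Im p))\<^sup>2) + 1 / (d\<^sup>2 + (z - (- Im a))\<^sup>2)) / 2)"
      by (intro Bochner_Integration.integrable_add integrable_divide integrable_inverse_square_shift d)
    show "AE z in lborel. norm (g (vline c z)) \<le> norm ((1 / (d\<^sup>2 + (z - (- Im p))\<^sup>2) + 1 / (d\<^sup>2 + (z - (- Im a))\<^sup>2)) / 2)"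
    proof (rule AE_I2)
      fix z :: real
      have "norm (g (vline c z)) \<le> (1 / (d\<^sup>2 + (z - (- Im p))\<^sup>2) + 1 / (d\<^sup>2 + (z - (- Im a))\<^sup>2)) / 2"
        unfolding g_def using c by (intro vline_kernel_product_bound d F1) (simp add: vline_def)
      also have "\<dots> \<le> norm \<dots>" by simp
      finally show "norm (g (vline c z)) \<le> norm ((1 / (d\<^sup>2 + (z - (- Im p))\<^sup>2) + 1 / (d\<^sup>2 + (z - (- Im a))\<^sup>2)) / 2)" .
    qed
  qed (rule meas)
  \<comment> \<open>On the three far sides of the rectangle of size R both s - p and s - a have modulus at
    least R - K.\<close>
  define K where "K = norm a + norm p + \<bar>c\<bar> + 1"
  have rect: "norm (2 * pi * \<i> * (F a / (a - p)) + \<i> * integral {- R..R} (\<lambda>z. g (vline c z))) \<le> 4 * R / (R - K)\<^sup>2"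
    if R: "R > 2 * K" for R
  proof -
    have K: "K \<ge> 1" by (simp add: K_def)
    have aK: "\<bar>Re a\<bar> \<le> norm a" "\<bar>Im a\<bar> \<le> norm a" "\<bar>Re p\<bar> \<le> norm p" "\<bar>Im p\<bar> \<le> norm p"
      by (auto intro: abs_Re_le_cmod abs_Im_le_cmod)
    define a1 where "a1 = Complex c (- R)"
    define a2 where "a2 = Complex (c + R) (- R)"
    define a3 where "a3 = Complex (c + R) R"
    define a4 where "a4 = Complex c R"
    have R0: "R > 0" using R K by simp
    have a_in: "a \<in> box a1 a3"
      using R aK a K by (auto simp: in_box_complex_iff a1_def a3_def K_def)
    have pim: "path_image (rectpath a1 a3) \<subseteq> {s. Re s > b} - {a}"
    proof
      fix x assume x: "x \<in> path_image (rectpath a1 a3)"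
      have "x \<in> cbox a1 a3"
        using path_image_rectpath_subset_cbox[of a1 a3] x R0 by (auto simp: a1_def a3_def)
      moreover have "x \<noteq> a" using path_image_rectpath_inter_box[of a1 a3] x a_in R0 by (auto simp: a1_def a3_def)
      ultimately show "x \<in> {s. Re s > b} - {a}" using c by (auto simp: in_cbox_complex_iff a1_def)
    qed
    have "((\<lambda>w. (F w / (w - p)) / (w - a)) has_contour_integral (2 * pi * \<i> * winding_number (rectpath a1 a3) a * (F a / (a - p)))) (rectpath a1 a3)"
    proof (rule Cauchy_integral_formula_convex_simple)
      show "convex {s. Re s > b}" by (rule convex_halfspace_Re_gt)
      show "(\<lambda>w. F w / (w - p)) holomorphic_on {s. Re s > b}"
        using p by (intro holomorphic_intros F) auto
      show "a \<in> interior {s. Re s > b}" using a c by (simp add: interior_open open_halfspace_Re_gt)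
    qed (use pim in auto)
    then have CI: "(g has_contour_integral (2 * pi * \<i> * (F a / (a - p)))) (rectpath a1 a3)"
      by (simp add: g_def[abs_def] winding_number_rectpath[OF a_in])
    have rp: "rectpath a1 a3 = linepath a1 a2 +++ linepath a2 a3 +++ linepath a3 a4 +++ linepath a4 a1"
      by (simp add: rectpath_def Let_def a1_def a2_def a3_def a4_def)
    have hol_g: "g holomorphic_on {s. Re s > b} - {a}"
      unfolding g_def[abs_def] using p by (intro holomorphic_intros holomorphic_on_subset[OF F]) auto
    have segs: "closed_segment a1 a2 \<subseteq> {s. Re s > b} - {a}" "closed_segment a2 a3 \<subseteq> {s. Re s > b} - {a}"
      "closed_segment a3 a4 \<subseteq> {s. Re s > b} - {a}" "closed_segment a4 a1 \<subseteq> {s. Re s > b} - {a}"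
      using pim unfolding rp by (auto simp: path_image_join)
    have ci: "g contour_integrable_on linepath u v" if "closed_segment u v \<subseteq> {s. Re s > b} - {a}" for u v
      by (intro contour_integrable_continuous_linepath holomorphic_on_imp_continuous_on holomorphic_on_subset[OF hol_g] that)
    have "2 * pi * \<i> * (F a / (a - p)) = contour_integral (rectpath a1 a3) g"
      using contour_integral_unique[OF CI] by simp
    also have "\<dots> = contour_integral (linepath a1 a2) g + (contour_integral (linepath a2 a3) g +
        (contour_integral (linepath a3 a4) g + contour_integral (linepath a4 a1) g))"
      unfolding rp using ci[OF segs(1)] ci[OF segs(2)] ci[OF segs(3)] ci[OF segs(4)]
      by (simp add: contour_integrable_join contour_integral_join)
    also have "contour_integral (linepath a4 a1) g = - contour_integral (linepath a1 a4) g"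
      by (intro contour_integral_reverse_linepath holomorphic_on_imp_continuous_on holomorphic_on_subset[OF hol_g] segs)
    also have "contour_integral (linepath a1 a4) g = \<i> * integral {- R..R} (\<lambda>x. g (Complex c x))"
      using R0 by (intro contour_integral_linepath_same_Re) (auto simp: a1_def a4_def)
    also have "integral {- R..R} (\<lambda>x. g (Complex c x)) = integral {- R..R} (\<lambda>z. g (vline c z))"
      using Henstock_Kurzweil_Integration.integral_reflect_real[of R "- R" "\<lambda>x. g (Complex c x)"] by (simp add: vline_def)
    finally have eq: "2 * pi * \<i> * (F a / (a - p)) + \<i> * integral {- R..R} (\<lambda>z. g (vline c z)) =
       contour_integral (linepath a1 a2) g + (contour_integral (linepath a2 a3) g + contour_integral (linepath a3 a4) g)"
      by (simp add: algebra_simps)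
    have gb: "norm (g s) \<le> 1 / (R - K)\<^sup>2" if s: "Re s \<ge> c" "\<bar>Im s\<bar> = R \<or> Re s = c + R" for s
    proof -
      have l: "R - K \<le> norm (s - q)" if "norm q + \<bar>c\<bar> + 1 \<le> K" for q
        using s(2)
      proof
        assume "\<bar>Im s\<bar> = R"
        then have "R - \<bar>Im q\<bar> \<le> \<bar>Im (s - q)\<bar>" by simp
        then show ?thesis using abs_Im_le_cmod[of "s - q"] abs_Im_le_cmod[of q] that by linarith
      next
        assume "Re s = c + R"
        then have "R - \<bar>c\<bar> - \<bar>Re q\<bar> \<le> \<bar>Re (s - q)\<bar>" by simp
        then show ?thesis using abs_Re_le_cmod[of "s - q"] abs_Re_le_cmod[of q] that by linarith
      qed
      have l1: "R - K \<le> norm (s - p)" "R - K \<le> norm (s - a)" by (rule l, simp add: K_def)+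
      have RK: "R - K > 0" using R K by simp
      have "norm (g s) = norm (F s) / (norm (s - p) * norm (s - a))" by (simp add: g_def norm_divide norm_mult)
      also have "\<dots> \<le> 1 / ((R - K) * (R - K))"
        using F1[of s] s c l1 RK by (intro frac_le mult_mono mult_pos_pos) auto
      finally show ?thesis by (simp add: power2_eq_square)
    qed
    have B0: "0 \<le> 1 / (R - K)\<^sup>2" by simp
    have n1: "norm (contour_integral (linepath a1 a2) g) \<le> 1 / (R - K)\<^sup>2 * norm (a2 - a1)"
    proof (rule contour_integral_bound_linepath[OF ci[OF segs(1)] B0])
      fix x assume "x \<in> closed_segment a1 a2"
      then show "norm (g x) \<le> 1 / (R - K)\<^sup>2" using R0
        by (intro gb) (auto simp: closed_segment_same_Im closed_segment_eq_real_ivl a1_def a2_def)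
    qed
    have n2: "norm (contour_integral (linepath a2 a3) g) \<le> 1 / (R - K)\<^sup>2 * norm (a3 - a2)"
    proof (rule contour_integral_bound_linepath[OF ci[OF segs(2)] B0])
      fix x assume "x \<in> closed_segment a2 a3"
      then show "norm (g x) \<le> 1 / (R - K)\<^sup>2" using R0
        by (intro gb) (auto simp: closed_segment_same_Re closed_segment_eq_real_ivl a3_def a2_def)
    qed
    have n3: "norm (contour_integral (linepath a3 a4) g) \<le> 1 / (R - K)\<^sup>2 * norm (a4 - a3)"
    proof (rule contour_integral_bound_linepath[OF ci[OF segs(3)] B0])
      fix x assume "x \<in> closed_segment a3 a4"
      then show "norm (g x) \<le> 1 / (R - K)\<^sup>2" using R0
        by (intro gb) (auto simp: closed_segment_same_Im closed_segment_eq_real_ivl a3_def a4_def split: if_splits)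
    qed
    have len: "norm (a2 - a1) = R" "norm (a3 - a2) = 2 * R" "norm (a4 - a3) = R"
      using R0 by (auto simp: a1_def a2_def a3_def a4_def cmod_def real_sqrt_mult)
    have "norm (contour_integral (linepath a1 a2) g + (contour_integral (linepath a2 a3) g + contour_integral (linepath a3 a4) g))
       \<le> norm (contour_integral (linepath a1 a2) g) + (norm (contour_integral (linepath a2 a3) g) + norm (contour_integral (linepath a3 a4) g))"
      by (rule order_trans[OF norm_triangle_ineq add_left_mono[OF norm_triangle_ineq]])
    also have "\<dots> \<le> 1 / (R - K)\<^sup>2 * R + (1 / (R - K)\<^sup>2 * (2 * R) + 1 / (R - K)\<^sup>2 * R)"
      using n1 n2 n3 unfolding len by (intro add_mono)
    also have "\<dots> = 4 * R / (R - K)\<^sup>2" by (simp add: add_divide_distrib[symmetric])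
    finally show ?thesis unfolding eq .
  qed
  have lim1: "(\<lambda>n. integral {- real n..real n} (\<lambda>z. g (vline c z))) \<longlonglongrightarrow> (LINT z|lborel. g (vline c z))"
  proof -
    have "(\<lambda>n. LINT z|lborel. indicator {- real n..real n} z *\<^sub>R g (vline c z)) \<longlonglongrightarrow> (LINT z|lborel. g (vline c z))"
    proof (rule integral_dominated_convergence[where w = "\<lambda>z. norm (g (vline c z))"])
      show "AE z in lborel. (\<lambda>n. indicator {- real n..real n} z *\<^sub>R g (vline c z)) \<longlonglongrightarrow> g (vline c z)"
      proof (rule AE_I2)
        fix z :: real
        have "\<forall>\<^sub>F n in sequentially. real n \<ge> \<bar>z\<bar>" by real_asymp
        then have "\<forall>\<^sub>F n in sequentially. indicator {- real n..real n} z *\<^sub>R g (vline c z) = g (vline c z)"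
          by eventually_elim (auto simp: indicator_def)
        then show "(\<lambda>n. indicator {- real n..real n} z *\<^sub>R g (vline c z)) \<longlonglongrightarrow> g (vline c z)"
          by (rule tendsto_eventually)
      qed
      show "\<And>n. (\<lambda>z. indicator {- real n..real n} z *\<^sub>R g (vline c z)) \<in> borel_measurable lborel"
        using meas by measurable
    qed (use int meas in \<open>auto simp: indicator_def\<close>)
    moreover have "(LINT z|lborel. indicator {- real n..real n} z *\<^sub>R g (vline c z)) = integral {- real n..real n} (\<lambda>z. g (vline c z))" for n
    proof -
      have "set_integrable lborel {- real n..real n} (\<lambda>z. g (vline c z))"
        unfolding set_integrable_def by (intro integrable_mult_indicator int) auto
      from set_borel_integral_eq_integral(2)[OF this] show ?thesis by (simp add: set_lebesgue_integral_def)
    qed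
    ultimately show ?thesis by simp
  qed
  have "(\<lambda>n. 2 * pi * \<i> * (F a / (a - p)) + \<i> * integral {- real n..real n} (\<lambda>z. g (vline c z))) \<longlonglongrightarrow> 0"
  proof (rule tendsto_norm_zero_cancel, rule tendsto_sandwich[OF _ _ tendsto_const])
    show "(\<lambda>n. 4 * real n / (real n - K)\<^sup>2) \<longlonglongrightarrow> 0" by real_asymp
    have "\<forall>\<^sub>F n in sequentially. real n > 2 * K" by real_asymp
    then show "\<forall>\<^sub>F n in sequentially. norm (2 * pi * \<i> * (F a / (a - p)) + \<i> * integral {- real n..real n} (\<lambda>z. g (vline c z)))
        \<le> 4 * real n / (real n - K)\<^sup>2"
      by eventually_elim (rule rect)
  qed auto
  moreover have "(\<lambda>n. 2 * pi * \<i> * (F a / (a - p)) + \<i> * integral {- real n..real n} (\<lambda>z. g (vline c z)))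
     \<longlonglongrightarrow> 2 * pi * \<i> * (F a / (a - p)) + \<i> * (LINT z|lborel. g (vline c z))"
    by (intro tendsto_intros lim1)
  ultimately have "2 * pi * \<i> * (F a / (a - p)) + \<i> * (LINT z|lborel. g (vline c z)) = 0"
    by (rule LIMSEQ_unique[symmetric])
  then have "\<i> * (2 * pi * (F a / (a - p)) + (LINT z|lborel. g (vline c z))) = 0"
    by (simp add: algebra_simps)
  then have "2 * pi * (F a / (a - p)) + (LINT z|lborel. g (vline c z)) = 0" by simp
  then have "(LINT z|lborel. g (vline c z)) = - (2 * pi * (F a / (a - p)))" by (simp add: eq_neg_iff_add_eq_0 add.commute)
  then show "(LINT z|lborel. F (vline c z) / ((vline c z - p) * (vline c z - a))) = - 2 * pi * F a / (a - p)"
    unfolding g_def by simp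
  show "integrable lborel (\<lambda>z. F (vline c z) / ((vline c z - p) * (vline c z - a)))"
    using int unfolding g_def .
qed

section \<open>An orthogonal system indexed by the zeros\<close>

text \<open>Under the Riemann hypothesis (xi - xi')/(xi + xi') is an inner function of the half plane Re s >
1/2; this is half of 1 plus that function.\<close>

definition D :: "complex \<Rightarrow> complex" where
  "D s = Xi s / (Xi s + deriv Xi s)"

lemma D_eq: "Xi s \<noteq> 0 \<Longrightarrow> D s = 1 / (1 + L s)"
  by (simp add: D_def L_def divide_simps)

lemma D_zero: "\<rho> \<in> Zeros \<Longrightarrow> D \<rho> = 0"
  by (simp add: D_def Zeros_def)

lemma D_derivative_at_zero:
  assumes "\<rho> \<in> Zeros"
  shows "((\<lambda>s. D s / (s - \<rho>)) \<longlongrightarrow> 1 / of_nat (xi_mult \<rho>)) (at \<rho>)"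
proof (rule Lim_transform_eventually)
  have "((\<lambda>s. 1 / ((s - \<rho>) + (s - \<rho>) * L s)) \<longlongrightarrow> 1 / ((\<rho> - \<rho>) + of_nat (xi_mult \<rho>))) (at \<rho>)"
    using xi_mult_pos[OF assms] by (intro tendsto_intros residue_L assms) auto
  then show "((\<lambda>s. 1 / ((s - \<rho>) + (s - \<rho>) * L s)) \<longlongrightarrow> 1 / of_nat (xi_mult \<rho>)) (at \<rho>)" by simp
  show "\<forall>\<^sub>F s in at \<rho>. 1 / ((s - \<rho>) + (s - \<rho>) * L s) = D s / (s - \<rho>)"
    using Xi_frequently_nonzero[of \<rho>]
  proof eventually_elim
    case (elim s)
    have "(s - \<rho>) + (s - \<rho>) * L s = (s - \<rho>) * (1 + L s)" by (simp add: distrib_left)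
    then show ?case by (simp add: D_eq[OF elim] mult.commute)
  qed
qed

lemma D_right_of_zero:
  assumes "\<rho> \<in> Zeros" "e \<longlonglongrightarrow> 0" "\<And>n. e n > (0::real)"
  shows "(\<lambda>n. D (\<rho> + of_real (e n)) / of_real (e n)) \<longlonglongrightarrow> 1 / of_nat (xi_mult \<rho>)"
    and "(\<lambda>n. D (\<rho> + of_real (e n))) \<longlonglongrightarrow> 0"
proof -
  have ne: "complex_of_real (e n) \<noteq> 0" for n using assms(3)[of n] by simp
  have "(\<lambda>n. \<rho> + of_real (e n)) \<longlonglongrightarrow> \<rho> + of_real 0" by (intro tendsto_intros assms)
  then have "filterlim (\<lambda>n. \<rho> + of_real (e n)) (at \<rho>) sequentially" using ne by (simp add: filterlim_at)
  with D_derivative_at_zero[OF assms(1)]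
  have "(\<lambda>n. D (\<rho> + of_real (e n)) / (\<rho> + of_real (e n) - \<rho>)) \<longlonglongrightarrow> 1 / of_nat (xi_mult \<rho>)"
    by (rule filterlim_compose)
  then show A: "(\<lambda>n. D (\<rho> + of_real (e n)) / of_real (e n)) \<longlonglongrightarrow> 1 / of_nat (xi_mult \<rho>)" by simp
  have "(\<lambda>n. D (\<rho> + of_real (e n)) / of_real (e n) * of_real (e n)) \<longlonglongrightarrow> 1 / of_nat (xi_mult \<rho>) * of_real 0"
    by (intro tendsto_mult A tendsto_of_real assms)
  then show "(\<lambda>n. D (\<rho> + of_real (e n))) \<longlonglongrightarrow> 0" using ne by simp
qed

lemma countable_Zeros: "countable Zeros"
proof -
  have "Zeros \<subseteq> (\<Union>N. Zeros_upto N)"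
  proof
    fix \<rho> assume "\<rho> \<in> Zeros"
    then have "\<forall>\<^sub>F N in sequentially. finite (Zeros_upto N) \<and> {\<rho>} \<subseteq> Zeros_upto N \<and> Zeros_upto N \<subseteq> Zeros"
      using filterlim_Zeros_upto unfolding filterlim_finite_subsets_at_top by blast
    then show "\<rho> \<in> (\<Union>N. Zeros_upto N)" by (auto simp: eventually_sequentially)
  qed
  then show ?thesis by (rule countable_subset) (auto intro: countable_finite finite_Zeros_upto)
qed

lemma countable_line_zeros: "countable {z. Xi (vline c z) = 0}"
proof -
  have "{z. Xi (vline c z) = 0} \<subseteq> (\<lambda>\<rho>. - Im \<rho>) ` Zeros"
    by (force simp: Zeros_def vline_def image_iff intro: exI[of _ "vline c _"])
  then show ?thesis by (rule countable_subset) (intro countable_image countable_Zeros)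
qed

lemma AE_line_nonzero: "AE z in lborel. Xi (vline c z) \<noteq> 0"
  by (rule AE_I'[OF countable_imp_null_set_lborel[OF countable_line_zeros[of c]]]) auto

lemma continuous_Xi: "continuous_on A Xi" "continuous_on A (deriv Xi)"
  by (intro holomorphic_on_imp_continuous_on holomorphic_Xi holomorphic_on_subset[OF holomorphic_deriv[OF holomorphic_Xi open_UNIV]]; simp)+

lemma continuous_vline: "continuous_on A (vline c)"
  unfolding vline_def[abs_def] Complex_eq by (intro continuous_intros)

lemma measurable_vline [measurable]: "vline c \<in> borel_measurable borel"
  by (rule borel_measurable_continuous_onI[OF continuous_vline])

lemma measurable_cnj [measurable]: "cnj \<in> borel_measurable borel"
  by (intro borel_measurable_continuous_onI continuous_intros)

lemma measurable_Xi [measurable]: "Xi \<in> borel_measurable borel" "deriv Xi \<in> borel_measurable borel"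
  by (intro borel_measurable_continuous_onI continuous_Xi)+

lemma measurable_D [measurable]: "D \<in> borel_measurable borel"
  unfolding D_def[abs_def] by measurable

lemma measurable_L [measurable]: "L \<in> borel_measurable borel"
  unfolding L_def[abs_def] by measurable

abbreviation "crit \<equiv> vline (1 / 2)"

text \<open>Moving the pole to the left of the line by e keeps all integrals absolutely convergent; the
modulus increases to that of the unshifted function as e tends to 0.\<close>

definition shifted :: "real \<Rightarrow> complex \<Rightarrow> real \<Rightarrow> complex" where
  "shifted e \<rho> z = D (crit z) / (crit z - \<rho> + of_real e)"

lemma measurable_shifted [measurable]: "shifted e \<rho> \<in> borel_measurable borel"
  unfolding shifted_def[abs_def] by measurable

text \<open>The functions D(s)/(s - rho) turn out to be orthogonal in L^2 of the critical line.\<close>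

definition mode :: "complex \<Rightarrow> real \<Rightarrow> complex" where
  "mode \<rho> z = D (crit z) / (crit z - \<rho>)"

lemma measurable_mode [measurable]: "mode \<rho> \<in> borel_measurable borel"
  unfolding mode_def[abs_def] by measurable

definition combination :: "(complex \<Rightarrow> complex) \<Rightarrow> complex set \<Rightarrow> real \<Rightarrow> complex" where
  "combination v F z = (\<Sum>\<rho>\<in>F. of_nat (xi_mult \<rho>) * v \<rho> * mode \<rho> z)"

lemma measurable_combination [measurable]: "combination v F \<in> borel_measurable borel"
  unfolding combination_def[abs_def] by measurable

context
  assumes on_line: "\<And>\<rho>. \<rho> \<in> Zeros \<Longrightarrow> Re \<rho> = 1 / 2"
begin

lemma zero_sum_Re:
  assumes "Re s \<ge> 1 / 2"
  shows "Re (zero_sum N s) \<ge> 0" "Re s = 1 / 2 \<Longrightarrow> Re (zero_sum N s) = 0"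
proof -
  have *: "Re (of_nat (xi_mult \<rho>) / (s - \<rho>)) = real (xi_mult \<rho>) * (Re s - 1 / 2) / (norm (s - \<rho>))\<^sup>2"
    if "\<rho> \<in> Zeros_upto N" for \<rho>
    using on_line[of \<rho>] that Zeros_upto_subset by (auto simp: Re_divide cmod_power2)
  have "Re (zero_sum N s) = (\<Sum>\<rho>\<in>Zeros_upto N. real (xi_mult \<rho>) * (Re s - 1 / 2) / (norm (s - \<rho>))\<^sup>2)"
    unfolding zero_sum_def Re_sum by (rule sum.cong[OF refl *])
  note eq = this
  show "Re (zero_sum N s) \<ge> 0" unfolding eq using assms by (auto intro!: sum_nonneg)
  assume "Re s = 1 / 2"
  then have "Re s - 1 / 2 = 0" by simp
  then show "Re (zero_sum N s) = 0" unfolding eq by (simp only: mult_zero_right div_0 sum.neutral_const)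
qed

lemma Re_L_nonneg:
  assumes "Re s \<ge> 1 / 2" "Xi s \<noteq> 0"
  shows "Re (L s) \<ge> 0"
  using tendsto_Re[OF L_partial_fractions[OF assms(2)]]
  by (rule tendsto_lowerbound) (auto intro!: always_eventually zero_sum_Re assms)

lemma Re_L_line:
  assumes "Re s = 1 / 2" "Xi s \<noteq> 0"
  shows "Re (L s) = 0"
proof -
  have "(\<lambda>N. 0) \<longlonglongrightarrow> Re (L s)"
    using tendsto_Re[OF L_partial_fractions[OF assms(2)]] zero_sum_Re(2)[of s] assms by simp
  then show ?thesis by (simp add: LIMSEQ_const_iff)
qed

lemma D_denominator:
  assumes "Re s \<ge> 1 / 2" "Xi s \<noteq> 0"
  shows "1 + L s \<noteq> 0" "Xi s + deriv Xi s \<noteq> 0" "norm (D s) \<le> 1"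
proof -
  have "Re (1 + L s) \<ge> 1" using Re_L_nonneg[OF assms] by simp
  then have n: "norm (1 + L s) \<ge> 1" using complex_Re_le_cmod[of "1 + L s"] by linarith
  then show 1: "1 + L s \<noteq> 0" by auto
  have "Xi s + deriv Xi s = Xi s * (1 + L s)" using assms by (simp add: L_def field_simps)
  then show "Xi s + deriv Xi s \<noteq> 0" using 1 assms by simp
  show "norm (D s) \<le> 1" using n by (simp add: D_eq assms norm_divide divide_le_eq)
qed

lemma Xi_right_nonzero: "Re s > 1 / 2 \<Longrightarrow> Xi s \<noteq> 0"
  using on_line[of s] by (auto simp: Zeros_def)

lemma holomorphic_D: "D holomorphic_on {s. Re s > 1 / 2}"
  unfolding D_def[abs_def]
  by (intro holomorphic_intros holomorphic_Xi holomorphic_on_subset[OF holomorphic_deriv[OF holomorphic_Xi open_UNIV]])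
     (use D_denominator(2) Xi_right_nonzero in auto)

lemma D_norm_le: "Re s \<ge> 1 / 2 \<Longrightarrow> norm (D s) \<le> 1"
  using D_denominator(3)[of s] by (cases "Xi s = 0") (auto simp: D_def)

text \<open>On the critical line L is imaginary, and D = 1/(1 + L), so that Re D = |D|^2.\<close>

lemma D_line:
  assumes "Re s = 1 / 2"
  shows "D s + cnj (D s) = 2 * (D s * cnj (D s))"
proof (cases "Xi s = 0")
  case False
  have n: "1 + L s \<noteq> 0" using D_denominator(1)[OF _ False] assms by simp
  then have n': "1 + cnj (L s) \<noteq> 0" by (metis complex_cnj_add complex_cnj_one complex_cnj_zero_iff)
  have "L s + cnj (L s) = 0" using Re_L_line[OF assms False] by (simp add: complex_eq_iff)
  then have c: "cnj (L s) = - L s" by (simp add: eq_neg_iff_add_eq_0 add.commute)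
  show ?thesis using n n' unfolding D_eq[OF False] by (simp add: c divide_simps)
qed (simp add: D_def)

lemma cnj_crit: "cnj (crit z) = 1 - crit z"
  by (simp add: vline_def complex_eq_iff)

lemma cnj_zero: "\<rho> \<in> Zeros \<Longrightarrow> cnj \<rho> = 1 - \<rho>"
  using on_line[of \<rho>] by (simp add: complex_eq_iff)

text \<open>On the critical line the conjugate of s - rho' + e is -(s - rho' - e), which extends
holomorphically and has its zero in the right half plane. Cauchy's formula holds on the lines to
the right of the critical line, where D is bounded by 1, and dominated convergence carries it
over to the boundary.\<close>

lemma D_kernel_integral:
  assumes e: "e > 0" and r: "\<rho> \<in> Zeros" "\<rho>' \<in> Zeros"
  shows "integrable lborel (\<lambda>z. D (crit z) / ((crit z - \<rho> + of_real e) * cnj (crit z - \<rho>' + of_real e)))"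
    and "(LINT z|lborel. D (crit z) / ((crit z - \<rho> + of_real e) * cnj (crit z - \<rho>' + of_real e))) =
      2 * pi * D (\<rho>' + of_real e) / (\<rho>' - \<rho> + 2 * of_real e)"
proof -
  define p where "p = \<rho> - of_real e"
  define a where "a = \<rho>' + of_real e"
  have Rp: "Re p = 1 / 2 - e" and Ra: "Re a = 1 / 2 + e" using r by (simp_all add: p_def a_def on_line)
  \<comment> \<open>Lines that approach the critical line and stay at distance at least e/2 from both poles.\<close>
  define c where "c n = 1 / 2 + e / (2 * real (Suc n))" for n
  have c1: "c n > 1 / 2" "c n \<le> 1 / 2 + e / 2" for n
  proof -
    show "c n > 1 / 2" using e by (simp add: c_def)
    have "e / (2 * real (Suc n)) \<le> e / 2" using e by (intro divide_left_mono) auto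
    then show "c n \<le> 1 / 2 + e / 2" by (simp add: c_def)
  qed
  have c_lim: "c \<longlonglongrightarrow> 1 / 2" unfolding c_def[abs_def] by real_asymp
  define s where "s n z = D (vline (c n) z) / ((vline (c n) z - p) * (vline (c n) z - a))" for n z
  define f where "f z = D (crit z) / ((crit z - p) * (crit z - a))" for z
  define w where "w z = (1 / ((e / 2)\<^sup>2 + (z - (- Im p))\<^sup>2) + 1 / ((e / 2)\<^sup>2 + (z - (- Im a))\<^sup>2)) / 2" for z
  have w_int: "integrable lborel w"
    unfolding w_def using e by (intro Bochner_Integration.integrable_add integrable_divide integrable_inverse_square_shift) auto
  have s_int: "(LINT z|lborel. s n z) = - 2 * pi * D a / (a - p)" for n
    unfolding s_def
    by (rule half_plane_Cauchy(2)[OF holomorphic_D]) (use D_norm_le c1[of n] Rp Ra e in auto)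
  have s_meas: "s n \<in> borel_measurable lborel" for n unfolding s_def[abs_def] by measurable
  have f_meas: "f \<in> borel_measurable lborel" unfolding f_def[abs_def] by measurable
  have s_lim: "AE z in lborel. (\<lambda>n. s n z) \<longlonglongrightarrow> f z"
    using AE_line_nonzero[of "1 / 2"]
  proof eventually_elim
    case (elim z)
    have v: "(\<lambda>n. vline (c n) z) \<longlonglongrightarrow> crit z"
      unfolding vline_def Complex_eq by (intro tendsto_intros c_lim)
    have ne: "crit z - p \<noteq> 0" "crit z - a \<noteq> 0" using Rp Ra e by (auto simp: vline_def complex_eq_iff)
    have X: "(\<lambda>n. Xi (vline (c n) z)) \<longlonglongrightarrow> Xi (crit z)" "(\<lambda>n. deriv Xi (vline (c n) z)) \<longlonglongrightarrow> deriv Xi (crit z)"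
      using continuous_Xi[of UNIV] v by (auto simp: continuous_on_eq_continuous_at intro: isCont_tendsto_compose)
    have "Xi (crit z) + deriv Xi (crit z) \<noteq> 0"
      by (rule D_denominator(2)) (use elim in \<open>auto simp: vline_def\<close>)
    then show ?case unfolding s_def f_def D_def using ne by (intro tendsto_intros X v) auto
  qed
  have s_bound: "AE z in lborel. norm (s n z) \<le> w z" for n
  proof (rule AE_I2)
    fix z
    show "norm (s n z) \<le> w z"
      unfolding s_def w_def
      by (rule vline_kernel_product_bound) (use e c1[of n] Rp Ra D_norm_le in \<open>auto simp: vline_def\<close>)
  qed
  have int_f: "integrable lborel f"
    by (rule integrable_dominated_convergence[OF f_meas s_meas w_int s_lim s_bound])
  have "(\<lambda>n. LINT z|lborel. s n z) \<longlonglongrightarrow> (LINT z|lborel. f z)"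
    by (rule integral_dominated_convergence[OF f_meas s_meas w_int s_lim s_bound])
  then have val: "(LINT z|lborel. f z) = - 2 * pi * D a / (a - p)"
    unfolding s_int by (simp add: LIMSEQ_const_iff)
  have eq: "D (crit z) / ((crit z - \<rho> + of_real e) * cnj (crit z - \<rho>' + of_real e)) = - f z" for z
  proof -
    have "cnj (crit z - \<rho>' + of_real e) = - (crit z - a)" by (simp add: cnj_crit cnj_zero r a_def)
    moreover have "crit z - \<rho> + of_real e = crit z - p" by (simp add: p_def)
    ultimately show ?thesis unfolding f_def by (simp only: mult_minus_right divide_minus_right)
  qed
  show "integrable lborel (\<lambda>z. D (crit z) / ((crit z - \<rho> + of_real e) * cnj (crit z - \<rho>' + of_real e)))"
    unfolding eq using int_f by simp
  have "a - p = \<rho>' - \<rho> + 2 * of_real e" by (simp add: a_def p_def)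
  then show "(LINT z|lborel. D (crit z) / ((crit z - \<rho> + of_real e) * cnj (crit z - \<rho>' + of_real e))) =
      2 * pi * D (\<rho>' + of_real e) / (\<rho>' - \<rho> + 2 * of_real e)"
    unfolding eq using val by (simp add: a_def)
qed

text \<open>Here |D|^2 is replaced by Re D, which makes the inner product a sum of two boundary integrals of
holomorphic functions.\<close>

lemma shifted_inner:
  assumes e: "e > 0" and r: "\<rho> \<in> Zeros" "\<rho>' \<in> Zeros"
  shows "integrable lborel (\<lambda>z. shifted e \<rho> z * cnj (shifted e \<rho>' z))"
    and "(LINT z|lborel. shifted e \<rho> z * cnj (shifted e \<rho>' z)) =
      pi * (D (\<rho>' + of_real e) + cnj (D (\<rho> + of_real e))) / (\<rho>' - \<rho> + 2 * of_real e)"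
proof -
  define f1 where "f1 z = D (crit z) / ((crit z - \<rho> + of_real e) * cnj (crit z - \<rho>' + of_real e))" for z
  define f2 where "f2 z = D (crit z) / ((crit z - \<rho>' + of_real e) * cnj (crit z - \<rho> + of_real e))" for z
  have eq: "shifted e \<rho> z * cnj (shifted e \<rho>' z) = (f1 z + cnj (f2 z)) / 2" for z
  proof -
    have "D (crit z) + cnj (D (crit z)) = 2 * (D (crit z) * cnj (D (crit z)))"
      by (rule D_line) (simp add: vline_def)
    then have "D (crit z) * cnj (D (crit z)) = (D (crit z) + cnj (D (crit z))) / 2" by simp
    moreover have "shifted e \<rho> z * cnj (shifted e \<rho>' z) = (D (crit z) * cnj (D (crit z))) / ((crit z - \<rho> + of_real e) * cnj (crit z - \<rho>' + of_real e))"
      by (simp add: shifted_def)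
    ultimately have "shifted e \<rho> z * cnj (shifted e \<rho>' z) = (D (crit z) + cnj (D (crit z))) / 2 / ((crit z - \<rho> + of_real e) * cnj (crit z - \<rho>' + of_real e))"
      by (simp only:)
    also have "\<dots> = (f1 z + cnj (f2 z)) / 2"
      by (simp add: f1_def f2_def add_divide_distrib mult.commute)
    finally show ?thesis .
  qed
  have i1: "integrable lborel f1" and v1: "(LINT z|lborel. f1 z) = 2 * pi * D (\<rho>' + of_real e) / (\<rho>' - \<rho> + 2 * of_real e)"
    unfolding f1_def by (rule D_kernel_integral[OF e r])+
  have i2: "integrable lborel f2" and v2: "(LINT z|lborel. f2 z) = 2 * pi * D (\<rho> + of_real e) / (\<rho> - \<rho>' + 2 * of_real e)"
    unfolding f2_def by (rule D_kernel_integral[OF e r(2) r(1)])+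
  have i2': "integrable lborel (\<lambda>z. cnj (f2 z))" using i2 by simp
  show "integrable lborel (\<lambda>z. shifted e \<rho> z * cnj (shifted e \<rho>' z))"
    unfolding eq by (intro integrable_divide Bochner_Integration.integrable_add i1 i2')
  have "(LINT z|lborel. shifted e \<rho> z * cnj (shifted e \<rho>' z)) = ((LINT z|lborel. f1 z) + cnj (LINT z|lborel. f2 z)) / 2"
    unfolding eq by (simp add: Bochner_Integration.integral_add[OF i1 i2'])
  also have "cnj (LINT z|lborel. f2 z) = 2 * pi * cnj (D (\<rho> + of_real e)) / (\<rho>' - \<rho> + 2 * of_real e)"
    unfolding v2 by (simp add: cnj_zero r)
  also have "((LINT z|lborel. f1 z) + 2 * pi * cnj (D (\<rho> + of_real e)) / (\<rho>' - \<rho> + 2 * of_real e)) / 2 =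
      pi * (D (\<rho>' + of_real e) + cnj (D (\<rho> + of_real e))) / (\<rho>' - \<rho> + 2 * of_real e)"
  proof -
    have *: "(2 * p * a / X + 2 * p * b / X) / 2 = p * (a + b) / X" for p a b X :: complex
      by (simp add: add_divide_distrib distrib_left)
    show ?thesis unfolding v1 of_real_mult of_real_numeral by (rule *)
  qed
  finally show "(LINT z|lborel. shifted e \<rho> z * cnj (shifted e \<rho>' z)) =
      pi * (D (\<rho>' + of_real e) + cnj (D (\<rho> + of_real e))) / (\<rho>' - \<rho> + 2 * of_real e)" .
qed

lemma shifted_norm_mono:
  assumes "\<rho> \<in> Zeros" "0 \<le> e" "e \<le> e'"
  shows "norm (shifted e' \<rho> z) \<le> norm (shifted e \<rho> z)"
proof (cases "crit z - \<rho> + of_real e = 0")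
  case False
  have "Re (crit z - \<rho>) = 0" using on_line[OF assms(1)] by (simp add: vline_def)
  then have "norm (crit z - \<rho> + of_real e) \<le> norm (crit z - \<rho> + of_real e')"
    using assms by (auto simp: cmod_def intro!: power_mono)
  then show ?thesis unfolding shifted_def norm_divide using False by (intro frac_le) auto
next
  case True
  have "Re (crit z - \<rho>) = 0" using on_line[OF assms(1)] by (simp add: vline_def)
  then have "e = 0" "crit z = \<rho>" using True by (auto simp: complex_eq_iff)
  then have "D (crit z) = 0" using D_zero[OF assms(1)] by simp
  then show ?thesis by (simp add: shifted_def)
qed

lemma shifted_tendsto:
  assumes "e \<longlonglongrightarrow> 0" "Xi (crit z) \<noteq> 0" "\<rho> \<in> Zeros"
  shows "(\<lambda>n. shifted (e n) \<rho> z) \<longlonglongrightarrow> mode \<rho> z"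
proof -
  have "crit z \<noteq> \<rho>" using assms by (auto simp: Zeros_def)
  then have "(\<lambda>n. shifted (e n) \<rho> z) \<longlonglongrightarrow> D (crit z) / (crit z - \<rho> + of_real 0)"
    unfolding shifted_def by (intro tendsto_intros assms) auto
  then show ?thesis by (simp add: mode_def)
qed

text \<open>For rho = rho' the shifted inner product is pi Re D(rho + e) / e, and D(rho + e) / e tends to
1/m. The integrands increase as e decreases.\<close>

lemma mode_norm:
  assumes r: "\<rho> \<in> Zeros"
  shows "integrable lborel (\<lambda>z. (norm (mode \<rho> z))\<^sup>2)"
    and "(LINT z|lborel. (norm (mode \<rho> z))\<^sup>2) = pi / real (xi_mult \<rho>)"
proof -
  define e where "e n = 1 / real (Suc n)" for n
  have e0: "e n > 0" for n by (simp add: e_def)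
  have e_lim: "e \<longlonglongrightarrow> 0" unfolding e_def[abs_def] by real_asymp
  define f where "f n z = (norm (shifted (e n) \<rho> z))\<^sup>2" for n z
  have f_c: "complex_of_real (f n z) = shifted (e n) \<rho> z * cnj (shifted (e n) \<rho> z)" for n z
    by (simp only: f_def complex_norm_square)
  have f_Re: "f n z = Re (shifted (e n) \<rho> z * cnj (shifted (e n) \<rho> z))" for n z
    by (simp flip: f_c)
  have f_int: "integrable lborel (f n)" for n
    unfolding f_Re[abs_def] by (intro integrable_Re shifted_inner e0 r)
  have f_val: "(LINT z|lborel. f n z) = Re (pi * (D (\<rho> + of_real (e n)) / of_real (e n)))" for n
  proof -
    have "(LINT z|lborel. f n z) = Re (LINT z|lborel. shifted (e n) \<rho> z * cnj (shifted (e n) \<rho> z))"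
      unfolding f_Re by (intro integral_Re shifted_inner e0 r)
    also have "\<dots> = Re (pi * (D (\<rho> + of_real (e n)) + cnj (D (\<rho> + of_real (e n)))) / (2 * of_real (e n)))"
      by (simp add: shifted_inner(2)[OF e0 r r])
    also have "\<dots> = Re (pi * (D (\<rho> + of_real (e n)) / of_real (e n)))"
      using e0[of n] by (simp add: complex_add_cnj Re_divide_of_real flip: of_real_mult)
    finally show ?thesis .
  qed
  have "(\<lambda>n. Re (pi * (D (\<rho> + of_real (e n)) / of_real (e n)))) \<longlonglongrightarrow> Re (of_real pi * (1 / of_nat (xi_mult \<rho>) :: complex))"
    by (intro tendsto_Re tendsto_mult tendsto_const D_right_of_zero(1)[OF r e_lim e0])
  moreover have "Re (of_real pi * (1 / of_nat (xi_mult \<rho>) :: complex)) = pi / real (xi_mult \<rho>)"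
    by (metis Re_complex_of_real mult_1_right of_real_divide of_real_of_nat_eq times_divide_eq_right)
  ultimately have ilim: "(\<lambda>n. LINT z|lborel. f n z) \<longlonglongrightarrow> pi / real (xi_mult \<rho>)" unfolding f_val by simp
  have mono: "AE z in lborel. mono (\<lambda>n. f n z)"
  proof (rule AE_I2, rule monoI)
    fix z :: real and m n :: nat assume "m \<le> n"
    then have "e n \<le> e m" unfolding e_def by (intro divide_left_mono) auto
    then show "f m z \<le> f n z" unfolding f_def
      using e0[of n] by (intro power_mono shifted_norm_mono r) auto
  qed
  have lim: "AE z in lborel. (\<lambda>n. f n z) \<longlonglongrightarrow> (norm (mode \<rho> z))\<^sup>2"
    using AE_line_nonzero[of "1 / 2"]
    by eventually_elim (auto simp: f_def intro!: tendsto_power tendsto_norm shifted_tendsto e_lim r)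
  have pos: "AE z in lborel. 0 \<le> f n z" for n by (simp add: f_def)
  have u: "(\<lambda>z. (norm (mode \<rho> z))\<^sup>2) \<in> borel_measurable lborel" by measurable
  show "integrable lborel (\<lambda>z. (norm (mode \<rho> z))\<^sup>2)"
    by (rule integral_monotone_convergence_nonneg(1)[OF f_int mono pos lim ilim u])
  show "(LINT z|lborel. (norm (mode \<rho> z))\<^sup>2) = pi / real (xi_mult \<rho>)"
    by (rule integral_monotone_convergence_nonneg(2)[OF f_int mono pos lim ilim u])
qed

lemma mode_product_integrable:
  assumes r: "\<rho> \<in> Zeros" "\<rho>' \<in> Zeros"
  shows "integrable lborel (\<lambda>z. mode \<rho> z * cnj (mode \<rho>' z))"
proof (rule Bochner_Integration.integrable_bound)
  show "integrable lborel (\<lambda>z. ((norm (mode \<rho> z))\<^sup>2 + (norm (mode \<rho>' z))\<^sup>2) / 2)"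
    by (intro integrable_divide Bochner_Integration.integrable_add mode_norm r)
  show "AE z in lborel. norm (mode \<rho> z * cnj (mode \<rho>' z)) \<le> norm (((norm (mode \<rho> z))\<^sup>2 + (norm (mode \<rho>' z))\<^sup>2) / 2)"
    using norm_product_inverse_le[of "mode \<rho> _" _ "cnj (mode \<rho>' _)"] by (intro AE_I2) (simp add: abs_of_nonneg)
qed measurable

text \<open>The numerator of the shifted inner product tends to D(rho') + conj D(rho) = 0, while the
denominator tends to rho' - rho.\<close>

lemma mode_orthogonal:
  assumes r: "\<rho> \<in> Zeros" "\<rho>' \<in> Zeros" and ne: "\<rho> \<noteq> \<rho>'"
  shows "(LINT z|lborel. mode \<rho> z * cnj (mode \<rho>' z)) = 0"
proof -
  define e where "e n = 1 / real (Suc n)" for n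
  have e0: "e n > 0" for n by (simp add: e_def)
  have e_lim: "e \<longlonglongrightarrow> 0" unfolding e_def[abs_def] by real_asymp
  have le: "norm (shifted (e n) \<rho> z) \<le> norm (mode \<rho> z)" if "\<rho> \<in> Zeros" for n \<rho> z
    using shifted_norm_mono[OF that, of 0 "e n" z] e0[of n] by (simp add: shifted_def mode_def)
  have "(\<lambda>n. LINT z|lborel. shifted (e n) \<rho> z * cnj (shifted (e n) \<rho>' z)) \<longlonglongrightarrow> (LINT z|lborel. mode \<rho> z * cnj (mode \<rho>' z))"
  proof (rule integral_dominated_convergence[where w = "\<lambda>z. ((norm (mode \<rho> z))\<^sup>2 + (norm (mode \<rho>' z))\<^sup>2) / 2"])
    show "integrable lborel (\<lambda>z. ((norm (mode \<rho> z))\<^sup>2 + (norm (mode \<rho>' z))\<^sup>2) / 2)"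
      by (intro integrable_divide Bochner_Integration.integrable_add mode_norm r)
    show "AE z in lborel. (\<lambda>n. shifted (e n) \<rho> z * cnj (shifted (e n) \<rho>' z)) \<longlonglongrightarrow> mode \<rho> z * cnj (mode \<rho>' z)"
      using AE_line_nonzero[of "1 / 2"]
      by eventually_elim (intro tendsto_mult tendsto_cnj shifted_tendsto e_lim r)
    show "AE z in lborel. norm (shifted (e n) \<rho> z * cnj (shifted (e n) \<rho>' z)) \<le> ((norm (mode \<rho> z))\<^sup>2 + (norm (mode \<rho>' z))\<^sup>2) / 2" for n
      by (intro AE_I2 norm_product_inverse_le) (auto intro: le r)
  qed measurable
  moreover have "(\<lambda>n. LINT z|lborel. shifted (e n) \<rho> z * cnj (shifted (e n) \<rho>' z)) \<longlonglongrightarrow> pi * (0 + cnj 0) / (\<rho>' - \<rho> + 2 * of_real 0)"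
    unfolding shifted_inner(2)[OF e0 r] using ne by (intro tendsto_intros D_right_of_zero(2) r e_lim e0) auto
  ultimately show ?thesis using LIMSEQ_unique by fastforce
qed

lemma combination_norm:
  assumes F: "finite F" "F \<subseteq> Zeros"
  shows "integrable lborel (\<lambda>z. (norm (combination v F z))\<^sup>2)"
    and "(LINT z|lborel. (norm (combination v F z))\<^sup>2) = pi * (\<Sum>\<rho>\<in>F. real (xi_mult \<rho>) * (norm (v \<rho>))\<^sup>2)"
proof -
  define k where "k \<rho> = of_nat (xi_mult \<rho>) * v \<rho>" for \<rho>
  define I where "I z = (\<Sum>\<rho>\<in>F. \<Sum>\<rho>'\<in>F. k \<rho> * cnj (k \<rho>') * (mode \<rho> z * cnj (mode \<rho>' z)))" for z
  have eq: "complex_of_real ((norm (combination v F z))\<^sup>2) = I z" for z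
    unfolding complex_norm_square combination_def I_def k_def cnj_sum sum_product
    by (intro sum.cong refl) simp
  have Re: "(norm (combination v F z))\<^sup>2 = Re (I z)" for z by (simp flip: eq)
  have int_I: "integrable lborel I"
    unfolding I_def using F by (intro Bochner_Integration.integrable_sum integrable_mult_right mode_product_integrable) auto
  have "(LINT z|lborel. I z) = (\<Sum>\<rho>\<in>F. \<Sum>\<rho>'\<in>F. k \<rho> * cnj (k \<rho>') * (LINT z|lborel. mode \<rho> z * cnj (mode \<rho>' z)))"
  proof -
    have i: "integrable lborel (\<lambda>z. k \<rho> * cnj (k \<rho>') * (mode \<rho> z * cnj (mode \<rho>' z)))" if "\<rho> \<in> F" "\<rho>' \<in> F" for \<rho> \<rho>'
      using F that by (intro integrable_mult_right mode_product_integrable) auto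
    show ?thesis unfolding I_def using i by (simp add: Bochner_Integration.integral_sum Bochner_Integration.integrable_sum)
  qed
  also have "\<dots> = (\<Sum>\<rho>\<in>F. of_real (pi * (real (xi_mult \<rho>) * (norm (v \<rho>))\<^sup>2)))"
  proof (rule sum.cong[OF refl])
    fix \<rho> assume \<rho>: "\<rho> \<in> F"
    have "(\<Sum>\<rho>'\<in>F. k \<rho> * cnj (k \<rho>') * (LINT z|lborel. mode \<rho> z * cnj (mode \<rho>' z))) =
       (\<Sum>\<rho>'\<in>F. if \<rho>' = \<rho> then k \<rho> * cnj (k \<rho>) * (LINT z|lborel. mode \<rho> z * cnj (mode \<rho> z)) else 0)"
      using F \<rho> by (intro sum.cong refl) (auto simp: mode_orthogonal subset_iff)
    also have "\<dots> = k \<rho> * cnj (k \<rho>) * (LINT z|lborel. mode \<rho> z * cnj (mode \<rho> z))" using F \<rho> by simp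
    also have "(LINT z|lborel. mode \<rho> z * cnj (mode \<rho> z)) = of_real (pi / real (xi_mult \<rho>))"
    proof -
      have "(LINT z|lborel. mode \<rho> z * cnj (mode \<rho> z)) = (LINT z|lborel. complex_of_real ((norm (mode \<rho> z))\<^sup>2))"
        by (simp only: complex_norm_square)
      also have "\<dots> = of_real (LINT z|lborel. (norm (mode \<rho> z))\<^sup>2)" by (rule integral_complex_of_real)
      finally show ?thesis using mode_norm(2)[of \<rho>] \<rho> F by (simp add: subset_iff)
    qed
    also have "k \<rho> * cnj (k \<rho>) = of_real ((real (xi_mult \<rho>))\<^sup>2 * (norm (v \<rho>))\<^sup>2)"
      unfolding complex_norm_square[symmetric] k_def by (simp add: norm_mult power_mult_distrib)
    also have "of_real ((real (xi_mult \<rho>))\<^sup>2 * (norm (v \<rho>))\<^sup>2) * of_real (pi / real (xi_mult \<rho>)) =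
       complex_of_real (pi * (real (xi_mult \<rho>) * (norm (v \<rho>))\<^sup>2))"
    proof -
      have "xi_mult \<rho> \<noteq> 0" using xi_mult_pos[of \<rho>] \<rho> F by auto
      then have "(real (xi_mult \<rho>))\<^sup>2 * (norm (v \<rho>))\<^sup>2 * (pi / real (xi_mult \<rho>)) = pi * (real (xi_mult \<rho>) * (norm (v \<rho>))\<^sup>2)"
        by (simp add: power2_eq_square)
      then show ?thesis by (simp only: of_real_mult[symmetric])
    qed
    finally show "(\<Sum>\<rho>'\<in>F. k \<rho> * cnj (k \<rho>') * (LINT z|lborel. mode \<rho> z * cnj (mode \<rho>' z))) =
       of_real (pi * (real (xi_mult \<rho>) * (norm (v \<rho>))\<^sup>2))" .
  qed
  also have "\<dots> = of_real (pi * (\<Sum>\<rho>\<in>F. real (xi_mult \<rho>) * (norm (v \<rho>))\<^sup>2))"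
    by (simp only: of_real_sum[symmetric] sum_distrib_left)
  finally have val: "(LINT z|lborel. I z) = of_real (pi * (\<Sum>\<rho>\<in>F. real (xi_mult \<rho>) * (norm (v \<rho>))\<^sup>2))" .
  show "integrable lborel (\<lambda>z. (norm (combination v F z))\<^sup>2)" unfolding Re by (rule integrable_Re[OF int_I])
  show "(LINT z|lborel. (norm (combination v F z))\<^sup>2) = pi * (\<Sum>\<rho>\<in>F. real (xi_mult \<rho>) * (norm (v \<rho>))\<^sup>2)"
    unfolding Re integral_Re[OF int_I] val by simp
qed

end

section \<open>Norms of the functions G\<close>

lemma integral_Fatou_bound:
  fixes u :: "nat \<Rightarrow> real \<Rightarrow> real"
  assumes u: "\<And>n. integrable lborel (u n)" "\<And>n z. 0 \<le> u n z" "\<And>n. (LINT z|lborel. u n z) \<le> C"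
    and lim: "AE z in lborel. (\<lambda>n. u n z) \<longlonglongrightarrow> f z" and f: "f \<in> borel_measurable lborel" "\<And>z. 0 \<le> f z"
  shows "integrable lborel f" "(LINT z|lborel. f z) \<le> C"
proof -
  have "0 \<le> (LINT z|lborel. u 0 z)" by (intro Bochner_Integration.integral_nonneg u(2))
  then have C: "0 \<le> C" using u(3)[of 0] by (rule order_trans)
  have "(\<integral>\<^sup>+z. ennreal (f z) \<partial>lborel) = (\<integral>\<^sup>+z. liminf (\<lambda>n. ennreal (u n z)) \<partial>lborel)"
  proof (rule nn_integral_cong_AE)
    show "AE z in lborel. ennreal (f z) = liminf (\<lambda>n. ennreal (u n z))"
      using lim
    proof eventually_elim
      case (elim z)
      have "(\<lambda>n. ennreal (u n z)) \<longlonglongrightarrow> ennreal (f z)" using elim by (rule tendsto_ennrealI)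
      then show ?case by (intro lim_imp_Liminf[symmetric]) auto
    qed
  qed
  also have "\<dots> \<le> liminf (\<lambda>n. \<integral>\<^sup>+z. ennreal (u n z) \<partial>lborel)"
    by (rule nn_integral_liminf) (use u(1) in measurable)
  also have "\<dots> \<le> liminf (\<lambda>n. ennreal C)"
  proof (rule Liminf_mono, rule always_eventually, rule allI)
    fix n
    have "(\<integral>\<^sup>+z. ennreal (u n z) \<partial>lborel) = ennreal (LINT z|lborel. u n z)"
      using u by (intro nn_integral_eq_integral) auto
    then show "(\<integral>\<^sup>+z. ennreal (u n z) \<partial>lborel) \<le> ennreal C" using u(3)[of n] by (simp add: ennreal_leI)
  qed
  also have "\<dots> = ennreal C" by (simp add: Liminf_const)
  finally have le: "(\<integral>\<^sup>+z. ennreal (f z) \<partial>lborel) \<le> ennreal C" .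
  show int: "integrable lborel f"
    using f le by (intro integrableI_nonneg) (auto simp: less_top intro: le_less_trans)
  have "ennreal (LINT z|lborel. f z) \<le> ennreal C"
    using le nn_integral_eq_integral[OF int] f by simp
  then show "(LINT z|lborel. f z) \<le> C" using C by (simp add: ennreal_le_iff)
qed

text \<open>A substitute for the triangle inequality in L^2, with a weight t that tends to 0 at the end.\<close>

lemma square_norm_split:
  fixes x y :: complex
  assumes t: "t > 0"
  shows "(norm x)\<^sup>2 \<le> (1 + t) * (norm y)\<^sup>2 + (1 + 1 / t) * (norm (y - x))\<^sup>2"
proof -
  define a where "a = norm y"
  define b where "b = norm (y - x)"
  have "norm x \<le> a + b" using norm_triangle_ineq4[of y "y - x"] by (simp add: a_def b_def)
  then have "(norm x)\<^sup>2 \<le> (a + b)\<^sup>2" by (intro power_mono) auto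
  also have "(a + b)\<^sup>2 = (1 + t) * a\<^sup>2 + (1 + 1 / t) * b\<^sup>2 - (t * a - b)\<^sup>2 / t"
    using t by (simp add: field_simps power2_eq_square)
  also have "\<dots> \<le> (1 + t) * a\<^sup>2 + (1 + 1 / t) * b\<^sup>2" using t by simp
  finally show ?thesis by (simp add: a_def b_def)
qed

lemma holomorphic_Li_bracket:
  assumes "\<And>s. s \<in> A \<Longrightarrow> Xi s \<noteq> 0 \<and> s \<noteq> 0 \<and> s \<noteq> 1"
  shows "Li_bracket n holomorphic_on A"
  unfolding Li_bracket_def[abs_def] xi_logderiv_eq
  by (intro holomorphic_intros holomorphic_L) (use assms in auto)

lemma measurable_Li_bracket [measurable]: "Li_bracket n \<in> borel_measurable borel"
  unfolding Li_bracket_def[abs_def] xi_logderiv_eq by measurable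

lemma Zeros_upto_mono: "N \<le> M \<Longrightarrow> Zeros_upto N \<subseteq> Zeros_upto M"
  by (auto simp: Zeros_upto_def)

context
  assumes on_line: "\<And>\<rho>. \<rho> \<in> Zeros \<Longrightarrow> Re \<rho> = 1 / 2"
begin

text \<open>Both factors are holomorphic near such a point, so removing singularities has no effect there.
The excluded points form a countable set.\<close>

lemma G_eq:
  assumes X: "Xi (vline (1 / 2) z) \<noteq> 0"
  shows "G n z = D (vline (1 / 2) z) * Li_bracket n (vline (1 / 2) z)"
proof -
  define s where "s = vline (1 / 2) z"
  have s: "Re s = 1 / 2" by (simp add: s_def vline_def)
  then have s01: "s \<noteq> 0" "s \<noteq> 1" by auto
  have den: "Xi s + deriv Xi s \<noteq> 0" using D_denominator(2)[OF on_line, of s] X s by (simp add: s_def)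
  define U where "U = {s. Xi s \<noteq> 0} \<inter> {s. Xi s + deriv Xi s \<noteq> 0} \<inter> (- {0, 1})"
  have "open U" unfolding U_def
    by (intro open_Int open_Collect_neq continuous_intros continuous_Xi)
  moreover have "s \<in> U" using X den s01 by (simp add: U_def s_def)
  moreover have "(\<lambda>s. D s * Li_bracket n s) holomorphic_on U"
    unfolding D_def[abs_def]
    by (intro holomorphic_intros holomorphic_Xi holomorphic_Li_bracket
        holomorphic_on_subset[OF holomorphic_deriv[OF holomorphic_Xi open_UNIV]]) (auto simp: U_def)
  ultimately have an: "(\<lambda>s. D s * Li_bracket n s) analytic_on {s}" by (auto simp: analytic_at)
  have "H n = remove_sings (\<lambda>s. D s * Li_bracket n s)"
    unfolding H_def D_def Li_bracket_def riemann_xi_eq ..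
  moreover have "1 / 2 - \<i> * of_real z = s" by (simp add: s_def vline_def complex_eq_iff)
  ultimately have "G n z = remove_sings (\<lambda>s. D s * Li_bracket n s) s" by (simp only: G_def)
  also have "\<dots> = D s * Li_bracket n s" by (rule remove_sings_at_analytic[OF an])
  finally show ?thesis by (simp only: s_def)
qed

text \<open>On the critical line conj rho = 1 - rho, hence |1 - q^n|^2 = (1 - q^n)(1 - q^(-n)) = (1 - q^n) +
(1 - q^(-n)).\<close>

lemma li_term_norm_square:
  assumes r: "\<rho> \<in> Zeros"
  shows "complex_of_real ((norm (li_term n \<rho>))\<^sup>2) = 2 * li_pair n \<rho>"
proof -
  have r0: "\<rho> \<noteq> 0" "\<rho> \<noteq> 1" using Zeros_nonzero[OF r] by auto
  have c: "cnj \<rho> = 1 - \<rho>" by (rule cnj_zero[OF on_line r])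
  have "cnj (li_term n \<rho>) = li_term n (1 - \<rho>)" by (simp add: li_term_def c)
  then have "complex_of_real ((norm (li_term n \<rho>))\<^sup>2) = li_term n \<rho> * li_term n (1 - \<rho>)"
    by (simp only: complex_norm_square)
  also have "\<dots> = 2 * li_pair n \<rho>"
  proof -
    define q where "q = 1 - 1 / \<rho>"
    have q0: "q \<noteq> 0" using r0 by (simp add: q_def)
    have A: "li_term n (1 - \<rho>) = 1 - inverse q ^ n" by (simp add: li_term_def one_minus_inverse_reflect r0 q_def)
    have B: "li_term n \<rho> = 1 - q ^ n" by (simp add: li_term_def q_def)
    have C: "q ^ n * inverse q ^ n = 1" using q0 by (simp flip: power_mult_distrib)
    have "(1 - q ^ n) * (1 - inverse q ^ n) = 1 - q ^ n - inverse q ^ n + q ^ n * inverse q ^ n"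
      by (simp only: ring_distribs) simp
    then show ?thesis unfolding li_pair_def A B C by simp
  qed
  finally show ?thesis .
qed

text \<open>Finite sums of the orthogonal functions over the zeros in growing discs converge to G almost
everywhere, and their squared norms are pi times the partial sums of a series with sum 2
lambda_n. Fatou's lemma bounds the norm of G from above and shows that the differences tend to 0
in norm, which gives the bound from below.\<close>

theorem li_coeff_eq_norm:
  assumes n: "n \<ge> 1"
  shows "integrable lborel (\<lambda>z. (cmod (G n z))\<^sup>2) \<and>
    li_coeff n = of_real (1 / (2 * pi) * (LINT z|lborel. (cmod (G n z))\<^sup>2))"
proof -
  define v where "v = li_term n"
  define a where "a \<rho> = real (xi_mult \<rho>) * (norm (v \<rho>))\<^sup>2" for \<rho>
  have a0: "a \<rho> \<ge> 0" for \<rho> by (simp add: a_def)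
  have "((\<lambda>\<rho>. 2 * (of_nat (xi_mult \<rho>) * li_pair n \<rho>)) has_sum (2 * li_coeff n)) Zeros"
    by (intro has_sum_cmult_right li_coeff_has_sum)
  moreover have "2 * (of_nat (xi_mult \<rho>) * li_pair n \<rho>) = complex_of_real (a \<rho>)" if "\<rho> \<in> Zeros" for \<rho>
    using li_term_norm_square[OF that, of n] by (simp add: a_def v_def)
  ultimately have S0: "((\<lambda>\<rho>. complex_of_real (a \<rho>)) has_sum (2 * li_coeff n)) Zeros"
    by (rule has_sum_cong[THEN iffD1, rotated])
  define S where "S = Re (2 * li_coeff n)"
  have S: "(a has_sum S) Zeros" using has_sum_Re[OF S0] by (simp add: S_def)
  have "Im (2 * li_coeff n) = 0"
  proof (rule has_sum_unique)
    show "((\<lambda>_. 0 :: real) has_sum Im (2 * li_coeff n)) Zeros" using has_sum_Im[OF S0] by simp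
    show "((\<lambda>_. 0 :: real) has_sum 0) Zeros" by (rule has_sum_0) simp
  qed
  then have li_S: "li_coeff n = of_real (S / 2)" by (simp add: S_def complex_eq_iff)
  define SN where "SN N = (\<Sum>\<rho>\<in>Zeros_upto N. a \<rho>)" for N
  have SN_lim: "SN \<longlonglongrightarrow> S" using tendsto_sum_Zeros_upto[OF S] by (simp add: SN_def[abs_def])
  have SN_le: "SN N \<le> S" for N
    unfolding SN_def using finite_sum_le_has_sum[OF S finite_Zeros_upto Zeros_upto_subset] a0 by blast
  define g where "g z = D (vline (1 / 2) z) * Li_bracket n (vline (1 / 2) z)" for z
  have g_meas [measurable]: "g \<in> borel_measurable borel" unfolding g_def[abs_def] by measurable
  define c where "c N z = combination v (Zeros_upto N) z" for N z
  have c_meas [measurable]: "c N \<in> borel_measurable borel" for N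
    unfolding c_def[abs_def] by (rule measurable_combination)
  have c_int: "integrable lborel (\<lambda>z. (norm (c N z))\<^sup>2)" and c_val: "(LINT z|lborel. (norm (c N z))\<^sup>2) = pi * SN N" for N
    unfolding c_def SN_def a_def by (rule combination_norm[OF on_line finite_Zeros_upto Zeros_upto_subset], assumption)+
  have cd_int: "integrable lborel (\<lambda>z. (norm (c (N + M) z - c N z))\<^sup>2)"
    and cd_le: "(LINT z|lborel. (norm (c (N + M) z - c N z))\<^sup>2) \<le> pi * (S - SN N)" for N M
  proof -
    have sub: "Zeros_upto N \<subseteq> Zeros_upto (N + M)" by (rule Zeros_upto_mono) simp
    define F where "F = Zeros_upto (N + M) - Zeros_upto N"
    have F: "finite F" "F \<subseteq> Zeros" using finite_Zeros_upto Zeros_upto_subset by (auto simp: F_def)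
    have eq: "c (N + M) z - c N z = combination v F z" for z
      unfolding c_def combination_def F_def
      by (subst sum_diff[OF finite_Zeros_upto sub]) auto
    have "(\<Sum>\<rho>\<in>F. a \<rho>) = SN (N + M) - SN N"
      unfolding F_def SN_def by (rule sum_diff[OF finite_Zeros_upto sub])
    then have "(LINT z|lborel. (norm (combination v F z))\<^sup>2) = pi * (SN (N + M) - SN N)"
      using combination_norm(2)[OF on_line F, of v] by (simp add: a_def)
    then show "(LINT z|lborel. (norm (c (N + M) z - c N z))\<^sup>2) \<le> pi * (S - SN N)"
      unfolding eq using SN_le[of "N + M"] by simp
    show "integrable lborel (\<lambda>z. (norm (c (N + M) z - c N z))\<^sup>2)"
      unfolding eq by (rule combination_norm(1)[OF on_line F])
  qed
  have c_lim: "AE z in lborel. (\<lambda>N. c N z) \<longlonglongrightarrow> g z"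
    using AE_line_nonzero[of "1 / 2"]
  proof eventually_elim
    case (elim z)
    define s where "s = vline (1 / 2) z"
    have "Re s = 1 / 2" by (simp add: s_def vline_def)
    then have s01: "s \<noteq> 0" "s \<noteq> 1" by auto
    have "((\<lambda>\<rho>. D s * (of_nat (xi_mult \<rho>) * (li_term n \<rho> / (s - \<rho>)))) has_sum (D s * Li_bracket n s)) Zeros"
      using elim s01 by (intro has_sum_cmult_right Li_bracket_has_sum n) (auto simp: s_def)
    from tendsto_sum_Zeros_upto[OF this]
    have "(\<lambda>N. \<Sum>\<rho>\<in>Zeros_upto N. D s * (of_nat (xi_mult \<rho>) * (li_term n \<rho> / (s - \<rho>)))) \<longlonglongrightarrow> g z"
      by (simp add: g_def s_def)
    moreover have "(\<Sum>\<rho>\<in>Zeros_upto N. D s * (of_nat (xi_mult \<rho>) * (li_term n \<rho> / (s - \<rho>)))) = c N z" for N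
      unfolding c_def combination_def mode_def v_def s_def by (intro sum.cong refl) simp
    ultimately show ?case by (simp only:)
  qed
  have g_int: "integrable lborel (\<lambda>z. (norm (g z))\<^sup>2)" and g_le: "(LINT z|lborel. (norm (g z))\<^sup>2) \<le> pi * S"
  proof -
    have lim: "AE z in lborel. (\<lambda>N. (norm (c N z))\<^sup>2) \<longlonglongrightarrow> (norm (g z))\<^sup>2"
      using c_lim by eventually_elim (intro tendsto_intros)
    have le: "(LINT z|lborel. (norm (c N z))\<^sup>2) \<le> pi * S" for N
      unfolding c_val using SN_le[of N] by simp
    have m: "(\<lambda>z. (norm (g z))\<^sup>2) \<in> borel_measurable lborel" by measurable
    show "integrable lborel (\<lambda>z. (norm (g z))\<^sup>2)"
      by (rule integral_Fatou_bound(1)[OF c_int _ le lim m]) auto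
    show "(LINT z|lborel. (norm (g z))\<^sup>2) \<le> pi * S"
      by (rule integral_Fatou_bound(2)[OF c_int _ le lim m]) auto
  qed
  have gd_int: "integrable lborel (\<lambda>z. (norm (g z - c N z))\<^sup>2)"
    and gd_le: "(LINT z|lborel. (norm (g z - c N z))\<^sup>2) \<le> pi * (S - SN N)" for N
  proof -
    have lim: "AE z in lborel. (\<lambda>M. (norm (c (N + M) z - c N z))\<^sup>2) \<longlonglongrightarrow> (norm (g z - c N z))\<^sup>2"
      using c_lim
    proof eventually_elim
      case (elim z)
      then have "(\<lambda>M. c (M + N) z) \<longlonglongrightarrow> g z" by (rule LIMSEQ_ignore_initial_segment)
      then have "(\<lambda>M. c (N + M) z) \<longlonglongrightarrow> g z" by (simp add: add.commute)
      then show ?case by (intro tendsto_intros)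
    qed
    have m: "(\<lambda>z. (norm (g z - c N z))\<^sup>2) \<in> borel_measurable lborel" by measurable
    show "integrable lborel (\<lambda>z. (norm (g z - c N z))\<^sup>2)"
      by (rule integral_Fatou_bound(1)[OF cd_int _ cd_le lim m]) auto
    show "(LINT z|lborel. (norm (g z - c N z))\<^sup>2) \<le> pi * (S - SN N)"
      by (rule integral_Fatou_bound(2)[OF cd_int _ cd_le lim m]) auto
  qed
  define I where "I = (LINT z|lborel. (norm (g z))\<^sup>2)"
  have bound: "pi * S \<le> (1 + t) * I" if t: "t > 0" for t
  proof (rule LIMSEQ_le)
    show "(\<lambda>N. pi * SN N) \<longlonglongrightarrow> pi * S" by (intro tendsto_intros SN_lim)
    have "(\<lambda>N. (1 + t) * I + (1 + 1 / t) * (pi * (S - SN N))) \<longlonglongrightarrow> (1 + t) * I + (1 + 1 / t) * (pi * (S - S))"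
      by (intro tendsto_intros SN_lim)
    then show "(\<lambda>N. (1 + t) * I + (1 + 1 / t) * (pi * (S - SN N))) \<longlonglongrightarrow> (1 + t) * I" by simp
    have "pi * SN N \<le> (1 + t) * I + (1 + 1 / t) * (pi * (S - SN N))" for N
    proof -
      have "pi * SN N = (LINT z|lborel. (norm (c N z))\<^sup>2)" by (simp add: c_val)
      also have "\<dots> \<le> (LINT z|lborel. (1 + t) * (norm (g z))\<^sup>2 + (1 + 1 / t) * (norm (g z - c N z))\<^sup>2)"
        by (intro integral_mono c_int Bochner_Integration.integrable_add integrable_mult_right g_int gd_int square_norm_split t)
      also have "\<dots> = (1 + t) * I + (1 + 1 / t) * (LINT z|lborel. (norm (g z - c N z))\<^sup>2)"
        unfolding I_def by (simp add: g_int gd_int)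
      also have "\<dots> \<le> (1 + t) * I + (1 + 1 / t) * (pi * (S - SN N))"
        using t by (intro add_left_mono mult_left_mono gd_le) auto
      finally show ?thesis .
    qed
    then show "\<exists>N. \<forall>n\<ge>N. pi * SN n \<le> (1 + t) * I + (1 + 1 / t) * (pi * (S - SN n))" by blast
  qed
  have "pi * S \<le> I"
  proof (rule tendsto_lowerbound)
    show "((\<lambda>t. (1 + t) * I) \<longlongrightarrow> I) (at_right 0)" by (auto intro!: tendsto_eq_intros)
    show "\<forall>\<^sub>F t in at_right 0. pi * S \<le> (1 + t) * I"
      using eventually_at_right_less[of 0] by eventually_elim (rule bound)
  qed simp
  with g_le have I: "I = pi * S" by (simp add: I_def)
  have eq: "G n z = g z" if "Xi (vline (1 / 2) z) \<noteq> 0" for z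
    unfolding g_def by (rule G_eq[OF that])
  have G_meas: "G n \<in> borel_measurable lborel"
    by (rule measurable_discrete_difference[of g _ _ "{z. Xi (vline (1 / 2) z) = 0}"])
       (use countable_line_zeros eq in auto)
  then have G2_meas: "(\<lambda>z. (cmod (G n z))\<^sup>2) \<in> borel_measurable lborel" by measurable
  have AE_eq: "AE z in lborel. (cmod (G n z))\<^sup>2 = (norm (g z))\<^sup>2"
    using AE_line_nonzero[of "1 / 2"] by eventually_elim (simp add: eq)
  have m: "(\<lambda>z. (norm (g z))\<^sup>2) \<in> borel_measurable lborel" by measurable
  have "integrable lborel (\<lambda>z. (cmod (G n z))\<^sup>2)"
    by (rule integrable_cong_AE_imp[OF g_int G2_meas]) (use AE_eq in eventually_elim, simp)
  moreover have "(LINT z|lborel. (cmod (G n z))\<^sup>2) = I"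
    unfolding I_def by (rule integral_cong_AE[OF G2_meas m AE_eq])
  ultimately show ?thesis unfolding li_S I by simp
qed

end

theorem theorem1p1:
  shows "riemann_hypothesis \<longleftrightarrow>
    (\<forall>n::nat. n \<ge> 1 \<longrightarrow>
       integrable lborel (\<lambda>z::real. (cmod (G n z))\<^sup>2) \<and>
       li_coeff n = of_real (1 / (2 * pi) * (LINT z|lborel. (cmod (G n z))\<^sup>2)))"
proof (intro iffI allI impI)
  fix n :: nat assume "riemann_hypothesis" and n: "n \<ge> 1"
  then have on_line: "\<And>\<rho>. \<rho> \<in> Zeros \<Longrightarrow> Re \<rho> = 1 / 2"
    by (simp add: riemann_hypothesis_def nontrivial_zeta_zeros_eq Zeros_def)
  show "integrable lborel (\<lambda>z::real. (cmod (G n z))\<^sup>2) \<and>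
       li_coeff n = of_real (1 / (2 * pi) * (LINT z|lborel. (cmod (G n z))\<^sup>2))"
    by (rule li_coeff_eq_norm[OF on_line n])
next
  assume li: "\<forall>n::nat. n \<ge> 1 \<longrightarrow>
       integrable lborel (\<lambda>z::real. (cmod (G n z))\<^sup>2) \<and>
       li_coeff n = of_real (1 / (2 * pi) * (LINT z|lborel. (cmod (G n z))\<^sup>2))"
  show "riemann_hypothesis"
  proof (rule RH_if_li_nonneg)
    fix n :: nat assume "n \<ge> 1"
    then have "li_coeff n = of_real (1 / (2 * pi) * (LINT z|lborel. (cmod (G n z))\<^sup>2))" using li by blast
    moreover have "1 / (2 * pi) * (LINT z|lborel. (cmod (G n z))\<^sup>2) \<ge> 0"
      by (intro mult_nonneg_nonneg Bochner_Integration.integral_nonneg) auto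
    ultimately show "\<exists>a\<ge>0. li_coeff n = complex_of_real a" by blast
  qed
qed

end
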